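(* Let $\mathbf{G}$ be the Gurarij space and let $\mathrm{Iso}_L(\mathbf{G})$ be its group of linear isometries with the topology of pointwise convergence. Then $\mathrm{Iso}_L(\mathbf{G})$ is a universal Polish group: every Polish group is homeomorphic (as a topological group) to a subgroup of $\mathrm{Iso}_L(\mathbf{G})$. Moreover, every separable normed space $E$ admits a $g$-embedding into $\mathbf{G}$.
   Context: All normed spaces are over $\mathbf{R}$. For a metric space $X$, $\mathrm{Iso}(X)$ is its isometry group with the topology of pointwise convergence; for a normed space $E$, $\mathrm{Iso}_L(E)$ is its group of linear (surjective) isometries with the same topology. A Gurarij space is a separable Banach space $\mathbf{G}$ such that for every $\varepsilon>0$, every pair of finite-dimensional normed spaces $E\subseteq F$, and every linear isometric embedding $\psi\colon E\to\mathbf{G}$, there is a linear map $\varphi\colon F\to\mathbf{G}$ extending $\psi$ with $(1-\varepsilon)\|x\|\le\|\varphi x\|\le(1+\varepsilon)\|x\|$ for all $x\in F$; such a space exists and is unique up to linear isometry. An isometric embedding of metric spaces $X\subseteq Y$ is a $g$-embedding if there is a continuous group homomorphism $\Theta\colon\mathrm{Iso}(X)\to\mathrm{Iso}(Y)$ such that $\Theta\varphi$ extends $\varphi$ for every $\varphi\in\mathrm{Iso}(X)$. For an isometric linear embedding of normed spaces $E\subseteq F$ this is equivalent to the existence of a continuous homomorphism $\Theta\colon\mathrm{Iso}_L(E)\to\mathrm{Iso}_L(F)$ with $\Theta\varphi$ extending $\varphi$ for all $\varphi$. *)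

theory Defs
  imports "HOL-Analysis.Analysis" "HOL-Analysis.Finite_Function_Topology" "HOL-Algebra.Group"
begin

definition topological_group :: "('a, 'b) monoid_scheme \<Rightarrow> 'a topology \<Rightarrow> bool" where
  "topological_group G T \<longleftrightarrow>
     group G \<and> topspace T = carrier G \<and>
     continuous_map (prod_topology T T) T (\<lambda>(x, y). x \<otimes>\<^bsub>G\<^esub> y) \<and>
     continuous_map T T (\<lambda>x. inv\<^bsub>G\<^esub> x)"

definition polish_group :: "('a, 'b) monoid_scheme \<Rightarrow> 'a topology \<Rightarrow> bool" where
  "polish_group G T \<longleftrightarrow>
     topological_group G T \<and> completely_metrizable_space T \<and> separable_space T"

definition pointwise_topology :: "('a \<Rightarrow> 'b::topological_space) set \<Rightarrow> ('a \<Rightarrow> 'b) topology" where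
  "pointwise_topology S = subtopology (product_topology (\<lambda>_. euclidean) UNIV) S"

definition isometric_embedding :: "('x::metric_space \<Rightarrow> 'y::metric_space) \<Rightarrow> bool" where
  "isometric_embedding f \<longleftrightarrow> (\<forall>x y. dist (f x) (f y) = dist x y)"

definition Iso :: "('x::metric_space \<Rightarrow> 'x) monoid" where
  "Iso = \<lparr>carrier = {f. isometric_embedding f \<and> surj f}, mult = (\<circ>), one = id\<rparr>"

definition Iso_L :: "('e::real_normed_vector \<Rightarrow> 'e) monoid" where
  "Iso_L = Iso\<lparr>carrier := {f \<in> carrier Iso. linear f}\<rparr>"

definition g_embedding :: "('x::metric_space \<Rightarrow> 'y::metric_space) \<Rightarrow> bool" where
  "g_embedding i \<longleftrightarrow>
     isometric_embedding i \<and>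
     (\<exists>\<Theta>. \<Theta> \<in> hom (Iso :: ('x \<Rightarrow> 'x) monoid) (Iso :: ('y \<Rightarrow> 'y) monoid) \<and>
          continuous_map (pointwise_topology (carrier Iso)) (pointwise_topology (carrier Iso)) \<Theta> \<and>
          (\<forall>\<phi>\<in>carrier Iso. \<forall>x. \<Theta> \<phi> (i x) = i (\<phi> x)))"

definition norm_on :: "'v::real_vector set \<Rightarrow> ('v \<Rightarrow> real) \<Rightarrow> bool" where
  "norm_on V N \<longleftrightarrow>
     (\<forall>x\<in>V. N x \<ge> 0) \<and>
     (\<forall>x\<in>V. N x = 0 \<longleftrightarrow> x = 0) \<and>
     (\<forall>x\<in>V. \<forall>y\<in>V. N (x + y) \<le> N x + N y) \<and>
     (\<forall>c. \<forall>x\<in>V. N (c *\<^sub>R x) = \<bar>c\<bar> * N x)"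

definition linear_on :: "'v::real_vector set \<Rightarrow> ('v \<Rightarrow> 'w::real_vector) \<Rightarrow> bool" where
  "linear_on V f \<longleftrightarrow>
     (\<forall>x\<in>V. \<forall>y\<in>V. f (x + y) = f x + f y) \<and> (\<forall>c. \<forall>x\<in>V. f (c *\<^sub>R x) = c *\<^sub>R f x)"

text \<open>
  A definition cannot quantify over types, so the finite-dimensional normed spaces are presented as
  the finite-dimensional subspaces \<open>F\<close> of the space of finitely supported real sequences,
  each with an arbitrary norm \<open>N\<close> on \<open>F\<close>; every finite-dimensional normed space is
  linearly isometric to one of these. The norm that the library puts on \<open>(nat, real) poly_mapping\<close>
  plays no role. The subspace \<open>E\<close> carries the restriction of \<open>N\<close>.
\<close>

definition gurarij_space :: "'g::banach itself \<Rightarrow> bool" where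
  "gurarij_space _ \<longleftrightarrow>
     separable_space (euclidean :: 'g topology) \<and>
     (\<forall>\<epsilon>>0. \<forall>(E :: (nat, real) poly_mapping set) F N (\<psi> :: (nat, real) poly_mapping \<Rightarrow> 'g).
        subspace E \<and> subspace F \<and> E \<subseteq> F \<and> (\<exists>B. finite B \<and> F = span B) \<and> norm_on F N \<and>
        linear_on E \<psi> \<and> (\<forall>x\<in>E. norm (\<psi> x) = N x) \<longrightarrow>
        (\<exists>\<phi> :: (nat, real) poly_mapping \<Rightarrow> 'g.
           linear_on F \<phi> \<and> (\<forall>x\<in>E. \<phi> x = \<psi> x) \<and>
           (\<forall>x\<in>F. (1 - \<epsilon>) * N x \<le> norm (\<phi> x) \<and> norm (\<phi> x) \<le> (1 + \<epsilon>) * N x)))"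

end

theory Submission
  imports Defs
begin

text \<open>
  Let \<open>E\<close> be a separable normed space on which a group acts by linear isometries, and let \<open>B\<close> be the
  dual unit ball of \<open>E\<close>. Inside the space of bounded functions on \<open>B\<close>, which contains \<open>E\<close>, consider the functions
  \<open>\<lambda> \<mapsto> min\<^sub>i (\<lambda> w\<^sub>i + r\<^sub>i)\<close> with \<open>w\<^sub>i \<in> E\<close> and \<open>r\<^sub>i\<close> real. If \<open>x\<close> is a point of a one-point normed extension
  of \<open>E\<close> and \<open>r\<^sub>i\<close> is the distance from \<open>x\<close> to \<open>w\<^sub>i\<close>, then by the Hahn--Banach theorem this function has
  exactly the distances \<open>r\<^sub>i\<close> to the \<open>w\<^sub>i\<close>. Moreover it depends on the \<open>w\<^sub>i\<close> and \<open>r\<^sub>i\<close> in a Lipschitz way, and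
  equivariantly. So \<open>E\<close> together with these functions spans a separable normed space to which the action
  extends continuously and in which all one-point extensions of finite-dimensional subspaces of \<open>E\<close> are
  approximately realised. Iterating, one obtains a separable space \<open>W \<supseteq> E\<close> with an action of the group which
  approximately realises the one-point extensions of all its finite-dimensional subspaces. A
  back-and-forth argument embeds \<open>W\<close> isometrically onto a dense subspace of any Gurarij space, and the
  action extends to the closure.

  For the isometry group of \<open>E\<close> this gives the \<open>g\<close>-embedding, affine isometries being reduced to linear ones by
  the Mazur--Ulam theorem. A Polish group carries a bounded left-invariant compatible metric \<open>d\<close> by the Birkhoff--Kakutani
  theorem, and acts by translations on the separable span of the functions \<open>d(x, \<cdot>)\<close>.
\<close>

section \<open>Seminorms and the Hahn--Banach theorem\<close>

text \<open>The obstacle is equivariance: the choices of a back-and-forth argument do not commute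
  with a group action. So the action is built before any choice is made. A new point is not chosen
  but named by its data, and a group element acts by rewriting the base points inside the name; on
  the free vector space over the names the homomorphism law then holds identically. Every name is
  meaningful: whatever its numbers are, the minimum is a bounded function on the dual ball, so no
  consistency of distances has to be imposed, and the rewritten name is always available. Only then
  is the whole space embedded, with arbitrary choices, and the action on the dense image is carried
  over to the Gurarij space. All stages share one type of names, with seminorms in place of
  quotients.\<close>

definition seminorm :: "('v::real_vector \<Rightarrow> real) \<Rightarrow> bool" where
  "seminorm q \<longleftrightarrow> (\<forall>x y. q (x + y) \<le> q x + q y) \<and> (\<forall>c x. q (c *\<^sub>R x) = \<bar>c\<bar> * q x)"

lemma seminormI:
  assumes "\<And>x y. q (x + y) \<le> q x + q y" "\<And>c x. q (c *\<^sub>R x) = \<bar>c\<bar> * q x"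
  shows "seminorm q"
  using assms by (auto simp: seminorm_def)

lemma seminorm_add: "seminorm q \<Longrightarrow> q (x + y) \<le> q x + q y"
  by (auto simp: seminorm_def)

lemma seminorm_scaleR: "seminorm q \<Longrightarrow> q (c *\<^sub>R x) = \<bar>c\<bar> * q x"
  by (auto simp: seminorm_def)

lemma seminorm_zero: "seminorm q \<Longrightarrow> q 0 = 0"
  using seminorm_scaleR[of q 0 0] by simp

lemma seminorm_uminus: "seminorm q \<Longrightarrow> q (- x) = q x"
  using seminorm_scaleR[of q "-1" x] by simp

lemma seminorm_minus_commute: "seminorm q \<Longrightarrow> q (x - y) = q (y - x)"
  using seminorm_uminus[of q "x - y"] by simp

lemma seminorm_nonneg: "seminorm q \<Longrightarrow> 0 \<le> q x"
  using seminorm_add[of q x "-x"] by (simp add: seminorm_zero seminorm_uminus)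

lemma seminorm_diff: "seminorm q \<Longrightarrow> q (x - y) \<le> q x + q y"
  using seminorm_add[of q x "-y"] by (simp add: seminorm_uminus)

lemma seminorm_abs_diff: "seminorm q \<Longrightarrow> \<bar>q x - q y\<bar> \<le> q (x - y)"
  using seminorm_add[of q "x - y" y] seminorm_add[of q "y - x" x] seminorm_minus_commute[of q x y]
  by simp

lemma seminorm_sum:
  assumes "seminorm q" shows "q (sum f A) \<le> (\<Sum>i\<in>A. q (f i))"
proof (induction A rule: infinite_finite_induct)
  case (insert i A)
  then show ?case using seminorm_add[OF assms, of "f i" "sum f A"] by auto
qed (auto simp: seminorm_zero[OF assms])

lemma seminorm_sum_scaleR:
  assumes "seminorm q" shows "q (\<Sum>i\<in>A. c i *\<^sub>R f i) \<le> (\<Sum>i\<in>A. \<bar>c i\<bar> * q (f i))"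
  using seminorm_sum[OF assms, of "\<lambda>i. c i *\<^sub>R f i" A] by (simp add: seminorm_scaleR[OF assms])

lemma seminorm_norm: "seminorm (norm :: 'a::real_normed_vector \<Rightarrow> real)"
  by (auto simp: seminorm_def norm_triangle_ineq)

lemma seminorm_linear: "seminorm q \<Longrightarrow> linear f \<Longrightarrow> seminorm (\<lambda>x. q (f x))"
  by (auto simp: seminorm_def linear_add linear_scale)

lemma seminorm_plus: "seminorm q \<Longrightarrow> seminorm q' \<Longrightarrow> seminorm (\<lambda>x. q x + q' x)"
  by (auto simp: seminorm_def algebra_simps intro: add_mono)
     (smt (verit, ccfv_SIG) add_mono)

lemma abs_linear_le_seminorm:
  fixes f :: "'v::real_vector \<Rightarrow> real"
  assumes "seminorm q" "linear f" "\<And>x. f x \<le> q x"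
  shows "\<bar>f x\<bar> \<le> q x"
  using assms(3)[of x] assms(3)[of "-x"] by (simp add: seminorm_uminus[OF assms(1)] linear_neg[OF assms(2)])

definition sublinear :: "('v::real_vector \<Rightarrow> real) \<Rightarrow> bool" where
  "sublinear q \<longleftrightarrow> (\<forall>x y. q (x + y) \<le> q x + q y) \<and> (\<forall>c\<ge>0. \<forall>x. q (c *\<^sub>R x) = c * q x)"

lemma sublinear_add: "sublinear q \<Longrightarrow> q (x + y) \<le> q x + q y"
  and sublinear_scaleR: "sublinear q \<Longrightarrow> 0 \<le> c \<Longrightarrow> q (c *\<^sub>R x) = c * q x"
  by (auto simp: sublinear_def)

lemma sublinear_zero: "sublinear q \<Longrightarrow> q 0 = 0"
  using sublinear_scaleR[of q 0 0] by simp

lemma seminorm_imp_sublinear: "seminorm q \<Longrightarrow> sublinear q"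
  by (auto simp: seminorm_def sublinear_def)

text \<open>Tilting a sublinear functional along \<open>v\<close> makes it linear on the line of \<open>v\<close>; so a minimal sublinear
  functional is linear.\<close>

definition tilt :: "('v::real_vector \<Rightarrow> real) \<Rightarrow> 'v \<Rightarrow> 'v \<Rightarrow> real" where
  "tilt q v x = (INF t\<in>{0..}. q (x + t *\<^sub>R v) - t * q v)"

lemma
  assumes q: "sublinear q"
  shows tilt_le: "0 \<le> t \<Longrightarrow> tilt q v x \<le> q (x + t *\<^sub>R v) - t * q v"
    and sublinear_tilt: "sublinear (tilt q v)"
proof -
  \<comment> \<open>A lower bound independent of \<open>t\<close>, which makes the infimum
    finite.\<close>
  have low: "- q (- x) \<le> q (x + t *\<^sub>R v) - t * q v" if "0 \<le> t" for t x
    using sublinear_add[OF q, of "x + t *\<^sub>R v" "- x"] sublinear_scaleR[OF q that, of v] by simp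
  have bdd: "bdd_below ((\<lambda>t. q (x + t *\<^sub>R v) - t * q v) ` {0..})" for x
    using low by (intro bdd_belowI2[where m = "- q (- x)"]) auto
  show le: "tilt q v x \<le> q (x + t *\<^sub>R v) - t * q v" if "0 \<le> t" for t x
    unfolding tilt_def using that by (intro cINF_lower bdd) auto
  have ge: "m \<le> tilt q v x" if "\<And>t. 0 \<le> t \<Longrightarrow> m \<le> q (x + t *\<^sub>R v) - t * q v" for m x
    unfolding tilt_def using that by (intro cINF_greatest) auto
  have scale: "c * tilt q v x \<le> tilt q v (c *\<^sub>R x)" if c: "c > 0" for c x
  proof (rule ge)
    fix t :: real assume t: "0 \<le> t"
    have "tilt q v x \<le> q (x + (t / c) *\<^sub>R v) - (t / c) * q v" using t c by (intro le) auto
    then have "c * tilt q v x \<le> c * q (x + (t / c) *\<^sub>R v) - t * q v"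
      using c by (simp add: field_simps)
    also have "c * q (x + (t / c) *\<^sub>R v) = q (c *\<^sub>R x + t *\<^sub>R v)"
      using sublinear_scaleR[OF q, of c "x + (t / c) *\<^sub>R v"] c by (simp add: scaleR_add_right)
    finally show "c * tilt q v x \<le> q (c *\<^sub>R x + t *\<^sub>R v) - t * q v" .
  qed
  have zero: "tilt q v 0 = 0"
  proof (rule antisym)
    show "tilt q v 0 \<le> 0" using le[of 0 0] sublinear_zero[OF q] by simp
    show "0 \<le> tilt q v 0" by (rule ge) (simp add: sublinear_scaleR[OF q])
  qed
  show "sublinear (tilt q v)"
    unfolding sublinear_def
  proof (intro conjI allI impI)
    fix x y
    have "tilt q v (x + y) - tilt q v y \<le> tilt q v x"
    proof (rule ge)
      fix s :: real assume s: "0 \<le> s"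
      have "tilt q v (x + y) - (q (x + s *\<^sub>R v) - s * q v) \<le> tilt q v y"
      proof (rule ge)
        fix t :: real assume t: "0 \<le> t"
        \<comment> \<open>The parameters add up: \<open>s\<close> for \<open>x\<close> and
          \<open>t\<close> for \<open>y\<close> compete with \<open>s + t\<close> for
          \<open>x + y\<close>.\<close>
        have "q (x + y + (s + t) *\<^sub>R v) \<le> q (x + s *\<^sub>R v) + q (y + t *\<^sub>R v)"
          using sublinear_add[OF q, of "x + s *\<^sub>R v" "y + t *\<^sub>R v"] by (simp add: algebra_simps)
        then show "tilt q v (x + y) - (q (x + s *\<^sub>R v) - s * q v) \<le> q (y + t *\<^sub>R v) - t * q v"
          using le[of "s + t" "x + y"] s t by (simp add: algebra_simps)
      qed
      then show "tilt q v (x + y) - tilt q v y \<le> q (x + s *\<^sub>R v) - s * q v" by simp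
    qed
    then show "tilt q v (x + y) \<le> tilt q v x + tilt q v y" by simp
  next
    fix c x assume "0 \<le> (c::real)"
    show "tilt q v (c *\<^sub>R x) = c * tilt q v x"
    proof (cases "c = 0")
      case False
      with \<open>0 \<le> c\<close> have "c > 0" by simp
      with scale[of c x] scale[of "inverse c" "c *\<^sub>R x"] show ?thesis
        by (simp add: field_simps)
    qed (simp add: zero)
  qed
qed

lemma minimal_sublinear_is_linear:
  fixes q :: "'v::real_vector \<Rightarrow> real"
  assumes q: "sublinear q" and min: "\<And>r. sublinear r \<Longrightarrow> r \<le> q \<Longrightarrow> r = q"
  shows "linear q"
proof -
  have add: "q (x + y) = q x + q y" for x y
  proof (rule antisym)
    \<comment> \<open>Minimality turns \<open>tilt q y\<close> into \<open>q\<close> itself; its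
      bound at \<open>t = 1\<close> is then superadditivity.\<close>
    have "tilt q y \<le> q" using tilt_le[OF q, of 0 y] by (auto simp: le_fun_def)
    then have "tilt q y = q" by (intro min sublinear_tilt q)
    then show "q x + q y \<le> q (x + y)" using tilt_le[OF q, of 1 y x] by simp
  qed (rule sublinear_add[OF q])
  have neg: "q (- x) = - q x" for x using add[of x "-x"] sublinear_zero[OF q] by simp
  show ?thesis
  proof (rule linearI)
    fix c x show "q (c *\<^sub>R x) = c *\<^sub>R q x"
      using sublinear_scaleR[OF q, of c x] sublinear_scaleR[OF q, of "-c" "x"] neg[of "c *\<^sub>R x"]
      by (cases "0 \<le> c") auto
  qed (rule add)
qed

text \<open>Zorn's lemma for the reversed pointwise order. The infimum of a chain is finite because
  of \<open>- P (- x)\<close>, and subadditive because any two members of a chain have a member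
  below both.\<close>

lemma linear_below_sublinear:
  fixes P :: "'v::real_vector \<Rightarrow> real"
  assumes P: "sublinear P"
  obtains f where "linear f" "\<And>x. f x \<le> P x"
proof -
  define A where "A = {q. sublinear q \<and> q \<le> P}"
  have "\<exists>m\<in>A. \<forall>a\<in>A. m \<ge> a \<longrightarrow> a = m"
  proof (rule predicate_Zorn)
    show "partial_order_on A (relation_of (\<lambda>x y. x \<ge> y) A)"
      by (rule partial_order_on_relation_ofI) auto
    fix C assume C: "C \<in> Chains (relation_of (\<lambda>x y. x \<ge> y) A)"
    show "\<exists>u\<in>A. \<forall>a\<in>C. a \<ge> u"
    proof (cases "C = {}")
      case True
      then show ?thesis using P by (auto simp: A_def)
    next
      case False
      have CA: "C \<subseteq> A" and tot: "\<And>a b. a \<in> C \<Longrightarrow> b \<in> C \<Longrightarrow> a \<le> b \<or> b \<le> a"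
        using C unfolding Chains_def relation_of_def by blast+
      have low: "- P (- x) \<le> a x" if "a \<in> C" for a x
      proof -
        have "sublinear a" "a (- x) \<le> P (- x)" using that CA by (auto simp: A_def le_fun_def)
        then show ?thesis using sublinear_add[of a x "- x"] sublinear_zero[of a] by simp
      qed
      define u where "u x = (INF a\<in>C. a x)" for x
      have ule: "u x \<le> a x" if "a \<in> C" for a x
        unfolding u_def using that low by (intro cINF_lower bdd_belowI2[where m="- P (- x)"]) auto
      have uge: "m \<le> u x" if "\<And>a. a \<in> C \<Longrightarrow> m \<le> a x" for m x
        unfolding u_def using that False by (intro cINF_greatest) auto
      have sub: "sublinear a" if "a \<in> C" for a using that CA by (auto simp: A_def)
      have "sublinear u"
        unfolding sublinear_def
      proof (intro conjI allI impI)
        fix x y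
        have "u (x + y) - u y \<le> u x"
        proof (rule uge)
          fix a assume a: "a \<in> C"
          have "u (x + y) - a x \<le> u y"
          proof (rule uge)
            fix b assume b: "b \<in> C"
            obtain c where c: "c \<in> C" "c \<le> a" "c \<le> b" using tot[OF a b] a b by blast
            have "u (x + y) \<le> c x + c y" using ule[OF c(1), of "x + y"] sublinear_add[OF sub[OF c(1)], of x y] by simp
            also have "\<dots> \<le> a x + b y" using c by (intro add_mono) (auto simp: le_fun_def)
            finally show "u (x + y) - a x \<le> b y" by simp
          qed
          then show "u (x + y) - u y \<le> a x" by simp
        qed
        then show "u (x + y) \<le> u x + u y" by simp
      next
        fix c x assume c: "0 \<le> (c::real)"
        show "u (c *\<^sub>R x) = c * u x"
        proof (cases "c = 0")
          case True
          have "u 0 = (INF a\<in>C. 0)" unfolding u_def using sub sublinear_zero by (intro INF_cong) auto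
          then show ?thesis using True False by simp
        next
          case False
          with c have c: "c > 0" by simp
          show ?thesis
          proof (rule antisym)
            have "u (c *\<^sub>R x) / c \<le> u x"
              by (rule uge) (use ule[of _ "c *\<^sub>R x"] sublinear_scaleR[OF sub] c in \<open>fastforce simp: field_simps\<close>)
            then show "u (c *\<^sub>R x) \<le> c * u x" using c by (simp add: field_simps)
            show "c * u x \<le> u (c *\<^sub>R x)"
              by (rule uge) (use ule[of _ x] sublinear_scaleR[OF sub] c in fastforce)
          qed
        qed
      qed
      moreover have "u \<le> P"
      proof -
        obtain a where "a \<in> C" using False by auto
        then show ?thesis using ule[of a] CA by (auto simp: A_def le_fun_def intro: order_trans)
      qed
      ultimately show ?thesis using ule by (auto simp: A_def le_fun_def intro!: bexI[of _ u])
    qed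
  qed
  then obtain m where m: "sublinear m" "m \<le> P" and min: "\<And>a. sublinear a \<Longrightarrow> a \<le> P \<Longrightarrow> a \<le> m \<Longrightarrow> a = m"
    by (auto simp: A_def)
  have "linear m" using m min by (intro minimal_sublinear_is_linear) (auto intro: order_trans)
  then show ?thesis using m that by (auto simp: le_fun_def)
qed

text \<open>The functional is taken below \<open>tilt P v\<close> instead of \<open>P\<close>: this
  forces its value at \<open>- v\<close> to be at most \<open>- P v\<close>, hence its value at
  \<open>v\<close> to be the largest one allowed.\<close>

theorem norming_functional:
  fixes P :: "'v::real_vector \<Rightarrow> real"
  assumes P: "seminorm P"
  obtains f where "linear f" "\<And>x. \<bar>f x\<bar> \<le> P x" "f v = P v"
proof -
  have sP: "sublinear P" using P by (rule seminorm_imp_sublinear)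
  obtain f where f: "linear f" "\<And>x. f x \<le> tilt P v x"
    using linear_below_sublinear[OF sublinear_tilt[OF sP]] by blast
  have "f x \<le> P x" for x using f(2)[of x] tilt_le[OF sP, of 0 v x] by simp
  moreover have "f (- v) \<le> - P v" using f(2)[of "- v"] tilt_le[OF sP, of 1 v "- v"] sublinear_zero[OF sP] by simp
  ultimately have "f v = P v" using linear_neg[OF f(1), of v] by (intro antisym) auto
  then show ?thesis using that f(1) abs_linear_le_seminorm[OF P f(1)] \<open>\<And>x. f x \<le> P x\<close> by blast
qed

section \<open>Linear extension\<close>

abbreviation keys :: "('k \<Rightarrow>\<^sub>0 real) \<Rightarrow> 'k set" where "keys \<equiv> Poly_Mapping.keys"
abbreviation lookup :: "('k \<Rightarrow>\<^sub>0 real) \<Rightarrow> 'k \<Rightarrow> real" where "lookup \<equiv> Poly_Mapping.lookup"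
abbreviation single :: "'k \<Rightarrow> real \<Rightarrow> 'k \<Rightarrow>\<^sub>0 real" where "single \<equiv> Poly_Mapping.single"

lemma lookup_scaleR: "lookup (c *\<^sub>R x) i = c *\<^sub>R lookup x i"
proof -
  have "finite {i. c *\<^sub>R lookup x i \<noteq> 0}"
    by (rule finite_subset[OF _ finite_keys[of x]]) (auto simp: in_keys_iff)
  then show ?thesis by (simp add: scaleR_poly_mapping_def)
qed

abbreviation pt :: "'g \<Rightarrow> 'g \<Rightarrow>\<^sub>0 real" where "pt g \<equiv> single g 1"

text \<open>The finitely supported functions on the generators form the free vector space over them;
  this is its universal property.\<close>

definition linext :: "('g \<Rightarrow> 'v::real_vector) \<Rightarrow> ('g \<Rightarrow>\<^sub>0 real) \<Rightarrow> 'v" where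
  "linext f w = (\<Sum>g\<in>keys w. lookup w g *\<^sub>R f g)"

lemma linext_superset:
  assumes "finite A" "keys w \<subseteq> A"
  shows "linext f w = (\<Sum>g\<in>A. lookup w g *\<^sub>R f g)"
  unfolding linext_def using assms by (intro sum.mono_neutral_left) (auto simp: in_keys_iff)

lemma linear_linext: "linear (linext f)"
proof (rule linearI)
  fix x y :: "'a \<Rightarrow>\<^sub>0 real"
  let ?A = "keys x \<union> keys y"
  have "linext f (x + y) = (\<Sum>g\<in>?A. lookup (x + y) g *\<^sub>R f g)"
    by (intro linext_superset) (auto simp: keys_add)
  also have "\<dots> = (\<Sum>g\<in>?A. lookup x g *\<^sub>R f g) + (\<Sum>g\<in>?A. lookup y g *\<^sub>R f g)"
    by (simp add: lookup_add scaleR_add_left sum.distrib)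
  also have "\<dots> = linext f x + linext f y"
    by (simp add: linext_superset[of ?A x] linext_superset[of ?A y])
  finally show "linext f (x + y) = linext f x + linext f y" .
next
  fix c and x :: "'a \<Rightarrow>\<^sub>0 real"
  have "linext f (c *\<^sub>R x) = (\<Sum>g\<in>keys x. lookup (c *\<^sub>R x) g *\<^sub>R f g)"
    by (intro linext_superset) (auto simp: in_keys_iff lookup_scaleR)
  then show "linext f (c *\<^sub>R x) = c *\<^sub>R linext f x"
    by (simp add: lookup_scaleR linext_def scaleR_sum_right)
qed

lemma linext_single [simp]: "linext f (single g c) = c *\<^sub>R f g"
  by (simp add: linext_def)

lemma scaleR_pt: "c *\<^sub>R pt g = single g c"
  by (rule poly_mapping_eqI) (simp add: lookup_scaleR lookup_single when_def)

lemma linext_pt [simp]: "linext pt w = w"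
proof (rule poly_mapping_eqI)
  fix k
  show "lookup (linext pt w) k = lookup w k"
    by (simp add: linext_def scaleR_pt lookup_sum lookup_single when_def in_keys_iff)
qed

lemma linear_eq_linext:
  assumes "linear F" shows "F w = linext (\<lambda>g. F (pt g)) w"
proof -
  have "F (linext pt w) = linext (\<lambda>g. F (pt g)) w"
    unfolding linext_def by (simp only: linear_sum[OF assms] linear_scale[OF assms])
  then show ?thesis by simp
qed

lemma linext_cong: "(\<And>g. g \<in> keys w \<Longrightarrow> f g = f' g) \<Longrightarrow> linext f w = linext f' w"
  by (simp add: linext_def)

lemma linear_linext_comp: "linear F \<Longrightarrow> F (linext f w) = linext (\<lambda>g. F (f g)) w"
  by (simp add: linext_def linear_sum linear_scale)

lemma keys_linext:
  fixes f :: "'g \<Rightarrow> ('h \<Rightarrow>\<^sub>0 real)"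
  assumes "k \<in> keys (linext f w)"
  obtains g where "g \<in> keys w" "k \<in> keys (f g)"
proof -
  have "(\<Sum>g\<in>keys w. lookup w g * lookup (f g) k) \<noteq> 0"
    using assms by (simp add: in_keys_iff linext_def lookup_sum lookup_scaleR)
  then obtain g where "g \<in> keys w" "lookup w g * lookup (f g) k \<noteq> 0"
    by (rule sum.not_neutral_contains_not_neutral)
  then show ?thesis using that by (auto simp: in_keys_iff)
qed

text \<open>Completeness of the target lets values on a dense image be extended by limits; a kernel
  of \<open>S\<close> or of \<open>q\<close> does no harm, since \<open>K\<close> is measured by
  \<open>q\<close>. This produces the embedding of \<open>W\<close>, the action on the Gurarij
  space, and isometries from their values on a dense sequence.\<close>

theorem isometric_extension_dense:
  fixes S :: "'v::real_vector \<Rightarrow> 'x::real_vector" and K :: "'v \<Rightarrow> 'g::banach"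
  assumes q: "seminorm q" and S: "linear S" and K: "linear K"
    and iso: "\<And>v. norm (K v) = q (S v)"
    and dense: "\<And>x e. 0 < e \<Longrightarrow> \<exists>v. q (S v - x) < e"
  obtains T where "linear T" "\<And>x. norm (T x) = q x" "\<And>v. T (S v) = K v"
proof -
  have "\<exists>V. \<forall>n. q (S (V n) - x) < inverse (real (Suc n))" for x
    by (rule choice) (use dense in auto)
  then obtain V where V: "\<And>x n. q (S (V x n) - x) < inverse (real (Suc n))" by metis
  have q0: "0 \<le> q x" for x by (rule seminorm_nonneg[OF q])
  have V0: "(\<lambda>n. q (S (V x n) - x)) \<longlonglongrightarrow> 0" for x
    by (rule tendsto_sandwich[OF _ _ tendsto_const LIMSEQ_inverse_real_of_nat])
       (use V q0 in \<open>auto intro!: always_eventually less_imp_le\<close>)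
  have dK: "norm (K v - K v') \<le> q (S v - x) + q (S v' - x)" for v v' x
  proof -
    have "norm (K v - K v') = q ((S v - x) - (S v' - x))"
      using iso[of "v - v'"] by (simp add: linear_diff[OF S] linear_diff[OF K])
    then show ?thesis using seminorm_diff[OF q, of "S v - x" "S v' - x"] by simp
  qed
  have "Cauchy (\<lambda>n. K (V x n))" for x
  proof (rule metric_CauchyI)
    fix e :: real assume "e > 0"
    then obtain N where N: "\<And>n. n \<ge> N \<Longrightarrow> q (S (V x n) - x) < e / 2"
      using order_tendstoD(2)[OF V0, of "e/2"] by (auto simp: eventually_sequentially)
    show "\<exists>M. \<forall>m\<ge>M. \<forall>n\<ge>M. dist (K (V x m)) (K (V x n)) < e"
      using dK[of "V x _" "V x _" x] N by (intro exI[of _ N]) (smt (verit) dist_norm field_sum_of_halves)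
  qed
  then have "\<exists>L. (\<lambda>n. K (V x n)) \<longlonglongrightarrow> L" for x
    by (simp add: Cauchy_convergent convergentD)
  then obtain T where T: "\<And>x. (\<lambda>n. K (V x n)) \<longlonglongrightarrow> T x" by metis
  \<comment> \<open>Independence of the approximating sequence; each property of \<open>T\<close> is
    read off from a convenient one.\<close>
  have any: "(\<lambda>n. K (v n)) \<longlonglongrightarrow> T x" if "(\<lambda>n. q (S (v n) - x)) \<longlonglongrightarrow> 0" for v x
  proof -
    have "(\<lambda>n. q (S (v n) - x) + q (S (V x n) - x)) \<longlonglongrightarrow> 0"
      using tendsto_add[OF that V0] by simp
    then have "(\<lambda>n. K (v n) - K (V x n)) \<longlonglongrightarrow> 0"
      by (rule Lim_null_comparison[rotated]) (use dK in auto)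
    then show ?thesis using tendsto_add[OF _ T[of x]] by fastforce
  qed
  show ?thesis
  proof
    show "linear T"
    proof (rule linearI)
      fix x y
      have "(\<lambda>n. K (V x n + V y n)) \<longlonglongrightarrow> T (x + y)"
      proof (rule any, rule tendsto_sandwich[OF _ _ tendsto_const])
        show "(\<lambda>n. q (S (V x n) - x) + q (S (V y n) - y)) \<longlonglongrightarrow> 0"
          using tendsto_add[OF V0 V0] by simp
        show "\<forall>\<^sub>F n in sequentially. q (S (V x n + V y n) - (x + y)) \<le> q (S (V x n) - x) + q (S (V y n) - y)"
          using seminorm_add[OF q, of "S (V x _) - x" "S (V y _) - y"]
          by (simp add: linear_add[OF S] algebra_simps)
      qed (use q0 in auto)
      then have "(\<lambda>n. K (V x n) + K (V y n)) \<longlonglongrightarrow> T (x + y)" by (simp add: linear_add[OF K])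
      then show "T (x + y) = T x + T y"
        using LIMSEQ_unique tendsto_add[OF T T] by blast
    next
      fix c x
      have "(\<lambda>n. K (c *\<^sub>R V x n)) \<longlonglongrightarrow> T (c *\<^sub>R x)"
      proof (rule any)
        have "q (S (c *\<^sub>R V x n) - c *\<^sub>R x) = \<bar>c\<bar> * q (S (V x n) - x)" for n
          using seminorm_scaleR[OF q, of c "S (V x n) - x"] by (simp add: linear_scale[OF S] algebra_simps)
        then show "(\<lambda>n. q (S (c *\<^sub>R V x n) - c *\<^sub>R x)) \<longlonglongrightarrow> 0"
          using tendsto_mult_right_zero[OF V0, of "\<bar>c\<bar>"] by simp
      qed
      then have "(\<lambda>n. c *\<^sub>R K (V x n)) \<longlonglongrightarrow> T (c *\<^sub>R x)" by (simp add: linear_scale[OF K])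
      then show "T (c *\<^sub>R x) = c *\<^sub>R T x"
        using LIMSEQ_unique tendsto_scaleR[OF tendsto_const T] by blast
    qed
    show "norm (T x) = q x" for x
    proof (rule LIMSEQ_unique)
      show "(\<lambda>n. norm (K (V x n))) \<longlonglongrightarrow> norm (T x)" by (intro tendsto_norm T)
      have "(\<lambda>n. q (S (V x n)) - q x) \<longlonglongrightarrow> 0"
        by (rule Lim_null_comparison[OF _ V0[of x]]) (use seminorm_abs_diff[OF q] in auto)
      then show "(\<lambda>n. norm (K (V x n))) \<longlonglongrightarrow> q x" by (simp add: iso LIM_zero_iff)
    qed
    show "T (S v) = K v" for v
      using any[of "\<lambda>_. v" "S v"] by (simp add: seminorm_zero[OF q] LIMSEQ_const_iff)
  qed
qed

section \<open>The space of formal one-point extensions\<close>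

text \<open>The generator \<open>New n R l\<close> names a point adjoined at stage \<open>n\<close> whose distance to \<open>0\<close> is meant to be \<open>R\<close>
  and whose distance to the combination \<open>u\<close> is meant to be \<open>r\<close>, for \<open>(u, r)\<close> in \<open>l\<close>. A functional \<open>\<mu>\<close> on the
  space of stage \<open>n\<close> is extended to it by the largest value compatible with these distances (see \<open>ext\<close> below). The seminorm
  \<open>pn A n\<close> of stage \<open>n\<close> vanishes on the points adjoined at stages \<open>\<ge> n\<close>, so ill-founded data, with
  \<open>u\<close> involving later generators, are harmless.\<close>

datatype ('x, 'r) gen = Base 'x | New nat 'r "((('x, 'r) gen \<times> 'r) list \<times> 'r) list"

text \<open>\<open>New\<close> stores a combination of generators as a list, through which the
  datatype recurses. Different lists may have the same value, but only the value enters the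
  seminorms.\<close>

definition comb :: "('g \<times> real) list \<Rightarrow> ('g \<Rightarrow>\<^sub>0 real)" where
  "comb u = (\<Sum>(g, c)\<leftarrow>u. single g c)"

lemma comb_Nil [simp]: "comb [] = 0" and comb_Cons [simp]: "comb ((g, c) # u) = single g c + comb u"
  by (simp_all add: comb_def)

lemma surj_comb: "\<exists>u. comb u = w"
proof -
  obtain xs where xs: "set xs = keys w" "distinct xs" using finite_distinct_list[OF finite_keys[of w]] by blast
  have "comb (map (\<lambda>g. (g, lookup w g)) xs) = (\<Sum>g\<in>keys w. single g (lookup w g))"
    unfolding comb_def using xs by (simp add: o_def sum_list_distinct_conv_sum_set)
  also have "\<dots> = linext pt w" by (simp only: linext_def scaleR_pt)
  finally have "comb (map (\<lambda>g. (g, lookup w g)) xs) = w" by simp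
  then show ?thesis ..
qed

text \<open>The number \<open>R\<close> is the bound coming from the distance to the origin; it also
  gives a value to the empty list.\<close>

definition minval :: "real \<Rightarrow> real list \<Rightarrow> real" where "minval R zs = foldr min zs R"

lemma minval_le_mem: "z \<in> set zs \<Longrightarrow> minval R zs \<le> z"
  and minval_ge: "m \<le> R \<Longrightarrow> (\<And>z. z \<in> set zs \<Longrightarrow> m \<le> z) \<Longrightarrow> m \<le> minval R zs"
  by (induction zs) (auto simp: minval_def min_le_iff_disj)

text \<open>A minimum is a contraction for the maximum of the coordinate differences; the sum is a
  cruder bound that passes more easily through lists.\<close>

lemma minval_diff:
  "length zs = length zs' \<Longrightarrow>
    \<bar>minval R zs - minval R' zs'\<bar> \<le> \<bar>R - R'\<bar> + (\<Sum>(z, z')\<leftarrow>zip zs zs'. \<bar>z - z'\<bar>)"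
proof (induction zs zs' rule: list_induct2)
  case (Cons z zs z' zs')
  have "\<bar>minval R (z # zs) - minval R' (z' # zs')\<bar> \<le> \<bar>z - z'\<bar> + \<bar>minval R zs - minval R' zs'\<bar>"
  proof -
    have "\<bar>min a b - min c d\<bar> \<le> \<bar>a - c\<bar> + \<bar>b - d\<bar>" for a b c d :: real by linarith
    then show ?thesis by (simp add: minval_def)
  qed
  then show ?case using Cons.IH by simp
qed (simp add: minval_def)

lemma abs_minval_le: "\<bar>minval R zs\<bar> \<le> \<bar>R\<bar> + (\<Sum>z\<leftarrow>zs. \<bar>z\<bar>)"
proof -
  have "minval 0 (map (\<lambda>_. 0) zs) = 0" by (induction zs) (auto simp: minval_def)
  then show ?thesis
    using minval_diff[of zs "map (\<lambda>_. 0) zs" R 0] by (simp add: zip_map2 zip_same_conv_map o_def case_prod_unfold)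
qed

fun ext :: "nat \<Rightarrow> ((('x, real) gen \<Rightarrow>\<^sub>0 real) \<Rightarrow> real) \<Rightarrow> ('x, real) gen \<Rightarrow> real" where
  "ext n \<mu> (Base x) = \<mu> (pt (Base x))"
| "ext n \<mu> (New m R l) =
    (if m = n then minval R (map (\<lambda>(u, r). \<mu> (comb u) + r) l) else \<mu> (pt (New m R l)))"

text \<open>With \<open>F\<close> as a set of points and each generator \<open>g\<close> as the
  function sending \<open>f\<close> to \<open>f g\<close>, this is the sup norm pulled back to the
  free vector space.\<close>

definition supn :: "('g \<Rightarrow> real) set \<Rightarrow> ('g \<Rightarrow>\<^sub>0 real) \<Rightarrow> real" where
  "supn F w = (SUP f\<in>F. \<bar>linext f w\<bar>)"

definition pointwise_bounded :: "('g \<Rightarrow> real) set \<Rightarrow> bool" where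
  "pointwise_bounded F \<longleftrightarrow> F \<noteq> {} \<and> (\<forall>g. \<exists>B. \<forall>f\<in>F. \<bar>f g\<bar> \<le> B)"

lemma pointwise_bounded_bdd:
  assumes "pointwise_bounded F" shows "bdd_above ((\<lambda>f. \<bar>linext f w\<bar>) ` F)"
proof -
  obtain B where B: "\<And>g f. f \<in> F \<Longrightarrow> \<bar>f g\<bar> \<le> B g" using assms unfolding pointwise_bounded_def by metis
  show ?thesis
  proof (rule bdd_aboveI2)
    fix f assume "f \<in> F"
    have "\<bar>linext f w\<bar> \<le> (\<Sum>g\<in>keys w. \<bar>lookup w g * f g\<bar>)"
      unfolding linext_def by (simp add: sum_abs)
    also have "\<dots> \<le> (\<Sum>g\<in>keys w. \<bar>lookup w g\<bar> * B g)"
      by (intro sum_mono) (simp add: abs_mult mult_left_mono B \<open>f \<in> F\<close>)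
    finally show "\<bar>linext f w\<bar> \<le> (\<Sum>g\<in>keys w. \<bar>lookup w g\<bar> * B g)" .
  qed
qed

lemma supn_ge: "pointwise_bounded F \<Longrightarrow> f \<in> F \<Longrightarrow> \<bar>linext f w\<bar> \<le> supn F w"
  unfolding supn_def by (intro cSUP_upper pointwise_bounded_bdd)

lemma supn_le: "pointwise_bounded F \<Longrightarrow> (\<And>f. f \<in> F \<Longrightarrow> \<bar>linext f w\<bar> \<le> m) \<Longrightarrow> supn F w \<le> m"
  unfolding supn_def by (intro cSUP_least) (auto simp: pointwise_bounded_def)

lemma seminorm_supn:
  assumes F: "pointwise_bounded F" shows "seminorm (supn F)"
proof (rule seminormI)
  fix x y
  show "supn F (x + y) \<le> supn F x + supn F y"
  proof (rule supn_le[OF F])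
    fix f assume "f \<in> F"
    then show "\<bar>linext f (x + y)\<bar> \<le> supn F x + supn F y"
      using supn_ge[OF F, of f x] supn_ge[OF F, of f y] by (simp add: linear_add[OF linear_linext])
  qed
next
  fix c :: real and x
  have le: "supn F (c *\<^sub>R x) \<le> \<bar>c\<bar> * supn F x" for c x
    by (rule supn_le[OF F]) (simp add: linear_scale[OF linear_linext] abs_mult mult_left_mono supn_ge[OF F])
  show "supn F (c *\<^sub>R x) = \<bar>c\<bar> * supn F x"
  proof (cases "c = 0")
    case True
    obtain f where "f \<in> F" using F by (auto simp: pointwise_bounded_def)
    then have "0 \<le> supn F x" for x using supn_ge[OF F, of f x] by linarith
    then show ?thesis using True le[of 0 x] by (auto intro: antisym)
  next
    case False
    then show ?thesis using le[of c x] le[of "inverse c" "c *\<^sub>R x"] by (simp add: field_simps)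
  qed
qed

text \<open>Each stage is a set of points at which all generators are evaluated. The points of stage
  \<open>Suc n\<close> are the functionals in the dual unit ball of \<open>pn A n\<close>, so that
  the generators adjoined at stage \<open>n\<close> become functions on this ball.\<close>

fun fam :: "('x \<Rightarrow> real) set \<Rightarrow> nat \<Rightarrow> (('x, real) gen \<Rightarrow> real) set" where
  "fam A 0 = (\<lambda>a. case_gen a (\<lambda>_ _ _. 0)) ` A"
| "fam A (Suc n) = ext n ` {\<mu>. linear \<mu> \<and> (\<forall>w. \<bar>\<mu> w\<bar> \<le> supn (fam A n) w)}"

abbreviation pn :: "('x \<Rightarrow> real) set \<Rightarrow> nat \<Rightarrow> (('x, real) gen \<Rightarrow>\<^sub>0 real) \<Rightarrow> real" where
  "pn A n \<equiv> supn (fam A n)"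

text \<open>A combination involves finitely many generators, so the sequence is eventually constant
  (\<open>pW_eq\<close>); the limit spares the choice of a stage.\<close>

definition pW :: "('x \<Rightarrow> real) set \<Rightarrow> (('x, real) gen \<Rightarrow>\<^sub>0 real) \<Rightarrow> real" where
  "pW A w = lim (\<lambda>n. pn A n w)"

text \<open>The bound is strict because a point adjoined at stage \<open>m\<close> first acquires
  its meaning in \<open>pn A (Suc m)\<close>.\<close>

fun old :: "nat \<Rightarrow> ('x, 'r) gen \<Rightarrow> bool" where
  "old n (Base x) \<longleftrightarrow> True"
| "old n (New m R l) \<longleftrightarrow> m < n"

lemma old_mono: "old n g \<Longrightarrow> n \<le> m \<Longrightarrow> old m g"
  by (cases g) auto

lemma ex_old: "\<exists>n. old n g"
  by (cases g) auto

lemma finite_old: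
  fixes C :: "(('x, 'r) gen \<Rightarrow>\<^sub>0 real) set"
  assumes "finite C" shows "\<exists>n. \<forall>w\<in>C. \<forall>g\<in>keys w. old n g"
proof -
  obtain N where N: "\<And>g :: ('x, 'r) gen. old (N g) g" using ex_old by metis
  let ?K = "\<Union>w\<in>C. keys w"
  have "finite (N ` ?K)" using assms by auto
  then have "\<forall>g\<in>?K. N g \<le> Max (N ` ?K)" by simp
  then show ?thesis using N old_mono by (metis UN_I)
qed

lemma sum_list_tendsto_zero:
  fixes f :: "'b \<Rightarrow> 'i \<Rightarrow> real"
  shows "(\<And>x. x \<in> set xs \<Longrightarrow> (f x \<longlongrightarrow> 0) F) \<Longrightarrow> ((\<lambda>i. \<Sum>x\<leftarrow>xs. f x i) \<longlongrightarrow> 0) F"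
proof (induction xs)
  case (Cons x xs)
  have "((\<lambda>i. f x i + (\<Sum>x\<leftarrow>xs. f x i)) \<longlongrightarrow> 0 + 0) F"
    by (intro tendsto_add Cons) auto
  then show ?case by simp
qed auto

section \<open>The stages and their limit seminorm\<close>

locale base_family =
  fixes A :: "('x \<Rightarrow> real) set"
  assumes pointwise_bounded_A: "pointwise_bounded A"
begin

lemma pointwise_bounded_fam: "pointwise_bounded (fam A n)"
proof (induction n)
  case 0
  have "\<exists>B. \<forall>a\<in>A. \<bar>case g of Base x \<Rightarrow> a x | New _ _ _ \<Rightarrow> 0\<bar> \<le> B" for g :: "('x, real) gen"
    using pointwise_bounded_A by (cases g) (auto simp: pointwise_bounded_def)
  then show ?case using pointwise_bounded_A by (auto simp: pointwise_bounded_def)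
next
  case (Suc n)
  have "seminorm (pn A n)" using Suc by (rule seminorm_supn)
  then have "linear (\<lambda>_. 0::real) \<and> (\<forall>w. \<bar>0\<bar> \<le> pn A n w)"
    by (auto simp: seminorm_nonneg intro: linearI)
  then have "fam A (Suc n) \<noteq> {}" by force
  moreover have "\<exists>B. \<forall>f\<in>fam A (Suc n). \<bar>f g\<bar> \<le> B" for g
  proof (cases "\<exists>R l. g = New n R l")
    case True
    then obtain R l where g: "g = New n R l" by auto
    have "\<bar>ext n \<mu> g\<bar> \<le> \<bar>R\<bar> + (\<Sum>(u, r)\<leftarrow>l. pn A n (comb u) + \<bar>r\<bar>)"
      if \<mu>: "\<And>w. \<bar>\<mu> w\<bar> \<le> pn A n w" for \<mu>
    proof -
      have "\<bar>ext n \<mu> g\<bar> \<le> \<bar>R\<bar> + (\<Sum>(u, r)\<leftarrow>l. \<bar>\<mu> (comb u) + r\<bar>)"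
        using abs_minval_le[of R "map (\<lambda>(u, r). \<mu> (comb u) + r) l"] by (simp add: g o_def case_prod_unfold)
      also have "(\<Sum>(u, r)\<leftarrow>l. \<bar>\<mu> (comb u) + r\<bar>) \<le> (\<Sum>(u, r)\<leftarrow>l. pn A n (comb u) + \<bar>r\<bar>)"
        using \<mu> by (intro sum_list_mono) (auto intro!: order_trans[OF abs_triangle_ineq] add_right_mono)
      finally show ?thesis by simp
    qed
    then show ?thesis by auto
  next
    case False
    then have "ext n \<mu> g = \<mu> (pt g)" for \<mu> by (cases g) auto
    then show ?thesis by auto
  qed
  ultimately show ?case by (auto simp: pointwise_bounded_def)
qed

lemma seminorm_pn: "seminorm (pn A n)"
  by (intro seminorm_supn pointwise_bounded_fam)

text \<open>A functional dominated by \<open>pn A n\<close> vanishes on every generator on which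
  \<open>pn A n\<close> does, and \<open>ext n\<close> creates new values only at stage
  \<open>n\<close>.\<close>

lemma fam_not_old: "f \<in> fam A n \<Longrightarrow> \<not> old n g \<Longrightarrow> f g = 0"
proof (induction n arbitrary: f g)
  case 0
  then show ?case by (cases g) auto
next
  case (Suc n)
  then obtain \<mu> where \<mu>: "linear \<mu>" "\<And>w. \<bar>\<mu> w\<bar> \<le> pn A n w" "f = ext n \<mu>" by auto
  have "f g = \<mu> (pt g)" using Suc.prems(2) \<mu>(3) by (cases g) auto
  moreover have "\<not> old n g" using Suc.prems(2) old_mono[of n g "Suc n"] by auto
  then have "pn A n (pt g) \<le> 0"
    by (intro supn_le[OF pointwise_bounded_fam]) (simp add: Suc.IH)
  ultimately show ?case using \<mu>(2)[of "pt g"] by simp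
qed

text \<open>Dropping the younger generators converts \<open>pn A n\<close> into \<open>pW A\<close>
  (\<open>pW_trunc\<close>). In this way a functional bounded by \<open>pW A\<close> becomes a
  member of the dual ball of stage \<open>n\<close>.\<close>

definition trunc :: "nat \<Rightarrow> (('x, real) gen \<Rightarrow>\<^sub>0 real) \<Rightarrow> (('x, real) gen \<Rightarrow>\<^sub>0 real)" where
  "trunc n = linext (\<lambda>g. if old n g then pt g else 0)"

lemma linear_trunc: "linear (trunc n)"
  unfolding trunc_def by (rule linear_linext)

lemma trunc_old: "\<forall>g\<in>keys w. old n g \<Longrightarrow> trunc n w = w"
proof -
  assume "\<forall>g\<in>keys w. old n g"
  then have "trunc n w = linext pt w" unfolding trunc_def by (intro linext_cong) auto
  then show ?thesis by simp
qed

lemma keys_trunc: "g \<in> keys (trunc n w) \<Longrightarrow> old n g"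
  unfolding trunc_def by (erule keys_linext) (auto split: if_splits)

lemma pn_trunc: "pn A n (trunc n w) = pn A n w"
proof -
  have "linext f (trunc n w) = linext f w" if "f \<in> fam A n" for f
  proof -
    have "linext f (trunc n w) = linext (\<lambda>g. linext f (if old n g then pt g else 0)) w"
      unfolding trunc_def by (rule linear_linext_comp[OF linear_linext])
    also have "\<dots> = linext f w"
      by (rule linext_cong) (auto simp: fam_not_old[OF that] linear_0[OF linear_linext])
    finally show ?thesis .
  qed
  then show ?thesis unfolding supn_def by (intro SUP_cong) auto
qed

lemma ext_old: "old n g \<Longrightarrow> ext n \<mu> g = \<mu> (pt g)"
  by (cases g) auto

text \<open>On older generators \<open>ext n \<mu>\<close> agrees with \<open>\<mu>\<close>, and by
  Hahn--Banach the dual ball recovers the seminorm. So each stage sits isometrically in the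
  next.\<close>

lemma pn_Suc:
  assumes "\<forall>g\<in>keys w. old n g" shows "pn A (Suc n) w = pn A n w"
proof -
  have eq: "linext (ext n \<mu>) w = \<mu> w" if "linear \<mu>" for \<mu>
    using assms by (subst linear_eq_linext[OF that, of w], intro linext_cong) (auto simp: ext_old)
  show ?thesis
  proof (rule antisym)
    show "pn A (Suc n) w \<le> pn A n w"
      by (rule supn_le[OF pointwise_bounded_fam]) (auto simp: eq)
    obtain \<mu> where \<mu>: "linear \<mu>" "\<And>x. \<bar>\<mu> x\<bar> \<le> pn A n x" "\<mu> w = pn A n w"
      using norming_functional[OF seminorm_pn] by blast
    then have "\<bar>linext (ext n \<mu>) w\<bar> \<le> pn A (Suc n) w"
      by (intro supn_ge pointwise_bounded_fam) auto
    then show "pn A n w \<le> pn A (Suc n) w" using eq[OF \<mu>(1)] \<mu>(3) by simp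
  qed
qed

lemma pn_stable:
  assumes "\<forall>g\<in>keys w. old n g" "n \<le> m" shows "pn A m w = pn A n w"
  using assms(2)
proof (induction m rule: dec_induct)
  case (step m)
  then show ?case using pn_Suc[of w m] old_mono assms(1) by (metis less_imp_le)
qed simp

lemma pW_eq:
  assumes "\<forall>g\<in>keys w. old n g" shows "pW A w = pn A n w"
proof -
  have "\<forall>\<^sub>F m in sequentially. pn A m w = pn A n w"
    by (rule eventually_sequentiallyI[of n]) (rule pn_stable[OF assms])
  then have "(\<lambda>m. pn A m w) \<longlonglongrightarrow> pn A n w" by (rule tendsto_eventually)
  then show ?thesis by (simp add: pW_def limI)
qed

lemma pW_trunc: "pW A (trunc n w) = pn A n w"
  using pW_eq[of "trunc n w" n] keys_trunc[of _ n w] by (simp add: pn_trunc)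

lemma seminorm_pW: "seminorm (pW A)"
proof (rule seminormI)
  fix x y :: "('x, real) gen \<Rightarrow>\<^sub>0 real"
  obtain n where "\<forall>w\<in>{x, y, x + y}. \<forall>g\<in>keys w. old n g" using finite_old[of "{x, y, x + y}"] by auto
  then have "pW A x = pn A n x" "pW A y = pn A n y" "pW A (x + y) = pn A n (x + y)"
    by (auto intro!: pW_eq)
  then show "pW A (x + y) \<le> pW A x + pW A y" by (simp add: seminorm_add[OF seminorm_pn])
next
  fix c and x :: "('x, real) gen \<Rightarrow>\<^sub>0 real"
  obtain n where "\<forall>w\<in>{x, c *\<^sub>R x}. \<forall>g\<in>keys w. old n g" using finite_old[of "{x, c *\<^sub>R x}"] by auto
  then have "pW A x = pn A n x" "pW A (c *\<^sub>R x) = pn A n (c *\<^sub>R x)"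
    by (auto intro!: pW_eq)
  then show "pW A (c *\<^sub>R x) = \<bar>c\<bar> * pW A x" by (simp add: seminorm_scaleR[OF seminorm_pn])
qed

lemma pW_Base:
  "pW A (linext (\<lambda>x. pt (Base x)) v) = (SUP a\<in>A. \<bar>linext a v\<bar>)"
proof -
  have "\<forall>g\<in>keys (linext (\<lambda>x. pt (Base x)) v). old 0 g"
    by (auto elim!: keys_linext)
  then have "pW A (linext (\<lambda>x. pt (Base x)) v) = pn A 0 (linext (\<lambda>x. pt (Base x)) v)" by (rule pW_eq)
  moreover have "linext f (linext (\<lambda>x. pt (Base x)) v) = linext (\<lambda>x. f (Base x)) v" for f :: "('x, real) gen \<Rightarrow> real"
    using linear_linext_comp[OF linear_linext[of f], of "\<lambda>x. pt (Base x)" v] by simp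
  ultimately show ?thesis
    by (simp add: supn_def image_image)
qed

text \<open>For \<open>n \<le> m\<close> both generators are null; for larger \<open>n\<close>
  stability reduces the claim to \<open>Suc m\<close>, where the contraction property of
  \<open>minval\<close> applies. All continuity of the action, and separability, rest on this
  estimate.\<close>

lemma pn_New_diff:
  assumes "length l = length l'"
  shows "pn A n (pt (New m R l) - pt (New m R' l'))
    \<le> \<bar>R - R'\<bar> + (\<Sum>((u, r), (u', r'))\<leftarrow>zip l l'. pn A m (comb u - comb u') + \<bar>r - r'\<bar>)" (is "?L n \<le> ?B")
proof -
  have B0: "0 \<le> ?B"
    by (auto intro!: add_nonneg_nonneg sum_list_nonneg simp: seminorm_nonneg[OF seminorm_pn])
  show ?thesis
  proof (cases "n \<le> m")
    case True
    have "linext f (pt (New m R l) - pt (New m R' l')) = 0" if "f \<in> fam A n" for f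
      using True by (simp add: linear_diff[OF linear_linext] fam_not_old[OF that])
    then show ?thesis by (intro supn_le pointwise_bounded_fam) (use B0 in auto)
  next
    case False
    have "\<forall>g\<in>keys (pt (New m R l) - pt (New m R' l')). old (Suc m) g"
      using keys_diff[of "pt (New m R l)" "pt (New m R' l')"] by fastforce
    then have "?L n = ?L (Suc m)" using False by (intro pn_stable) auto
    also have "\<dots> \<le> ?B"
    proof (rule supn_le[OF pointwise_bounded_fam])
      fix f assume "f \<in> fam A (Suc m)"
      then obtain \<mu> where \<mu>: "linear \<mu>" "\<And>w. \<bar>\<mu> w\<bar> \<le> pn A m w" "f = ext m \<mu>" by auto
      let ?z = "map (\<lambda>(u, r). \<mu> (comb u) + r)"
      have "\<bar>linext f (pt (New m R l) - pt (New m R' l'))\<bar> = \<bar>minval R (?z l) - minval R' (?z l')\<bar>"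
        using \<mu>(3) by (simp add: linear_diff[OF linear_linext])
      also have "\<dots> \<le> \<bar>R - R'\<bar> + (\<Sum>(z, z')\<leftarrow>zip (?z l) (?z l'). \<bar>z - z'\<bar>)"
        by (rule minval_diff) (simp add: assms)
      also have "(\<Sum>(z, z')\<leftarrow>zip (?z l) (?z l'). \<bar>z - z'\<bar>)
          = (\<Sum>((u, r), (u', r'))\<leftarrow>zip l l'. \<bar>\<mu> (comb u - comb u') + (r - r')\<bar>)"
        unfolding zip_map_map map_map
        by (rule arg_cong[where f = sum_list], rule map_cong)
           (auto simp: linear_diff[OF \<mu>(1)] algebra_simps)
      also have "\<dots> \<le> (\<Sum>((u, r), (u', r'))\<leftarrow>zip l l'. pn A m (comb u - comb u') + \<bar>r - r'\<bar>)"
      proof (rule sum_list_mono, clarify)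
        fix u r u' r'
        show "\<bar>\<mu> (comb u - comb u') + (r - r')\<bar> \<le> pn A m (comb u - comb u') + \<bar>r - r'\<bar>"
          using \<mu>(2)[of "comb u - comb u'"] by linarith
      qed
      finally show "\<bar>linext f (pt (New m R l) - pt (New m R' l'))\<bar> \<le> ?B" by simp
    qed
    finally show ?thesis .
  qed
qed

end

section \<open>The action by renaming, its continuity, and the realisation of one-point
  extensions\<close>

lemma seminorm_sum_list:
  assumes "seminorm q" shows "q (\<Sum>x\<leftarrow>xs. f x) \<le> (\<Sum>x\<leftarrow>xs. q (f x))"
proof (induction xs)
  case (Cons x xs)
  then show ?case using seminorm_add[OF assms, of "f x" "\<Sum>x\<leftarrow>xs. f x"] by simp
qed (simp add: seminorm_zero[OF assms])

text \<open>Base points are renamed at every depth of a name, while stages, distances and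
  coefficients stay. Hence composition is respected exactly (\<open>act_comp\<close>).\<close>

definition act :: "('x \<Rightarrow> 'x) \<Rightarrow> (('x, real) gen \<Rightarrow>\<^sub>0 real) \<Rightarrow> (('x, real) gen \<Rightarrow>\<^sub>0 real)" where
  "act h = linext (\<lambda>g. pt (map_gen h (\<lambda>r. r) g))"

lemma linear_act: "linear (act h)"
  unfolding act_def by (rule linear_linext)

lemma act_single [simp]: "act h (single g c) = single (map_gen h (\<lambda>r. r) g) c"
  by (simp add: act_def scaleR_pt)

lemma act_comp: "act h (act h' w) = act (h \<circ> h') w"
proof -
  have "act h (act h' w) = linext (\<lambda>g. act h (pt (map_gen h' (\<lambda>r. r) g))) w"
    using linear_linext_comp[OF linear_act[of h], of "\<lambda>g. pt (map_gen h' (\<lambda>r. r) g)" w] by (simp add: act_def[of h'])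
  then show ?thesis by (simp add: act_def gen.map_comp o_def)
qed

lemma act_id: "act (\<lambda>x. x) w = w"
  by (simp add: act_def gen.map_ident)

lemma linext_act: "linext f (act h w) = linext (f \<circ> map_gen h (\<lambda>r. r)) w"
  using linear_linext_comp[OF linear_linext[of f], of "\<lambda>g. pt (map_gen h (\<lambda>r. r) g)" w]
  by (simp add: act_def o_def)

lemma act_comb: "act h (comb u) = comb (map (map_prod (map_gen h (\<lambda>r. r)) (\<lambda>r. r)) u)"
  by (induction u) (auto simp: linear_0[OF linear_act] linear_add[OF linear_act])

context base_family
begin

lemma pn_single_diff:
  "pn A n (single g c - single g' c')
    \<le> \<bar>c\<bar> * pn A n (pt g - pt g') + \<bar>c - c'\<bar> * pn A n (pt g')"
proof -
  have "single g c - single g' c' = c *\<^sub>R (pt g - pt g') + (c - c') *\<^sub>R pt g'"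
    by (rule poly_mapping_eqI) (simp add: lookup_add lookup_minus lookup_scaleR lookup_single when_def algebra_simps)
  then show ?thesis
    using seminorm_add[OF seminorm_pn, of n "c *\<^sub>R (pt g - pt g')" "(c - c') *\<^sub>R pt g'"]
    by (simp only: seminorm_scaleR[OF seminorm_pn])
qed

lemma pn_single_tendsto:
  assumes g: "((\<lambda>i. pn A n (pt (g i) - pt g0)) \<longlongrightarrow> 0) F" and c: "(c \<longlongrightarrow> c0) F"
  shows "((\<lambda>i. pn A n (single (g i) (c i) - single g0 c0)) \<longlongrightarrow> 0) F"
proof (rule tendsto_sandwich[OF _ _ tendsto_const])
  have "((\<lambda>i. \<bar>c i - c0\<bar>) \<longlongrightarrow> 0) F" using c by (simp add: LIM_zero tendsto_rabs_zero)
  then have "((\<lambda>i. \<bar>c i - c0\<bar> * pn A n (pt g0)) \<longlongrightarrow> 0) F" by (rule tendsto_mult_left_zero)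
  with tendsto_mult[OF tendsto_rabs[OF c] g]
  show "((\<lambda>i. \<bar>c i\<bar> * pn A n (pt (g i) - pt g0) + \<bar>c i - c0\<bar> * pn A n (pt g0)) \<longlongrightarrow> 0) F"
    using tendsto_add by fastforce
qed (intro always_eventually allI pn_single_diff seminorm_nonneg[OF seminorm_pn])+

lemma pn_comb_diff:
  "pn A n (comb (map (\<lambda>x. (f x, c x)) xs) - comb (map (\<lambda>x. (f' x, c' x)) xs))
    \<le> (\<Sum>x\<leftarrow>xs. pn A n (single (f x) (c x) - single (f' x) (c' x)))"
proof -
  have "comb (map (\<lambda>x. (f x, c x)) xs) - comb (map (\<lambda>x. (f' x, c' x)) xs)
      = (\<Sum>x\<leftarrow>xs. single (f x) (c x) - single (f' x) (c' x))"
    by (induction xs) (auto simp: algebra_simps)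
  then show ?thesis by (simp only: seminorm_sum_list[OF seminorm_pn])
qed

text \<open>Numbers may vary along with base points: the action keeps them fixed, but the
  construction of a countable dense set replaces them by rationals. The induction runs over all
  \<open>n\<close> at once, since the estimate for a generator of stage \<open>m\<close> uses
  \<open>pn A m\<close> on its components.\<close>

theorem map_gen_tendsto:
  fixes h :: "'i \<Rightarrow> 'y \<Rightarrow> 'x" and b :: "'i \<Rightarrow> 's \<Rightarrow> real"
  assumes h: "\<And>x n. ((\<lambda>i. pn A n (pt (Base (h i x)) - pt (Base (h0 x)))) \<longlongrightarrow> 0) F"
    and b: "\<And>r. ((\<lambda>i. b i r) \<longlongrightarrow> b0 r) F"
  shows "((\<lambda>i. pn A n (pt (map_gen (h i) (b i) g) - pt (map_gen h0 b0 g))) \<longlongrightarrow> 0) F"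
proof (induction g arbitrary: n)
  case (Base x)
  then show ?case using h by simp
next
  case (New m R l)
  define G G0 where "G i = map_gen (h i) (b i)" and "G0 = map_gen h0 b0" for i
  let ?d = "\<lambda>i g c. pn A m (single (G i g) (b i c) - single (G0 g) (b0 c))"
  let ?B = "\<lambda>i. \<bar>b i R - b0 R\<bar> + (\<Sum>(u, r)\<leftarrow>l. (\<Sum>(g, c)\<leftarrow>u. ?d i g c) + \<bar>b i r - b0 r\<bar>)"
  have b0: "((\<lambda>i. \<bar>b i r - b0 r\<bar>) \<longlongrightarrow> 0) F" for r
    using b[of r] by (simp add: LIM_zero tendsto_rabs_zero)
  have d0: "((\<lambda>i. ?d i g c) \<longlongrightarrow> 0) F" if "(u, r) \<in> set l" "(g, c) \<in> set u" for u r g c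
  proof (rule pn_single_tendsto[OF _ b])
    show "((\<lambda>i. pn A m (pt (G i g) - pt (G0 g))) \<longlongrightarrow> 0) F"
      using New.IH[OF that(1) _ that(2)] by (simp add: fsts.simps G_def G0_def)
  qed
  have "(?B \<longlongrightarrow> 0 + 0) F"
  proof (intro tendsto_add b0 sum_list_tendsto_zero)
    fix x assume x: "x \<in> set l"
    have "((\<lambda>i. (\<Sum>y\<leftarrow>fst x. ?d i (fst y) (snd y)) + \<bar>b i (snd x) - b0 (snd x)\<bar>) \<longlongrightarrow> 0 + 0) F"
      using d0[of "fst x" "snd x"] x by (intro tendsto_add b0 sum_list_tendsto_zero) auto
    then show "((\<lambda>i. case x of (u, r) \<Rightarrow> (\<Sum>(g, c)\<leftarrow>u. ?d i g c) + \<bar>b i r - b0 r\<bar>) \<longlongrightarrow> 0) F"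
      by (simp add: case_prod_unfold)
  qed
  then have B: "(?B \<longlongrightarrow> 0) F" by simp
  have "pn A n (pt (G i (New m R l)) - pt (G0 (New m R l))) \<le> ?B i" for i
  proof -
    let ?l = "\<lambda>g b. map (\<lambda>x. (map (\<lambda>y. (g (fst y), b (snd y))) (fst x), b (snd x))) l"
    have "G i (New m R l) = New m (b i R) (?l (G i) (b i))" "G0 (New m R l) = New m (b0 R) (?l G0 b0)"
      by (simp_all add: G_def G0_def map_prod_def case_prod_unfold)
    then have "pn A n (pt (G i (New m R l)) - pt (G0 (New m R l)))
        \<le> \<bar>b i R - b0 R\<bar> + (\<Sum>((u, r), (u', r'))\<leftarrow>zip (?l (G i) (b i)) (?l G0 b0). pn A m (comb u - comb u') + \<bar>r - r'\<bar>)"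
      by (simp only:) (rule pn_New_diff, simp)
    also have "\<dots> \<le> ?B i"
      unfolding zip_map_map zip_same_conv_map map_map
      by (intro add_left_mono sum_list_mono) (auto simp: case_prod_unfold pn_comb_diff)
    finally show ?thesis .
  qed
  then show ?case unfolding G_def[symmetric] G0_def[symmetric]
    by (intro tendsto_sandwich[OF _ _ tendsto_const B]) (auto intro!: always_eventually seminorm_nonneg[OF seminorm_pn])
qed

text \<open>Renaming inside a new generator only replaces each \<open>comb u\<close> by its image
  under \<open>act h\<close>, so it turns \<open>ext n \<mu>\<close> into
  \<open>ext n (\<mu> \<circ> act h)\<close>; by induction \<open>act h\<close> does not increase
  \<open>pn A n\<close>.\<close>

lemma fam_comp:
  assumes h: "\<And>a. a \<in> A \<Longrightarrow> a \<circ> h \<in> A"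
  shows "f \<in> fam A n \<Longrightarrow> f \<circ> map_gen h (\<lambda>r. r) \<in> fam A n"
proof (induction n arbitrary: f)
  case 0
  then obtain a where "a \<in> A" and f: "f = case_gen a (\<lambda>_ _ _. 0)" by auto
  have "f \<circ> map_gen h (\<lambda>r. r) = case_gen (a \<circ> h) (\<lambda>_ _ _. 0)"
  proof
    fix g show "(f \<circ> map_gen h (\<lambda>r. r)) g = case_gen (a \<circ> h) (\<lambda>_ _ _. 0) g" by (cases g) (auto simp: f)
  qed
  then show ?case unfolding fam.simps using h[OF \<open>a \<in> A\<close>] by (simp only: image_eqI)
next
  case (Suc n)
  then obtain \<mu> where \<mu>: "linear \<mu>" "\<And>w. \<bar>\<mu> w\<bar> \<le> pn A n w" and f: "f = ext n \<mu>" by auto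
  have "pn A n (act h w) \<le> pn A n w" for w
    by (rule supn_le[OF pointwise_bounded_fam]) (simp add: linext_act supn_ge[OF pointwise_bounded_fam] Suc.IH)
  then have "\<bar>\<mu> (act h w)\<bar> \<le> pn A n w" for w using \<mu>(2)[of "act h w"] by (rule order_trans[rotated])
  moreover have "linear (\<mu> \<circ> act h)" using linear_act \<mu>(1) by (rule linear_compose)
  moreover have "f \<circ> map_gen h (\<lambda>r. r) = ext n (\<mu> \<circ> act h)"
  proof
    fix g show "(f \<circ> map_gen h (\<lambda>r. r)) g = ext n (\<mu> \<circ> act h) g"
      by (cases g) (auto simp: f act_comb o_def case_prod_unfold map_prod_def)
  qed
  ultimately show ?case by auto
qed

lemma pn_act_le:
  assumes h: "\<And>a. a \<in> A \<Longrightarrow> a \<circ> h \<in> A" shows "pn A n (act h w) \<le> pn A n w"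
  by (rule supn_le[OF pointwise_bounded_fam]) (simp add: linext_act supn_ge[OF pointwise_bounded_fam] fam_comp[OF h])

lemma pW_eq_eventually: "\<forall>\<^sub>F n in sequentially. pW A w = pn A n w"
proof -
  obtain n where n: "\<forall>w'\<in>{w}. \<forall>g\<in>keys w'. old n g" using finite_old[of "{w}"] by auto
  show ?thesis
    by (rule eventually_sequentiallyI[of n]) (use n old_mono in \<open>auto intro!: pW_eq\<close>)
qed

lemma pW_act_le:
  assumes h: "\<And>a. a \<in> A \<Longrightarrow> a \<circ> h \<in> A" shows "pW A (act h w) \<le> pW A w"
proof -
  have "\<forall>\<^sub>F n in sequentially. pW A (act h w) \<le> pW A w"
    using pW_eq_eventually[of w] pW_eq_eventually[of "act h w"]
    by eventually_elim (simp add: pn_act_le[OF h])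
  then show ?thesis by simp
qed

text \<open>Renaming leaves the stage of a generator unchanged, so one \<open>n\<close> serves for
  all \<open>i\<close> and \<open>map_gen_tendsto\<close> applies generator by generator.\<close>

lemma pW_act_tendsto:
  assumes h: "\<And>x. ((\<lambda>i. pW A (pt (Base (h i x)) - pt (Base (h0 x)))) \<longlongrightarrow> 0) F"
  shows "((\<lambda>i. pW A (act (h i) w - act h0 w)) \<longlongrightarrow> 0) F"
proof -
  have old: "\<forall>g\<in>keys (pt (Base x) - pt (Base y) :: ('x, real) gen \<Rightarrow>\<^sub>0 real). old n g" for x y n
    using keys_diff[of "pt (Base x)" "pt (Base y) :: ('x, real) gen \<Rightarrow>\<^sub>0 real"] by fastforce
  have g: "((\<lambda>i. pW A (pt (map_gen (h i) (\<lambda>r. r) g) - pt (map_gen h0 (\<lambda>r. r) g))) \<longlongrightarrow> 0) F" for g :: "('x, real) gen"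
  proof -
    obtain n where n: "old n g" using ex_old by blast
    have "old n (map_gen k (\<lambda>r. r) g)" for k using n by (cases g) auto
    then have "\<forall>g'\<in>keys (pt (map_gen (h i) (\<lambda>r. r) g) - pt (map_gen h0 (\<lambda>r. r) g) :: ('x, real) gen \<Rightarrow>\<^sub>0 real). old n g'" for i
      using keys_diff[of "pt (map_gen (h i) (\<lambda>r. r) g)" "pt (map_gen h0 (\<lambda>r. r) g) :: ('x, real) gen \<Rightarrow>\<^sub>0 real"] by fastforce
    then have eq: "pW A (pt (map_gen (h i) (\<lambda>r. r) g) - pt (map_gen h0 (\<lambda>r. r) g)) = pn A n (pt (map_gen (h i) (\<lambda>r. r) g) - pt (map_gen h0 (\<lambda>r. r) g))" for i
      by (rule pW_eq)
    have pBase: "pW A (pt (Base x) - pt (Base y)) = pn A n (pt (Base x) - pt (Base y))" for x y n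
      by (rule pW_eq[OF old])
    have "((\<lambda>i. pn A n (pt (Base (h i x)) - pt (Base (h0 x)))) \<longlongrightarrow> 0) F" for x n
      using h[of x] by (simp only: pBase[of _ _ n])
    then show ?thesis
      unfolding eq by (rule map_gen_tendsto) simp
  qed
  show ?thesis
  proof (rule tendsto_sandwich[OF _ _ tendsto_const])
    have "((\<lambda>i. \<Sum>g\<in>keys w. \<bar>lookup w g\<bar> * pW A (pt (map_gen (h i) (\<lambda>r. r) g) - pt (map_gen h0 (\<lambda>r. r) g)))
       \<longlongrightarrow> (\<Sum>g\<in>keys w. \<bar>lookup w g\<bar> * 0)) F"
      by (intro tendsto_intros g)
    then show "((\<lambda>i. \<Sum>g\<in>keys w. \<bar>lookup w g\<bar> * pW A (pt (map_gen (h i) (\<lambda>r. r) g) - pt (map_gen h0 (\<lambda>r. r) g))) \<longlongrightarrow> 0) F"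
      by simp
    have "pW A (act (h i) w - act h0 w) \<le> (\<Sum>g\<in>keys w. \<bar>lookup w g\<bar> * pW A (pt (map_gen (h i) (\<lambda>r. r) g) - pt (map_gen h0 (\<lambda>r. r) g)))" for i
    proof -
      have "act (h i) w - act h0 w = (\<Sum>g\<in>keys w. lookup w g *\<^sub>R (pt (map_gen (h i) (\<lambda>r. r) g) - pt (map_gen h0 (\<lambda>r. r) g)))"
        by (simp add: act_def linext_def sum_subtractf scaleR_diff_right)
      then show ?thesis by (simp only: seminorm_sum_scaleR[OF seminorm_pW])
    qed
    then show "\<forall>\<^sub>F i in F. pW A (act (h i) w - act h0 w) \<le> (\<Sum>g\<in>keys w. \<bar>lookup w g\<bar> * pW A (pt (map_gen (h i) (\<lambda>r. r) g) - pt (map_gen h0 (\<lambda>r. r) g)))"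
      by simp
  qed (simp add: seminorm_nonneg[OF seminorm_pW])
qed

text \<open>\<open>P\<close> describes the one-point extension, with \<open>(0, 1)\<close> as the
  new point. Upper bound: by the triangle inequality for \<open>P\<close>, the values that a
  functional allows at the new point are compatible. Lower bound: a functional norming
  \<open>(w, 1)\<close> is restricted to \<open>W\<close>, and the greatest extension of the
  restriction is at least its own value at the new point.\<close>

theorem one_point_realisation:
  fixes P :: "(('x, real) gen \<Rightarrow>\<^sub>0 real) \<times> real \<Rightarrow> real"
  assumes C: "finite C" and P: "seminorm P" and P0: "\<And>w. P (w, 0) = pW A w"
  obtains v where "\<And>w. w \<in> C \<Longrightarrow> pW A (v + w) = P (w, 1)"
proof -
  obtain n where n: "\<And>w. w \<in> C \<Longrightarrow> \<forall>g\<in>keys w. old n g" using finite_old[OF C] by auto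
  obtain L where L: "set L = C" using finite_list[OF C] by auto
  \<comment> \<open>Negatives, because \<open>pW A (v + w)\<close> is the distance from
    \<open>v\<close> to \<open>- w\<close>.\<close>
  obtain rp :: "(('x, real) gen \<Rightarrow>\<^sub>0 real) \<Rightarrow> (('x, real) gen \<times> real) list" where rp: "\<And>w. comb (rp w) = - w"
    using choice[of "\<lambda>w u. comb u = - w"] surj_comb by blast
  \<comment> \<open>Stage \<open>n\<close> is late enough for all generators in \<open>C\<close> to
    be old.\<close>
  define v where "v = pt (New n (P (0, 1)) (map (\<lambda>w. (rp w, P (w, 1))) L))"
  have ext: "linext (ext n \<mu>) (v + w) = minval (P (0, 1)) (map (\<lambda>w'. P (w', 1) - \<mu> w') L) + \<mu> w"
    if \<mu>: "linear \<mu>" and w: "w \<in> C" for \<mu> w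
  proof -
    have "linext (ext n \<mu>) w = \<mu> w"
      using n[OF w] by (subst linear_eq_linext[OF \<mu>, of w], intro linext_cong) (auto simp: ext_old)
    then show ?thesis
      by (simp add: linear_add[OF linear_linext] v_def o_def rp linear_neg[OF \<mu>])
  qed
  have sum1: "P (w' - w, 0) \<le> P (w', 1) + P (w, 1)" for w w'
    using seminorm_diff[OF P, of "(w', 1)" "(w, 1)"] by simp
  have "pW A (v + w) = P (w, 1)" if w: "w \<in> C" for w
  proof -
    have "\<forall>g\<in>keys (v + w). old (Suc n) g"
      using keys_add[of v w] n[OF w] old_mono[of n _ "Suc n"] by (fastforce simp: v_def)
    then have "pW A (v + w) = pn A (Suc n) (v + w)" by (rule pW_eq)
    also have "\<dots> = P (w, 1)"
    proof (rule antisym)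
      show "pn A (Suc n) (v + w) \<le> P (w, 1)"
      proof (rule supn_le[OF pointwise_bounded_fam])
        fix f assume "f \<in> fam A (Suc n)"
        then obtain \<mu> where \<mu>: "linear \<mu>" "\<And>w. \<bar>\<mu> w\<bar> \<le> pn A n w" and f: "f = ext n \<mu>" by auto
        have "\<mu> w' - \<mu> w \<le> P (w', 1) + P (w, 1)" if "w' \<in> C \<or> w' = 0" for w'
        proof -
          have "\<forall>g\<in>keys (w' - w). old n g"
            using keys_diff[of w' w] n[OF w] n that by fastforce
          then have "pn A n (w' - w) = P (w' - w, 0)" by (simp add: pW_eq P0)
          then show ?thesis using \<mu>(2)[of "w' - w"] sum1[of w' w] by (simp add: linear_diff[OF \<mu>(1)])
        qed
        then have "- P (w, 1) - \<mu> w \<le> minval (P (0, 1)) (map (\<lambda>w'. P (w', 1) - \<mu> w') L)"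
          by (intro minval_ge) (fastforce simp: linear_0[OF \<mu>(1)] L)+
        moreover have "minval (P (0, 1)) (map (\<lambda>w'. P (w', 1) - \<mu> w') L) \<le> P (w, 1) - \<mu> w"
          by (rule minval_le_mem) (use w L in auto)
        ultimately show "\<bar>linext f (v + w)\<bar> \<le> P (w, 1)" by (simp add: f ext[OF \<mu>(1) w] abs_le_iff)
      qed
      obtain \<kappa> where \<kappa>: "linear \<kappa>" "\<And>z. \<bar>\<kappa> z\<bar> \<le> P z" "\<kappa> (w, 1) = P (w, 1)"
        using norming_functional[OF P] by blast
      \<comment> \<open>The restriction of \<open>\<kappa>\<close>, cut down to stage
        \<open>n\<close> so that \<open>pn A n\<close> dominates it.\<close>
      define \<mu> where "\<mu> z = \<kappa> (trunc n z, 0)" for z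
      have \<mu>: "linear \<mu>"
        unfolding \<mu>_def using linear_compose[OF linear_trunc, of "\<lambda>z. (z, 0::real)" n] \<kappa>(1)
        by (intro linear_compose[of "\<lambda>z. (trunc n z, 0)" \<kappa>, unfolded o_def])
           (auto intro!: linearI simp: linear_add[OF linear_trunc] linear_scale[OF linear_trunc])
      have "\<bar>\<mu> z\<bar> \<le> pn A n z" for z
        using \<kappa>(2)[of "(trunc n z, 0)"] by (simp add: \<mu>_def P0 pW_trunc)
      then have le: "\<bar>linext (ext n \<mu>) (v + w)\<bar> \<le> pn A (Suc n) (v + w)"
        using \<mu> by (intro supn_ge pointwise_bounded_fam) auto
      have split: "\<kappa> (w', 1) = \<mu> w' + \<kappa> (0, 1)" if "w' \<in> C" for w'
        using linear_add[OF \<kappa>(1), of "(w', 0)" "(0, 1)"] trunc_old[OF n[OF that]] by (simp add: \<mu>_def)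
      have "\<kappa> (0, 1) \<le> minval (P (0, 1)) (map (\<lambda>w'. P (w', 1) - \<mu> w') L)"
      proof (rule minval_ge)
        show "\<kappa> (0, 1) \<le> P (0, 1)" using \<kappa>(2)[of "(0, 1)"] by simp
        fix z assume "z \<in> set (map (\<lambda>w'. P (w', 1) - \<mu> w') L)"
        then obtain w' where "w' \<in> C" "z = P (w', 1) - \<mu> w'" using L by auto
        then show "\<kappa> (0, 1) \<le> z" using \<kappa>(2)[of "(w', 1)"] split by simp
      qed
      then show "P (w, 1) \<le> pn A (Suc n) (v + w)"
        using le ext[OF \<mu> w] split[OF w] \<kappa>(3) by simp
    qed
    finally show ?thesis .
  qed
  then show ?thesis using that by blast
qed

end

section \<open>The back-and-forth argument\<close>

text \<open>A pair \<open>(w, t)\<close> stands for \<open>w + t x\<close> with \<open>x\<close> the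
  adjoined point. Distances to finitely many points are met exactly; on a finite-dimensional
  subspace this becomes the approximation of \<open>one_point_approx\<close>.\<close>

definition one_point_property :: "('w::real_vector \<Rightarrow> real) \<Rightarrow> bool" where
  "one_point_property p \<longleftrightarrow> (\<forall>C P. finite C \<longrightarrow> seminorm P \<longrightarrow> (\<forall>w. P (w, 0) = p w) \<longrightarrow>
     (\<exists>v. \<forall>w\<in>C. p (v + w) = P (w, 1 :: real)))"

abbreviation lc :: "nat \<Rightarrow> (nat \<Rightarrow> real) \<Rightarrow> (nat \<Rightarrow> 'v::real_vector) \<Rightarrow> 'v" where
  "lc m c a \<equiv> (\<Sum>i<m. c i *\<^sub>R a i)"

lemma lc_diff: "lc m c a - lc m c' a = lc m (\<lambda>i. c i - c' i) a"
  by (simp add: sum_subtractf scaleR_diff_left)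

text \<open>By homogeneity the case \<open>t = 1\<close> decides. Coefficients up to
  \<open>K\<close> are rounded to a grid of mesh \<open>1 / K\<close> on which the distances are
  exact. If a coefficient exceeds \<open>K\<close>, both sides are close to
  \<open>p (lc m c a)\<close> compared with the allowed error.\<close>

lemma one_point_approx:
  fixes a :: "nat \<Rightarrow> 'w::real_vector" and \<eta> :: real
  assumes p: "seminorm p" and ext: "one_point_property p" and P: "seminorm P"
    and P0: "\<And>w. P (w, 0) = p w" and \<eta>: "0 < \<eta>"
  obtains v where "\<And>c t. \<bar>p (lc m c a + t *\<^sub>R v) - P (lc m c a, t)\<bar> \<le> \<eta> * ((\<Sum>i<m. \<bar>c i\<bar>) + \<bar>t\<bar>)"
proof -
  define S N1 where "S = (\<Sum>i<m. p (a i))" and "N1 = P (0, 1)"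
  have S0: "0 \<le> S" "0 \<le> N1" by (simp_all add: S_def N1_def sum_nonneg seminorm_nonneg[OF p] seminorm_nonneg[OF P])
  \<comment> \<open>One \<open>K\<close> serves two errors: rounding costs \<open>2 * S / K\<close>,
    and neglecting the new point costs \<open>2 * N1\<close>, to be absorbed by
    \<open>\<eta> * K\<close>.\<close>
  obtain K :: nat where K': "(2 * S + 2 * N1) / \<eta> + 1 < real K" using reals_Archimedean2 by blast
  moreover have "0 \<le> (2 * S + 2 * N1) / \<eta>" using S0 \<eta> by auto
  ultimately have Kpos: "0 < real K" by linarith
  have "(2 * S + 2 * N1) / \<eta> \<le> real K" using K' by simp
  then have K: "2 * S + 2 * N1 \<le> \<eta> * real K" using \<eta> by (simp add: field_simps)
  define Gr where "Gr = {..<m} \<rightarrow>\<^sub>E ((\<lambda>j. real_of_int j / real K) ` {- int (K * K)..int (K * K)})"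
  have finGr: "finite Gr" unfolding Gr_def by (intro finite_PiE) auto
  \<comment> \<open>The origin is added so that \<open>p v\<close> is known exactly.\<close>
  define C where "C = insert 0 ((\<lambda>c. lc m c a) ` Gr)"
  have "finite C" using finGr by (simp add: C_def)
  then obtain v where v: "\<And>w. w \<in> C \<Longrightarrow> p (v + w) = P (w, 1)"
    using ext P P0 unfolding one_point_property_def by meson
  have pv: "p v = N1" using v[of 0] by (simp add: C_def N1_def)
  have near: "\<bar>p (v + lc m c a) - P (lc m c a, 1)\<bar> \<le> \<eta>" if c: "\<And>i. i < m \<Longrightarrow> \<bar>c i\<bar> \<le> real K" for c
  proof -
    define g where "g i = (if i < m then real_of_int \<lfloor>c i * real K\<rfloor> / real K else undefined)" for i
    have "g \<in> Gr"
      unfolding Gr_def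
    proof (rule PiE_I)
      fix i assume "i \<in> {..<m}"
      then have "\<bar>c i\<bar> * real K \<le> real K * real K" using c by (intro mult_right_mono) auto
      then have "\<bar>c i * real K\<bar> \<le> real K * real K" by (simp add: abs_mult)
      then have "- (real K * real K) \<le> c i * real K" "c i * real K \<le> real K * real K" by (auto simp: abs_le_iff)
      then have "\<lfloor>c i * real K\<rfloor> \<in> {- int (K * K)..int (K * K)}"
        by (auto simp: le_floor_iff floor_le_iff)
      then show "g i \<in> (\<lambda>j. real_of_int j / real K) ` {- int (K * K)..int (K * K)}"
        using \<open>i \<in> {..<m}\<close> by (auto simp: g_def)
    qed (simp add: g_def)
    then have exact: "p (v + lc m g a) = P (lc m g a, 1)" by (intro v) (simp add: C_def)
    have "\<bar>c i - g i\<bar> \<le> 1 / real K" if "i < m" for i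
    proof -
      have "\<bar>c i * real K - real_of_int \<lfloor>c i * real K\<rfloor>\<bar> \<le> 1" by linarith
      moreover have "c i - g i = (c i * real K - real_of_int \<lfloor>c i * real K\<rfloor>) / real K"
        using that Kpos by (simp add: g_def field_simps)
      ultimately show ?thesis using Kpos by (simp add: divide_right_mono)
    qed
    then have "(\<Sum>i<m. \<bar>c i - g i\<bar> * p (a i)) \<le> (\<Sum>i<m. 1 / real K * p (a i))"
      by (intro sum_mono mult_right_mono seminorm_nonneg p) auto
    also have "\<dots> = S / real K" by (simp add: S_def sum_divide_distrib)
    finally have "p (lc m (\<lambda>i. c i - g i) a) \<le> S / real K"
      using seminorm_sum_scaleR[OF p, of "\<lambda>i. c i - g i" a "{..<m}"] by linarith
    then have d: "p (lc m c a - lc m g a) \<le> S / real K" by (simp only: lc_diff)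
    have "\<bar>p (v + lc m c a) - p (v + lc m g a)\<bar> \<le> S / real K"
      using seminorm_abs_diff[OF p, of "v + lc m c a" "v + lc m g a"] d by simp
    moreover have "\<bar>P (lc m c a, 1) - P (lc m g a, 1)\<bar> \<le> S / real K"
      using seminorm_abs_diff[OF P, of "(lc m c a, 1)" "(lc m g a, 1)"] d by (simp add: P0)
    moreover have "2 * (S / real K) \<le> \<eta>"
      using K S0 Kpos by (simp add: field_simps)
    ultimately show ?thesis using exact by linarith
  qed
  have "\<bar>p (lc m c a + t *\<^sub>R v) - P (lc m c a, t)\<bar> \<le> \<eta> * ((\<Sum>i<m. \<bar>c i\<bar>) + \<bar>t\<bar>)" for c t
  proof (cases "t = 0")
    case True
    then show ?thesis using \<eta> by (simp add: P0 sum_nonneg)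
  next
    case t: False
    have sum0: "0 \<le> (\<Sum>i<m. \<bar>c i\<bar>)" by (simp add: sum_nonneg)
    show ?thesis
    proof (cases "\<forall>i<m. \<bar>c i\<bar> \<le> real K * \<bar>t\<bar>")
      case True
      let ?c = "\<lambda>i. c i / t"
      have eq: "lc m c a = t *\<^sub>R lc m ?c a" using t by (simp add: scaleR_sum_right)
      have "p (lc m c a + t *\<^sub>R v) = \<bar>t\<bar> * p (v + lc m ?c a)"
        using seminorm_scaleR[OF p, of t "v + lc m ?c a"] eq by (simp add: scaleR_add_right add.commute)
      moreover have "P (lc m c a, t) = \<bar>t\<bar> * P (lc m ?c a, 1)"
        using seminorm_scaleR[OF P, of t "(lc m ?c a, 1)"] eq by simp
      ultimately have "\<bar>p (lc m c a + t *\<^sub>R v) - P (lc m c a, t)\<bar> = \<bar>t\<bar> * \<bar>p (v + lc m ?c a) - P (lc m ?c a, 1)\<bar>"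
        by (simp add: abs_mult flip: right_diff_distrib)
      also have "\<dots> \<le> \<bar>t\<bar> * \<eta>"
        using True t by (intro mult_left_mono near) (auto simp: field_simps)
      also have "\<dots> \<le> \<eta> * ((\<Sum>i<m. \<bar>c i\<bar>) + \<bar>t\<bar>)" using \<eta> sum0 by (simp add: algebra_simps)
      finally show ?thesis .
    next
      case False
      then obtain i where i: "i < m" "real K * \<bar>t\<bar> < \<bar>c i\<bar>" by force
      have "\<bar>p (lc m c a + t *\<^sub>R v) - p (lc m c a)\<bar> \<le> \<bar>t\<bar> * N1"
        using seminorm_abs_diff[OF p, of "lc m c a + t *\<^sub>R v" "lc m c a"] by (simp add: seminorm_scaleR[OF p] pv)
      moreover have "\<bar>P (lc m c a, t) - p (lc m c a)\<bar> \<le> \<bar>t\<bar> * N1"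
        using seminorm_abs_diff[OF P, of "(lc m c a, t)" "(lc m c a, 0)"] seminorm_scaleR[OF P, of t "(0, 1)"]
        by (simp add: P0 N1_def)
      ultimately have "\<bar>p (lc m c a + t *\<^sub>R v) - P (lc m c a, t)\<bar> \<le> \<bar>t\<bar> * (2 * N1)" by linarith
      also have "\<dots> \<le> \<bar>t\<bar> * (\<eta> * real K)" using K S0 by (intro mult_left_mono) auto
      also have "\<dots> = \<eta> * (real K * \<bar>t\<bar>)" by simp
      also have "\<dots> \<le> \<eta> * \<bar>c i\<bar>" using i \<eta> by (intro mult_left_mono) auto
      also have "\<dots> \<le> \<eta> * ((\<Sum>i<m. \<bar>c i\<bar>) + \<bar>t\<bar>)"
        using member_le_sum[of i "{..<m}" "\<lambda>i. \<bar>c i\<bar>"] i(1) \<eta> by (intro mult_left_mono) auto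
      finally show ?thesis .
    qed
  qed
  then show ?thesis using that by blast
qed

section \<open>Amalgamation along an almost isometric correspondence\<close>

lemma seminorm_INF:
  fixes \<phi> :: "'e \<Rightarrow> 'v::real_vector \<Rightarrow> real"
  assumes nonneg: "\<And>e x. 0 \<le> \<phi> e x"
    and add: "\<And>e e' x y. \<exists>e''. \<phi> e'' (x + y) \<le> \<phi> e x + \<phi> e' y"
    and scale: "\<And>c e x. \<exists>e'. \<phi> e' (c *\<^sub>R x) \<le> \<bar>c\<bar> * \<phi> e x"
  shows "seminorm (\<lambda>x. INF e. \<phi> e x)"
proof -
  let ?q = "\<lambda>x. INF e. \<phi> e x"
  have le: "?q x \<le> \<phi> e x" for e x by (intro cINF_lower bdd_belowI2[where m = 0]) (auto simp: nonneg)
  have ge: "m \<le> ?q x" if "\<And>e. m \<le> \<phi> e x" for m x using that by (intro cINF_greatest) auto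
  have sc: "?q (c *\<^sub>R x) \<le> \<bar>c\<bar> * ?q x" for c x
  proof (cases "c = 0")
    case True
    obtain e' where "\<phi> e' (c *\<^sub>R x) \<le> \<bar>c\<bar> * \<phi> undefined x" using scale by blast
    then show ?thesis using True le[of "c *\<^sub>R x" e'] by simp
  next
    case False
    have "?q (c *\<^sub>R x) / \<bar>c\<bar> \<le> ?q x"
    proof (rule ge)
      fix e obtain e' where "\<phi> e' (c *\<^sub>R x) \<le> \<bar>c\<bar> * \<phi> e x" using scale by blast
      then show "?q (c *\<^sub>R x) / \<bar>c\<bar> \<le> \<phi> e x" using le[of "c *\<^sub>R x" e'] False by (simp add: field_simps)
    qed
    then show ?thesis using False by (simp add: field_simps)
  qed
  show ?thesis
  proof (rule seminormI)
    fix x y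
    have "?q (x + y) - ?q y \<le> ?q x"
    proof (rule ge)
      fix e
      have "?q (x + y) - \<phi> e x \<le> ?q y"
      proof (rule ge)
        fix e' obtain e'' where "\<phi> e'' (x + y) \<le> \<phi> e x + \<phi> e' y" using add by blast
        then show "?q (x + y) - \<phi> e x \<le> \<phi> e' y" using le[of "x + y" e''] by linarith
      qed
      then show "?q (x + y) - ?q y \<le> \<phi> e x" by linarith
    qed
    then show "?q (x + y) \<le> ?q x + ?q y" by linarith
  next
    fix c x
    show "?q (c *\<^sub>R x) = \<bar>c\<bar> * ?q x"
    proof (cases "c = 0")
      case True
      then show ?thesis using sc[of 0 x] ge[of 0 "0"] nonneg by (auto intro: antisym)
    next
      case False
      then show ?thesis using sc[of c x] sc[of "inverse c" "c *\<^sub>R x"] by (simp add: field_simps)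
    qed
  qed
qed

text \<open>The error is measured by the coefficients and not by the vectors, so that the
  \<open>a i\<close> and the \<open>b i\<close> may be linearly dependent.\<close>

definition correlated :: "('w::real_vector \<Rightarrow> real) \<Rightarrow> real \<Rightarrow> nat \<Rightarrow> (nat \<Rightarrow> 'w) \<Rightarrow> (nat \<Rightarrow> 'g::real_normed_vector) \<Rightarrow> bool" where
  "correlated p \<delta> m a b \<longleftrightarrow> (\<forall>c. \<bar>p (lc m c a) - norm (lc m c b)\<bar> \<le> \<delta> * (\<Sum>i<m. \<bar>c i\<bar>))"

lemma correlatedD: "correlated p \<delta> m a b \<Longrightarrow> \<bar>p (lc m c a) - norm (lc m c b)\<bar> \<le> \<delta> * (\<Sum>i<m. \<bar>c i\<bar>)"
  by (simp add: correlated_def)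

lemma correlated_cong:
  assumes "\<And>i. i < m \<Longrightarrow> a i = a' i" "\<And>i. i < m \<Longrightarrow> b i = b' i"
  shows "correlated p \<delta> m a b \<longleftrightarrow> correlated p \<delta> m a' b'"
proof -
  have "lc m c a = lc m c a'" "lc m c b = lc m c b'" for c using assms by (auto intro!: sum.cong)
  then show ?thesis by (simp add: correlated_def)
qed

text \<open>The amalgam glues \<open>a i\<close> to \<open>b i\<close> at distance \<open>\<delta>\<close>: this is the largest seminorm with that property
  which is dominated by the given ones on the two summands.\<close>

definition amalgam :: "('w::real_vector \<Rightarrow> real) \<Rightarrow> real \<Rightarrow> nat \<Rightarrow> (nat \<Rightarrow> 'w) \<Rightarrow> (nat \<Rightarrow> 'g::real_normed_vector) \<Rightarrow> 'w \<times> 'g \<Rightarrow> real" where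
  "amalgam p \<delta> m a b z =
    (INF e. p (fst z - lc m e a) + \<delta> * (\<Sum>i<m. \<bar>e i\<bar>) + norm (snd z + lc m e b))"

context
  fixes p :: "'w::real_vector \<Rightarrow> real" and \<delta> :: real and m :: nat
    and a :: "nat \<Rightarrow> 'w" and b :: "nat \<Rightarrow> 'g::real_normed_vector"
  assumes p: "seminorm p" and \<delta>: "0 \<le> \<delta>" and corr: "correlated p \<delta> m a b"
begin

lemma seminorm_amalgam: "seminorm (amalgam p \<delta> m a b)"
  unfolding amalgam_def
proof (rule seminorm_INF)
  fix e :: "nat \<Rightarrow> real" and z :: "'w \<times> 'g"
  show "0 \<le> p (fst z - lc m e a) + \<delta> * (\<Sum>i<m. \<bar>e i\<bar>) + norm (snd z + lc m e b)"
    by (intro add_nonneg_nonneg mult_nonneg_nonneg seminorm_nonneg[OF p] \<delta> sum_nonneg) auto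
next
  fix e e' :: "nat \<Rightarrow> real" and x y :: "'w \<times> 'g"
  let ?e = "\<lambda>i. e i + e' i"
  have "lc m ?e a = lc m e a + lc m e' a" "lc m ?e b = lc m e b + lc m e' b"
    by (simp_all add: scaleR_add_left sum.distrib)
  then have "p (fst (x + y) - lc m ?e a) \<le> p (fst x - lc m e a) + p (fst y - lc m e' a)"
    "norm (snd (x + y) + lc m ?e b) \<le> norm (snd x + lc m e b) + norm (snd y + lc m e' b)"
    using seminorm_add[OF p, of "fst x - lc m e a" "fst y - lc m e' a"]
      norm_triangle_ineq[of "snd x + lc m e b" "snd y + lc m e' b"] by (simp_all add: algebra_simps)
  moreover have "\<delta> * (\<Sum>i<m. \<bar>?e i\<bar>) \<le> \<delta> * (\<Sum>i<m. \<bar>e i\<bar>) + \<delta> * (\<Sum>i<m. \<bar>e' i\<bar>)"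
    unfolding distrib_left[symmetric] sum.distrib[symmetric] by (intro mult_left_mono \<delta> sum_mono) auto
  ultimately show "\<exists>e''. p (fst (x + y) - lc m e'' a) + \<delta> * (\<Sum>i<m. \<bar>e'' i\<bar>) + norm (snd (x + y) + lc m e'' b)
     \<le> p (fst x - lc m e a) + \<delta> * (\<Sum>i<m. \<bar>e i\<bar>) + norm (snd x + lc m e b)
       + (p (fst y - lc m e' a) + \<delta> * (\<Sum>i<m. \<bar>e' i\<bar>) + norm (snd y + lc m e' b))"
    by (intro exI[of _ ?e]) linarith
next
  fix c :: real and e :: "nat \<Rightarrow> real" and x :: "'w \<times> 'g"
  let ?e = "\<lambda>i. c * e i"
  have "lc m ?e a = c *\<^sub>R lc m e a" "lc m ?e b = c *\<^sub>R lc m e b"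
    by (simp_all add: scaleR_sum_right)
  then have "p (fst (c *\<^sub>R x) - lc m ?e a) = \<bar>c\<bar> * p (fst x - lc m e a)"
    "norm (snd (c *\<^sub>R x) + lc m ?e b) = \<bar>c\<bar> * norm (snd x + lc m e b)"
    using seminorm_scaleR[OF p, of c "fst x - lc m e a"] norm_scaleR[of c "snd x + lc m e b"]
    by (simp_all add: algebra_simps)
  moreover have "(\<Sum>i<m. \<bar>?e i\<bar>) = \<bar>c\<bar> * (\<Sum>i<m. \<bar>e i\<bar>)" by (simp add: abs_mult sum_distrib_left)
  ultimately show "\<exists>e'. p (fst (c *\<^sub>R x) - lc m e' a) + \<delta> * (\<Sum>i<m. \<bar>e' i\<bar>) + norm (snd (c *\<^sub>R x) + lc m e' b)
     \<le> \<bar>c\<bar> * (p (fst x - lc m e a) + \<delta> * (\<Sum>i<m. \<bar>e i\<bar>) + norm (snd x + lc m e b))"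
    by (intro exI[of _ ?e]) (simp add: algebra_simps)
qed

lemma amalgam_le: "amalgam p \<delta> m a b (w, y) \<le> p (w - lc m e a) + \<delta> * (\<Sum>i<m. \<bar>e i\<bar>) + norm (y + lc m e b)"
proof -
  have "0 \<le> p (w - lc m e a) + \<delta> * (\<Sum>i<m. \<bar>e i\<bar>) + norm (y + lc m e b)" for e
    by (intro add_nonneg_nonneg mult_nonneg_nonneg seminorm_nonneg[OF p] \<delta> sum_nonneg) auto
  then have "bdd_below (range (\<lambda>e. p (w - lc m e a) + \<delta> * (\<Sum>i<m. \<bar>e i\<bar>) + norm (y + lc m e b)))"
    by (intro bdd_belowI2[where m = 0])
  then show ?thesis unfolding amalgam_def fst_conv snd_conv by (rule cINF_lower) simp
qed

text \<open>Correlation says that a detour through the gluing costs at least as much as it saves, so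
  the summand keeps its seminorm.\<close>

lemma amalgam_left: "amalgam p \<delta> m a b (w, 0) = p w"
proof (rule antisym)
  show "amalgam p \<delta> m a b (w, 0) \<le> p w" using amalgam_le[of w 0 "\<lambda>_. 0"] by simp
  have "p w \<le> p (w - lc m e a) + \<delta> * (\<Sum>i<m. \<bar>e i\<bar>) + norm (0 + lc m e b)" for e
    using correlatedD[OF corr, of e] seminorm_add[OF p, of "w - lc m e a" "lc m e a"] by simp
  then show "p w \<le> amalgam p \<delta> m a b (w, 0)" unfolding amalgam_def by (intro cINF_greatest) auto
qed

lemma amalgam_right: "amalgam p \<delta> m a b (0, y) = norm y"
proof (rule antisym)
  show "amalgam p \<delta> m a b (0, y) \<le> norm y"
    using amalgam_le[of 0 y "\<lambda>_. 0"] by (simp add: seminorm_zero[OF p])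
  have "norm y \<le> p (0 - lc m e a) + \<delta> * (\<Sum>i<m. \<bar>e i\<bar>) + norm (y + lc m e b)" for e
    using correlatedD[OF corr, of e] norm_triangle_ineq4[of "y + lc m e b" "lc m e b"]
    by (simp add: seminorm_uminus[OF p])
  then show "norm y \<le> amalgam p \<delta> m a b (0, y)" unfolding amalgam_def by (intro cINF_greatest) auto
qed

lemma amalgam_lc: "amalgam p \<delta> m a b (lc m c a, - lc m c b) \<le> \<delta> * (\<Sum>i<m. \<bar>c i\<bar>)"
  using amalgam_le[of "lc m c a" "- lc m c b" c] by (simp add: seminorm_zero[OF p])

lemma amalgam_pair:
  assumes "j < m" shows "amalgam p \<delta> m a b (a j, - b j) \<le> \<delta>"
proof -
  let ?c = "\<lambda>i. if i = j then 1 else 0 :: real"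
  have lc: "lc m ?c f = f j" for f :: "nat \<Rightarrow> 'v::real_vector"
  proof -
    have "lc m ?c f = (\<Sum>i<m. if i = j then f i else 0)" by (intro sum.cong) auto
    then show ?thesis using assms by (simp add: sum.delta)
  qed
  have "(\<Sum>i<m. \<bar>?c i\<bar>) = (\<Sum>i<m. if i = j then 1 else 0)" by (intro sum.cong) auto
  then have "(\<Sum>i<m. \<bar>?c i\<bar>) = 1" using assms by (simp add: sum.delta)
  then show ?thesis using amalgam_lc[of ?c] by (simp only: lc mult_1_right)
qed

text \<open>In the amalgam \<open>d\<close> is a one-point extension of the space carrying
  \<open>p\<close>, and \<open>v\<close> realises it up to \<open>\<eta>\<close>. Exchanging
  \<open>lc m c a\<close> for \<open>lc m c b\<close> there costs \<open>\<delta>\<close> times the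
  sum of the coefficients.\<close>

lemma back_step:
  assumes ext: "one_point_property p" and \<eta>: "0 < \<eta>"
  obtains v where "correlated p (\<delta> + \<eta>) (Suc m) (a(m := v)) (b(m := d))"
proof -
  let ?Am = "amalgam p \<delta> m a b"
  let ?P = "\<lambda>z. ?Am (fst z, snd z *\<^sub>R d)"
  have "linear (\<lambda>z. (fst z, snd z *\<^sub>R d) :: 'w \<times> 'g)" by (rule linearI) (auto simp: algebra_simps)
  then have P: "seminorm ?P" by (rule seminorm_linear[OF seminorm_amalgam])
  obtain v where v: "\<And>c t. \<bar>p (lc m c a + t *\<^sub>R v) - ?P (lc m c a, t)\<bar> \<le> \<eta> * ((\<Sum>i<m. \<bar>c i\<bar>) + \<bar>t\<bar>)"
    using one_point_approx[where m = m and a = a, OF p ext P _ \<eta>] by (auto simp: amalgam_left)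
  have "correlated p (\<delta> + \<eta>) (Suc m) (a(m := v)) (b(m := d))"
    unfolding correlated_def
  proof
    fix c
    have "\<bar>?Am (lc m c a, c m *\<^sub>R d) - ?Am (0, lc m c b + c m *\<^sub>R d)\<bar> \<le> \<delta> * (\<Sum>i<m. \<bar>c i\<bar>)"
      using seminorm_abs_diff[OF seminorm_amalgam, of "(lc m c a, c m *\<^sub>R d)" "(0, lc m c b + c m *\<^sub>R d)"] amalgam_lc[of c]
      by simp
    moreover have "\<bar>p (lc m c a + c m *\<^sub>R v) - ?Am (lc m c a, c m *\<^sub>R d)\<bar> \<le> \<eta> * ((\<Sum>i<m. \<bar>c i\<bar>) + \<bar>c m\<bar>)"
      using v[of c "c m"] by simp
    moreover have "0 \<le> \<delta> * \<bar>c m\<bar>" using \<delta> by simp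
    ultimately show "\<bar>p (lc (Suc m) c (a(m := v))) - norm (lc (Suc m) c (b(m := d)))\<bar> \<le> (\<delta> + \<eta>) * (\<Sum>i<Suc m. \<bar>c i\<bar>)"
      by (simp add: amalgam_right algebra_simps)
  qed
  then show ?thesis using that by blast
qed

end

section \<open>The extension step inside the Gurarij space\<close>

lemma linear_on_sum:
  assumes F: "subspace F" and lin: "linear_on F \<phi>" and x: "\<And>i. i \<in> I \<Longrightarrow> x i \<in> F"
  shows "\<phi> (\<Sum>i\<in>I. c i *\<^sub>R x i) = (\<Sum>i\<in>I. c i *\<^sub>R \<phi> (x i))"
proof -
  have add: "\<phi> (y + z) = \<phi> y + \<phi> z" and sc: "\<phi> (r *\<^sub>R y) = r *\<^sub>R \<phi> y" if "y \<in> F" "z \<in> F" for y z r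
    using lin that by (auto simp: linear_on_def)
  have zero: "\<phi> 0 = 0" using sc[of 0 0 0] subspace_0[OF F] by simp
  from x show ?thesis
  proof (induction I rule: infinite_finite_induct)
    case (insert i I)
    have "(\<Sum>i\<in>I. c i *\<^sub>R x i) \<in> F" using insert by (intro subspace_sum[OF F] subspace_scale[OF F]) auto
    moreover have "x i \<in> F" "c i *\<^sub>R x i \<in> F" using insert by (auto intro: subspace_scale[OF F])
    ultimately show ?case using insert by (simp add: add sc)
  qed (auto simp: zero)
qed

lemma keys_subset_span: "{x :: nat \<Rightarrow>\<^sub>0 real. keys x \<subseteq> {..<n}} = span (pt ` {..<n})"
proof
  show "{x :: nat \<Rightarrow>\<^sub>0 real. keys x \<subseteq> {..<n}} \<subseteq> span (pt ` {..<n})"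
  proof
    fix x :: "nat \<Rightarrow>\<^sub>0 real" assume "x \<in> {x. keys x \<subseteq> {..<n}}"
    then have "linext pt x = (\<Sum>g<n. lookup x g *\<^sub>R pt g)" by (intro linext_superset) auto
    then have "x = (\<Sum>g<n. lookup x g *\<^sub>R pt g)" by simp
    also have "\<dots> \<in> span (pt ` {..<n})" by (intro span_sum span_scale span_base) auto
    finally show "x \<in> span (pt ` {..<n})" .
  qed
  have "subspace {x :: nat \<Rightarrow>\<^sub>0 real. keys x \<subseteq> {..<n}}"
    unfolding subspace_def
  proof (intro conjI ballI allI)
    fix x y :: "nat \<Rightarrow>\<^sub>0 real" and c :: real
    assume x: "x \<in> {x. keys x \<subseteq> {..<n}}"
    have "keys (c *\<^sub>R x) \<subseteq> keys x" by (auto simp: in_keys_iff lookup_scaleR)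
    then show "c *\<^sub>R x \<in> {x. keys x \<subseteq> {..<n}}" using x by auto
    assume "y \<in> {x. keys x \<subseteq> {..<n}}"
    then show "x + y \<in> {x. keys x \<subseteq> {..<n}}" using x keys_add[of x y] by auto
  qed simp
  then show "span (pt ` {..<n}) \<subseteq> {x :: nat \<Rightarrow>\<^sub>0 real. keys x \<subseteq> {..<n}}"
    by (intro span_minimal) auto
qed

lemma gurarij_extension:
  fixes E F :: "(nat \<Rightarrow>\<^sub>0 real) set" and \<psi> :: "(nat \<Rightarrow>\<^sub>0 real) \<Rightarrow> 'g::banach"
  assumes "gurarij_space TYPE('g)" "0 < \<epsilon>" "subspace E" "subspace F" "E \<subseteq> F"
    "finite B" "F = span B" "norm_on F N" "linear_on E \<psi>" "\<And>x. x \<in> E \<Longrightarrow> norm (\<psi> x) = N x"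
  obtains \<phi> where "linear_on F \<phi>" "\<And>x. x \<in> E \<Longrightarrow> \<phi> x = \<psi> x"
    "\<And>x. x \<in> F \<Longrightarrow> (1 - \<epsilon>) * N x \<le> norm (\<phi> x)" "\<And>x. x \<in> F \<Longrightarrow> norm (\<phi> x) \<le> (1 + \<epsilon>) * N x"
  using assms(1)[unfolded gurarij_space_def, THEN conjunct2, rule_format, of \<epsilon> E F N \<psi>] assms(2-) by blast

text \<open>The \<open>b j\<close> may be dependent, whereas the subspace handed to the Gurarij
  property needs coordinates on which the norm is definite.\<close>

lemma finite_spanning_basis:
  fixes b :: "nat \<Rightarrow> 'g::real_vector"
  obtains k :: nat and \<beta> :: "nat \<Rightarrow> 'g" where
    "\<And>c. lc k c \<beta> = 0 \<Longrightarrow> \<forall>i<k. c i = 0" "\<And>j. j < m \<Longrightarrow> \<exists>c. lc k c \<beta> = b j"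
proof -
  obtain B where B: "B \<subseteq> b ` {..<m}" "independent B" "b ` {..<m} \<subseteq> span B"
    using maximal_independent_subset[of "b ` {..<m}"] by blast
  have "finite B" using B(1) by (rule finite_subset) simp
  then obtain \<beta> where \<beta>: "bij_betw \<beta> {0..<card B} B" using ex_bij_betw_nat_finite by blast
  let ?k = "card B"
  have \<beta>: "bij_betw \<beta> {..<?k} B" using \<beta> by (simp add: atLeast0LessThan)
  show ?thesis
  proof
    fix c assume 0: "lc ?k c \<beta> = 0"
    define u where "u v = c (inv_into {..<?k} \<beta> v)" for v
    have u: "u (\<beta> i) = c i" if "i < ?k" for i
      using that \<beta> by (simp add: u_def bij_betw_def inv_into_f_f)
    have "(\<Sum>v\<in>B. u v *\<^sub>R v) = (\<Sum>i<?k. u (\<beta> i) *\<^sub>R \<beta> i)"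
      using sum.reindex_bij_betw[OF \<beta>, of "\<lambda>v. u v *\<^sub>R v"] by simp
    also have "\<dots> = lc ?k c \<beta>" by (intro sum.cong) (auto simp: u)
    finally have "(\<Sum>v\<in>B. u v *\<^sub>R v) = 0" using 0 by simp
    then have "u v = 0" if "v \<in> B" for v
      using independentD[OF B(2) \<open>finite B\<close> subset_refl] that by blast
    then show "\<forall>i<?k. c i = 0" using u \<beta> by (metis bij_betwE lessThan_iff)
  next
    fix j assume "j < m"
    then have "b j \<in> span B" using B(3) by auto
    then obtain r where r: "b j = (\<Sum>v\<in>B. r v *\<^sub>R v)" using span_finite[OF \<open>finite B\<close>] by auto
    then have "b j = (\<Sum>i<?k. r (\<beta> i) *\<^sub>R \<beta> i)"
      using sum.reindex_bij_betw[OF \<beta>, of "\<lambda>v. r v *\<^sub>R v"] by simp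
    then show "\<exists>c. lc ?k c \<beta> = b j" by (intro exI[of _ "\<lambda>i. r (\<beta> i)"]) simp
  qed
qed

lemma linear_lookup_sum: "linear (\<lambda>x :: 'k \<Rightarrow>\<^sub>0 real. \<Sum>i\<in>I. lookup x (f i) *\<^sub>R v i)"
  by (rule linearI) (simp_all add: lookup_add lookup_scaleR scaleR_add_left sum.distrib scaleR_sum_right)

text \<open>The space \<open>F\<close> has \<open>k\<close> coordinates for a basis of the span of
  the \<open>b i\<close> and one for each of the \<open>m + 1\<close> vectors \<open>a j\<close>;
  its norm comes from the amalgam. Extending the given map on the first \<open>k\<close> coordinates
  sends \<open>a j\<close> near \<open>b j\<close> for \<open>j < m\<close>, and the new error
  \<open>\<eta>\<close> is independent of \<open>\<delta>\<close>: this lets the iteration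
  converge.\<close>

lemma gurarij_step:
  fixes p :: "'w::real_vector \<Rightarrow> real" and b :: "nat \<Rightarrow> 'g::banach"
  assumes G: "gurarij_space TYPE('g)" and p: "seminorm p" and \<delta>: "0 \<le> \<delta>"
    and corr: "correlated p \<delta> m a b" and \<eta>: "0 < \<eta>"
  obtains b' :: "nat \<Rightarrow> 'g" where "correlated p \<eta> (Suc m) a b'" "\<And>i. i < m \<Longrightarrow> norm (b' i - b i) \<le> \<delta> + \<eta>"
proof -
  obtain k \<beta> where ind: "\<And>c. lc k c \<beta> = 0 \<Longrightarrow> \<forall>i<k. c i = 0" and spn: "\<And>j. j < m \<Longrightarrow> \<exists>c. lc k c \<beta> = b j"
    by (rule finite_spanning_basis[of m b]) (rule that)
  define M where "M = (\<Sum>j<Suc m. p (a j))"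
  have M0: "0 \<le> M" unfolding M_def by (intro sum_nonneg seminorm_nonneg[OF p])
  \<comment> \<open>This makes \<open>\<epsilon> * M\<close> and
    \<open>\<epsilon> * \<delta>\<close> at most \<open>\<eta> / 4\<close>, and
    \<open>\<epsilon> \<le> 1\<close> keeps \<open>\<epsilon> * \<eta>'\<close> below
    \<open>\<eta>'\<close>; each claim then uses up at most three quarters of \<open>\<eta>\<close>.
    The summand 1 keeps the denominator positive.\<close>
  define \<eta>' \<epsilon> where "\<eta>' = \<eta> / 4" and "\<epsilon> = min 1 (\<eta> / (4 * (M + 1 + \<delta>)))"
  have \<epsilon>: "0 < \<epsilon>" "\<epsilon> \<le> 1" and \<eta>': "0 < \<eta>'" using M0 \<delta> \<eta> by (auto simp: \<epsilon>_def \<eta>'_def)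
  have "\<epsilon> * (M + 1 + \<delta>) \<le> \<eta> / (4 * (M + 1 + \<delta>)) * (M + 1 + \<delta>)"
    using M0 \<delta> by (intro mult_right_mono) (auto simp: \<epsilon>_def)
  also have "\<dots> = \<eta> / 4" using M0 \<delta> by (simp add: field_simps)
  finally have \<epsilon>M: "\<epsilon> * M + \<epsilon> + \<epsilon> * \<delta> \<le> \<eta> / 4" by (simp add: algebra_simps)
  moreover have "0 \<le> \<epsilon> * M" "0 \<le> \<epsilon> * \<delta>" using \<epsilon> M0 \<delta> by auto
  ultimately have small: "\<epsilon> * M \<le> \<eta> / 4" "\<epsilon> * \<delta> \<le> \<eta> / 4" using \<epsilon> by linarith+
  have \<epsilon>\<eta>': "\<epsilon> * \<eta>' \<le> \<eta>'" using \<epsilon> \<eta>' by (simp add: mult_left_le_one_le)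
  define Am where "Am = amalgam p \<delta> m a b"
  note Am = seminorm_amalgam[OF p \<delta> corr, folded Am_def] amalgam_left[OF p \<delta> corr, folded Am_def]
    amalgam_right[OF p \<delta> corr, folded Am_def] amalgam_pair[OF p \<delta> corr, folded Am_def]
  define Y where "Y x = (\<Sum>j<Suc m. lookup x (k + j) *\<^sub>R a j)" for x :: "nat \<Rightarrow>\<^sub>0 real"
  define \<psi> where "\<psi> x = (\<Sum>i<k. lookup x i *\<^sub>R \<beta> i)" for x :: "nat \<Rightarrow>\<^sub>0 real"
  define R where "R x = (\<Sum>j<Suc m. \<bar>lookup x (k + j)\<bar>)" for x :: "nat \<Rightarrow>\<^sub>0 real"
  \<comment> \<open>The term \<open>\<eta>' * R x\<close> makes this definite on \<open>F\<close>
    although \<open>p\<close> is only a seminorm and the \<open>a j\<close> may be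
    dependent.\<close>
  define N where "N x = Am (Y x, \<psi> x) + \<eta>' * R x" for x
  have linY: "linear Y" and lin\<psi>: "linear \<psi>"
    unfolding Y_def \<psi>_def by (rule linear_lookup_sum)+
  have "linear (\<lambda>x. (Y x, \<psi> x))"
    using linY lin\<psi> by (intro linearI) (auto simp: linear_add linear_scale)
  then have sN1: "seminorm (\<lambda>x. Am (Y x, \<psi> x))" by (rule seminorm_linear[OF Am(1)])
  have sR: "seminorm (\<lambda>x. \<eta>' * R x)"
  proof (rule seminormI)
    show "\<eta>' * R (x + y) \<le> \<eta>' * R x + \<eta>' * R y" for x y
      unfolding R_def distrib_left[symmetric] sum.distrib[symmetric] using \<eta>'
      by (intro mult_left_mono sum_mono) (auto simp: lookup_add)
    show "\<eta>' * R (c *\<^sub>R x) = \<bar>c\<bar> * (\<eta>' * R x)" for c x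
      by (simp add: R_def lookup_scaleR abs_mult sum_distrib_left algebra_simps)
  qed
  have N: "seminorm N" unfolding N_def by (rule seminorm_plus[OF sN1 sR])
  define E F where "E = {x :: nat \<Rightarrow>\<^sub>0 real. keys x \<subseteq> {..<k}}"
    and "F = {x :: nat \<Rightarrow>\<^sub>0 real. keys x \<subseteq> {..<k + Suc m}}"
  have E: "E = span (pt ` {..<k})" and F: "F = span (pt ` {..<k + Suc m})"
    unfolding E_def F_def by (rule keys_subset_span)+
  have subF: "subspace F" by (simp add: F)
  have EF: "E \<subseteq> F" by (auto simp: E_def F_def)
  have normF: "norm_on F N"
    unfolding norm_on_def
  proof (intro conjI ballI allI)
    fix x assume x: "x \<in> F"
    show "N x = 0 \<longleftrightarrow> x = 0"
    proof
      assume "N x = 0"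
      moreover have "0 \<le> Am (Y x, \<psi> x)" "0 \<le> R x"
        by (auto simp: R_def intro!: seminorm_nonneg[OF Am(1)] sum_nonneg)
      ultimately have "Am (Y x, \<psi> x) = 0" "R x = 0" using \<eta>' by (auto simp: N_def add_nonneg_eq_0_iff)
      then have z: "lookup x (k + j) = 0" if "j < Suc m" for j
        using that by (auto simp: R_def sum_nonneg_eq_0_iff simp del: sum.lessThan_Suc)
      then have "Y x = 0" by (simp add: Y_def)
      then have "\<psi> x = 0" using \<open>Am (Y x, \<psi> x) = 0\<close> by (simp add: Am)
      then have "\<forall>i<k. lookup x i = 0" unfolding \<psi>_def by (rule ind)
      moreover have "lookup x i = 0" if "k \<le> i" for i
      proof (cases "i < k + Suc m")
        case True
        then show ?thesis using z[of "i - k"] that by simp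
      next
        case False
        then show ?thesis using x by (auto simp: F_def in_keys_iff)
      qed
      ultimately show "x = 0" by (intro poly_mapping_eqI) (metis lookup_zero not_le)
    qed (simp add: seminorm_zero[OF N])
  qed (auto simp: seminorm_nonneg[OF N] seminorm_add[OF N] seminorm_scaleR[OF N])
  have N\<psi>: "norm (\<psi> x) = N x" if "x \<in> E" for x
  proof -
    have "lookup x (k + j) = 0" for j using that by (auto simp: E_def in_keys_iff)
    then show ?thesis by (simp add: N_def Y_def R_def Am)
  qed
  have "linear_on E \<psi>" by (simp add: linear_on_def linear_add[OF lin\<psi>] linear_scale[OF lin\<psi>])
  then obtain \<phi> where \<phi>: "linear_on F \<phi>" "\<And>x. x \<in> E \<Longrightarrow> \<phi> x = \<psi> x"
    and lower: "\<And>x. x \<in> F \<Longrightarrow> (1 - \<epsilon>) * N x \<le> norm (\<phi> x)"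
    and upper: "\<And>x. x \<in> F \<Longrightarrow> norm (\<phi> x) \<le> (1 + \<epsilon>) * N x"
    using gurarij_extension[OF G \<epsilon>(1) _ subF EF _ F normF _ N\<psi>] by (auto simp: E)
  have ptF: "pt (k + j) \<in> F" if "j < Suc m" for j using that by (simp add: F_def)
  define b' where "b' j = \<phi> (pt (k + j))" for j
  have "correlated p \<eta> (Suc m) a b'"
    unfolding correlated_def
  proof
    fix c :: "nat \<Rightarrow> real"
    define X where "X = (\<Sum>j<Suc m. c j *\<^sub>R pt (k + j))"
    have X: "lookup X (k + j) = (if j < Suc m then c j else 0)" for j
    proof -
      have "lookup X (k + j) = (\<Sum>i<Suc m. if i = j then c i else 0)"
        unfolding X_def lookup_sum by (intro sum.cong) (auto simp: lookup_scaleR lookup_single when_def)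
      then show ?thesis by (simp only: sum.delta finite_lessThan lessThan_iff)
    qed
    have X0: "lookup X i = 0" if "i < k" for i
      unfolding X_def lookup_sum using that by (intro sum.neutral) (auto simp: lookup_scaleR lookup_single when_def)
    have XF: "X \<in> F" unfolding X_def using ptF by (intro subspace_sum[OF subF] subspace_scale[OF subF]) auto
    have \<phi>X: "\<phi> X = lc (Suc m) c b'"
      unfolding X_def b'_def by (rule linear_on_sum[OF subF \<phi>(1)]) (use ptF in auto)
    have YX: "Y X = lc (Suc m) c a" unfolding Y_def by (intro sum.cong) (auto simp: X)
    have \<psi>X: "\<psi> X = 0" by (simp add: \<psi>_def X0)
    have RX: "R X = (\<Sum>j<Suc m. \<bar>c j\<bar>)" unfolding R_def by (intro sum.cong) (auto simp: X)
    define s where "s = (\<Sum>j<Suc m. \<bar>c j\<bar>)"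
    have s0: "0 \<le> s" by (simp add: s_def sum_nonneg)
    have NX: "N X = p (lc (Suc m) c a) + \<eta>' * s" by (simp only: N_def YX \<psi>X RX Am s_def)
    have "p (lc (Suc m) c a) \<le> (\<Sum>j<Suc m. \<bar>c j\<bar> * p (a j))" by (rule seminorm_sum_scaleR[OF p])
    also have "\<dots> \<le> (\<Sum>j<Suc m. \<bar>c j\<bar> * M)"
    proof (intro sum_mono mult_left_mono)
      fix j assume "j \<in> {..<Suc m}"
      then show "p (a j) \<le> M" unfolding M_def by (intro member_le_sum) (auto simp: seminorm_nonneg[OF p])
    qed simp
    also have "\<dots> = s * M" by (simp only: s_def sum_distrib_right)
    finally have "\<epsilon> * p (lc (Suc m) c a) \<le> \<epsilon> * (s * M)" using \<epsilon> by (intro mult_left_mono) auto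
    also have "\<dots> = (\<epsilon> * M) * s" by simp
    also have "\<dots> \<le> (\<eta> / 4) * s" using small s0 by (intro mult_right_mono)
    finally have 1: "\<epsilon> * p (lc (Suc m) c a) \<le> (\<eta> / 4) * s" .
    have 2: "\<epsilon> * (\<eta>' * s) \<le> (\<eta> / 4) * s"
      using mult_right_mono[OF \<epsilon>\<eta>' s0] by (simp add: \<eta>'_def algebra_simps)
    have "\<bar>norm (\<phi> X) - N X\<bar> \<le> \<epsilon> * N X" using lower[OF XF] upper[OF XF] by (simp add: abs_le_iff algebra_simps)
    then have "\<bar>p (lc (Suc m) c a) - norm (lc (Suc m) c b')\<bar> \<le> \<epsilon> * p (lc (Suc m) c a) + \<epsilon> * (\<eta>' * s) + \<eta>' * s"
      using s0 \<eta>' mult_nonneg_nonneg[of \<eta>' s] unfolding \<phi>X NX distrib_left by linarith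
    also have "\<dots> \<le> (\<eta> / 4) * s + (\<eta> / 4) * s + (\<eta> / 4) * s" using 1 2 by (simp add: \<eta>'_def)
    also have "\<dots> \<le> \<eta> * s" using \<eta> s0 by simp
    finally show "\<bar>p (lc (Suc m) c a) - norm (lc (Suc m) c b')\<bar> \<le> \<eta> * (\<Sum>i<Suc m. \<bar>c i\<bar>)"
      by (simp only: s_def)
  qed
  moreover have "norm (b' j - b j) \<le> \<delta> + \<eta>" if j: "j < m" for j
  proof -
    obtain c where c: "lc k c \<beta> = b j" using spn[OF j] by blast
    define u where "u = (\<Sum>i<k. c i *\<^sub>R pt i)"
    have u: "lookup u j = (if j < k then c j else 0)" for j
    proof -
      have "lookup u j = (\<Sum>i<k. if i = j then c i else 0)"
        unfolding u_def lookup_sum by (intro sum.cong) (auto simp: lookup_scaleR lookup_single when_def)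
      then show ?thesis by (simp only: sum.delta finite_lessThan lessThan_iff)
    qed
    have uE: "u \<in> E" by (auto simp: E_def in_keys_iff u split: if_splits)
    have "\<psi> u = b j" unfolding \<psi>_def c[symmetric] by (intro sum.cong) (auto simp: u)
    then have \<phi>u: "\<phi> u = b j" using \<phi>(2)[OF uE] by simp
    \<comment> \<open>The vector of \<open>F\<close> that stands for \<open>(a j, - b j)\<close>;
      its norm is at most \<open>\<delta> + \<eta>'\<close>.\<close>
    let ?d = "pt (k + j) - u"
    have F': "pt (k + j) \<in> F" "u \<in> F" using ptF[of j] j uE EF by auto
    then have dF: "?d \<in> F" by (rule subspace_diff[OF subF])
    have "\<phi> (pt (k + j) + (-1) *\<^sub>R u) = \<phi> (pt (k + j)) + (-1) *\<^sub>R \<phi> u"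
      using \<phi>(1) F' subspace_scale[OF subF F'(2), of "-1"] unfolding linear_on_def by metis
    then have "\<phi> ?d = b' j - b j" by (simp add: b'_def \<phi>u)
    moreover have "Y ?d = a j"
    proof -
      have "Y ?d = (\<Sum>i<Suc m. if i = j then a i else 0)"
        unfolding Y_def by (intro sum.cong) (auto simp: lookup_minus u lookup_single when_def)
      then show ?thesis using j by (simp only: sum.delta finite_lessThan lessThan_iff) simp
    qed
    moreover have "\<psi> ?d = - b j"
      using \<open>\<psi> u = b j\<close> by (simp add: linear_diff[OF lin\<psi>]) (simp add: \<psi>_def lookup_single when_def)
    moreover have "R ?d = 1"
    proof -
      have "R ?d = (\<Sum>i<Suc m. if i = j then 1 else 0)"
        unfolding R_def by (intro sum.cong) (auto simp: lookup_minus u lookup_single when_def)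
      then show ?thesis using j by (simp only: sum.delta finite_lessThan lessThan_iff) simp
    qed
    ultimately have "norm (b' j - b j) \<le> (1 + \<epsilon>) * (Am (a j, - b j) + \<eta>')"
      using upper[OF dF] by (simp add: N_def)
    also have "\<dots> \<le> (1 + \<epsilon>) * (\<delta> + \<eta>')" using Am(4)[OF j] \<epsilon> by (intro mult_left_mono) auto
    also have "\<dots> = \<delta> + \<epsilon> * \<delta> + \<eta>' + \<epsilon> * \<eta>'" by (simp add: algebra_simps)
    also have "\<dots> \<le> \<delta> + \<eta>" using small \<epsilon>\<eta>' \<eta> \<eta>'_def by linarith
    finally show ?thesis .
  qed
  ultimately show ?thesis by (rule that)
qed

text \<open>The step back comes first and worsens the error to \<open>\<delta> + \<eta>\<close>; the
  step forth then resets it to \<open>\<eta>\<close>, moving each \<open>b i\<close> by at most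
  \<open>(\<delta> + \<eta>) + \<eta>\<close>. Index \<open>m\<close> serves the target
  \<open>d\<close>, index \<open>m + 1\<close> the source \<open>v\<close>.\<close>

lemma back_and_forth_step:
  fixes p :: "'w::real_vector \<Rightarrow> real" and b :: "nat \<Rightarrow> 'g::banach"
  assumes G: "gurarij_space TYPE('g)" and p: "seminorm p" and ext: "one_point_property p" and \<delta>: "0 \<le> \<delta>"
    and corr: "correlated p \<delta> m a b" and \<eta>: "0 < \<eta>"
  obtains a' and b' :: "nat \<Rightarrow> 'g" where "correlated p \<eta> (m + 2) a' b'" "\<And>i. i < m \<Longrightarrow> a' i = a i" "a' (Suc m) = v"
    "\<And>i. i < m \<Longrightarrow> norm (b' i - b i) \<le> \<delta> + 2 * \<eta>" "norm (b' m - d) \<le> \<delta> + 2 * \<eta>"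
proof -
  obtain w where w: "correlated p (\<delta> + \<eta>) (Suc m) (a(m := w)) (b(m := d))"
    by (rule back_step[OF p \<delta> corr ext \<eta>])
  let ?a = "a(m := w, Suc m := v)"
  have "correlated p (\<delta> + \<eta>) (Suc m) ?a (b(m := d))"
    using w by (subst correlated_cong[of "Suc m" ?a "a(m := w)" "b(m := d)" "b(m := d)"]) auto
  then obtain b' :: "nat \<Rightarrow> 'g" where b': "correlated p \<eta> (Suc (Suc m)) ?a b'"
    "\<And>i. i < Suc m \<Longrightarrow> norm (b' i - (b(m := d)) i) \<le> \<delta> + \<eta> + \<eta>"
    using gurarij_step[OF G p _ _ \<eta>, of "\<delta> + \<eta>" "Suc m" ?a "b(m := d)"] \<delta> \<eta> by auto
  show ?thesis
  proof
    show "correlated p \<eta> (m + 2) ?a b'" using b'(1) by simp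
    show "norm (b' i - b i) \<le> \<delta> + 2 * \<eta>" if "i < m" for i using b'(2)[of i] that by simp
    show "norm (b' m - d) \<le> \<delta> + 2 * \<eta>" using b'(2)[of m] by simp
  qed auto
qed

section \<open>The limit of the back-and-forth construction\<close>

lemma geometric_Cauchy_limit:
  fixes x :: "nat \<Rightarrow> 'g::banach"
  assumes x: "\<And>n. N \<le> n \<Longrightarrow> norm (x (Suc n) - x n) \<le> 2 * (1/2)^n"
  obtains L where "x \<longlonglongrightarrow> L" "\<And>n. N \<le> n \<Longrightarrow> norm (L - x n) \<le> 4 * (1/2)^n"
proof -
  \<comment> \<open>The subtracted term makes the bound telescope; 4 is the sum of the terms
    \<open>2 * (1/2)^j\<close>.\<close>
  have step: "norm (x (n + k) - x n) \<le> 4 * (1/2)^n - 4 * (1/2)^(n + k)" if n: "N \<le> n" for n k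
  proof (induction k)
    case (Suc k)
    have "norm (x (n + Suc k) - x n) \<le> norm (x (Suc (n + k)) - x (n + k)) + norm (x (n + k) - x n)"
      using norm_triangle_ineq[of "x (Suc (n + k)) - x (n + k)" "x (n + k) - x n"] by simp
    also have "\<dots> \<le> 2 * (1/2)^(n + k) + (4 * (1/2)^n - 4 * (1/2)^(n + k))"
      using x[of "n + k"] n Suc by (intro add_mono) auto
    finally show ?case by simp
  qed simp
  have bd: "norm (x k - x n) \<le> 4 * (1/2)^n" if "N \<le> n" "n \<le> k" for n k
  proof -
    have "0 \<le> 4 * (1/2::real)^k" by simp
    moreover have "norm (x k - x n) \<le> 4 * (1/2)^n - 4 * (1/2)^k"
      using step[OF that(1), of "k - n"] that(2) by simp
    ultimately show ?thesis by linarith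
  qed
  have z: "(\<lambda>n. 4 * (1/2::real)^n) \<longlonglongrightarrow> 0"
    by (intro tendsto_mult_right_zero LIMSEQ_power_zero) simp
  have "Cauchy x"
  proof (rule metric_CauchyI)
    fix e :: real assume "0 < e"
    then have "\<forall>\<^sub>F n in sequentially. 4 * (1/2)^n < e / 2" using order_tendstoD(2)[OF z, of "e / 2"] by simp
    then obtain n where n: "N \<le> n" "4 * (1/2)^n < e / 2"
      unfolding eventually_sequentially by (metis nat_le_linear)
    have "dist (x i) (x j) < e" if "n \<le> i" "n \<le> j" for i j
      using bd[OF n(1) that(1)] bd[OF n(1) that(2)] n(2) norm_triangle_ineq4[of "x i - x n" "x j - x n"]
      by (simp add: dist_norm)
    then show "\<exists>M. \<forall>m\<ge>M. \<forall>n\<ge>M. dist (x m) (x n) < e" by blast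
  qed
  then obtain L where L: "x \<longlonglongrightarrow> L" by (auto simp: Cauchy_convergent_iff convergent_def)
  show ?thesis
  proof (rule that[OF L])
    fix n assume n: "N \<le> n"
    show "norm (L - x n) \<le> 4 * (1/2)^n"
      by (rule LIMSEQ_le_const2[OF tendsto_norm[OF tendsto_diff[OF L tendsto_const]]])
         (use bd[OF n] in blast)
  qed
qed

lemma separable_dense_sequence:
  assumes "separable_space (euclidean :: 'g::metric_space topology)"
  obtains e :: "nat \<Rightarrow> 'g::metric_space" where "\<And>y r. 0 < r \<Longrightarrow> \<exists>n. dist (e n) y < r"
proof -
  obtain C :: "'g set" where C: "countable C" "closure C = UNIV"
    using assms unfolding separable_space_def by auto
  have "C \<noteq> {}" using C(2) by auto
  show ?thesis
  proof (rule that[of "from_nat_into C"])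
    fix y :: 'g and r :: real assume "0 < r"
    moreover have "y \<in> closure C" using C(2) by simp
    ultimately obtain z where "z \<in> C" "dist z y < r" unfolding closure_approachable by blast
    then show "\<exists>n. dist (from_nat_into C n) y < r"
      using from_nat_into_surj[OF C(1)] by metis
  qed
qed

theorem isometric_dense_embedding:
  fixes p :: "'w::real_vector \<Rightarrow> real" and v :: "nat \<Rightarrow> 'w"
  assumes G: "gurarij_space TYPE('g::banach)" and p: "seminorm p" and ext: "one_point_property p"
    and v: "\<And>w r. 0 < r \<Longrightarrow> \<exists>n. p (v n - w) < r"
  obtains J :: "'w \<Rightarrow> 'g::banach" where "linear J" "\<And>w. norm (J w) = p w" "\<And>y r. 0 < r \<Longrightarrow> \<exists>w. norm (J w - y) < r"
proof -
  have "separable_space (euclidean :: 'g topology)" using G by (simp add: gurarij_space_def)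
  then obtain e :: "nat \<Rightarrow> 'g" where e: "\<And>y r. 0 < r \<Longrightarrow> \<exists>n. dist (e n) y < r"
    by (rule separable_dense_sequence) blast
  \<comment> \<open>Each \<open>e j\<close> is the target in arbitrarily late rounds, because round
    \<open>n\<close> approximates its target only up to a multiple of
    \<open>(1/2)^n\<close>.\<close>
  define d where "d n = e (fst (prod_decode n))" for n
  define P where "P n s \<longleftrightarrow> correlated p ((1/2)^n) (2 * n) (fst s) (snd s)" for n and s :: "(nat \<Rightarrow> 'w) \<times> (nat \<Rightarrow> 'g)"
  \<comment> \<open>Round \<open>n\<close> adds index \<open>2 * n\<close> for \<open>d n\<close>
    and index \<open>2 * n + 1\<close> for \<open>v n\<close>. The displacement is
    \<open>(1/2)^n + 2 * (1/2)^Suc n = 2 * (1/2)^n\<close>.\<close>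
  define Q where "Q n s s' \<longleftrightarrow> (\<forall>i<2*n. fst s' i = fst s i) \<and> fst s' (Suc (2 * n)) = v n \<and>
      (\<forall>i<2*n. norm (snd s' i - snd s i) \<le> 2 * (1/2)^n) \<and> norm (snd s' (2 * n) - d n) \<le> 2 * (1/2)^n"
    for n and s s' :: "(nat \<Rightarrow> 'w) \<times> (nat \<Rightarrow> 'g)"
  have "\<exists>f. \<forall>n. P n (f n) \<and> Q n (f n) (f (Suc n))"
  proof (rule dependent_nat_choice)
    show "\<exists>s. P 0 s" by (simp add: P_def correlated_def seminorm_zero[OF p])
    fix s n assume s: "P n s"
    then have c: "correlated p ((1/2)^n) (2 * n) (fst s) (snd s)" by (simp add: P_def)
    obtain a' and b' :: "nat \<Rightarrow> 'g" where "correlated p ((1/2)^Suc n) (2 * n + 2) a' b'"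
      "\<And>i. i < 2 * n \<Longrightarrow> a' i = fst s i" "a' (Suc (2 * n)) = v n"
      "\<And>i. i < 2 * n \<Longrightarrow> norm (b' i - snd s i) \<le> (1/2)^n + 2 * (1/2)^Suc n" "norm (b' (2 * n) - d n) \<le> (1/2)^n + 2 * (1/2)^Suc n"
      using back_and_forth_step[OF G p ext _ c, of "(1/2)^Suc n" "v n" "d n"] by auto
    then have "P (Suc n) (a', b') \<and> Q n s (a', b')" by (simp add: P_def Q_def)
    then show "\<exists>s'. P (Suc n) s' \<and> Q n s s'" ..
  qed
  then obtain f where f: "\<And>n. P n (f n)" "\<And>n. Q n (f n) (f (Suc n))" by blast
  define a b where "a n = fst (f n)" and "b n = snd (f n)" for n
  have corr: "correlated p ((1/2)^n) (2 * n) (a n) (b n)" for n using f(1)[of n] by (simp add: P_def a_def b_def)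
  have a: "a (Suc n) i = a n i" if "i < 2 * n" for n i using f(2)[of n] that by (simp add: Q_def a_def)
  have av: "a (Suc n) (Suc (2 * n)) = v n" for n using f(2)[of n] by (simp add: Q_def a_def)
  have b: "norm (b (Suc n) i - b n i) \<le> 2 * (1/2)^n" if "i < 2 * n" for n i
    using f(2)[of n] that by (simp add: Q_def b_def)
  have bd: "norm (b (Suc n) (2 * n) - d n) \<le> 2 * (1/2)^n" for n using f(2)[of n] by (simp add: Q_def b_def)
  \<comment> \<open>Sources are final once chosen, and index \<open>i\<close> is available at round
    \<open>Suc i\<close>, as \<open>i < 2 * Suc i\<close>.\<close>
  define A where "A i = a (Suc i) i" for i
  have stab: "a (n + j) i = a n i" if "i < 2 * n" for n j i
    by (induction j) (use a that in auto)
  have A: "a n i = A i" if "i < 2 * n" for n i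
    using stab[of i n "Suc i - n"] stab[of i "Suc i" "n - Suc i"] that by (cases "n \<le> Suc i") (auto simp: A_def)
  have "\<exists>L. (\<lambda>n. b n i) \<longlonglongrightarrow> L \<and> (\<forall>n. i < 2 * n \<longrightarrow> norm (L - b n i) \<le> 4 * (1/2)^n)" for i
  proof (rule geometric_Cauchy_limit[of "Suc (i div 2)" "\<lambda>n. b n i"])
    show "norm (b (Suc n) i - b n i) \<le> 2 * (1/2)^n" if "Suc (i div 2) \<le> n" for n
      using that by (intro b) linarith
    fix L assume "(\<lambda>n. b n i) \<longlonglongrightarrow> L" "\<And>n. Suc (i div 2) \<le> n \<Longrightarrow> norm (L - b n i) \<le> 4 * (1/2)^n"
    moreover have "Suc (i div 2) \<le> n" if "i < 2 * n" for n using that by linarith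
    ultimately show ?thesis by blast
  qed
  then obtain B where B: "\<And>i. (\<lambda>n. b n i) \<longlonglongrightarrow> B i" "\<And>i n. i < 2 * n \<Longrightarrow> norm (B i - b n i) \<le> 4 * (1/2)^n"
    by metis
  have iso: "norm (lc k c B) = p (lc k c A)" for k c
  proof -
    have "\<bar>p (lc k c A) - norm (lc k c (b n))\<bar> \<le> (1/2)^n * (\<Sum>i<k. \<bar>c i\<bar>)" if n: "k \<le> n" for n
    proof -
      \<comment> \<open>Padding with zeros brings a combination of fixed length \<open>k\<close>
        into the range of \<open>corr\<close>.\<close>
      let ?c = "\<lambda>i. if i < k then c i else 0"
      have *: "(\<Sum>i<2*n. g i) = (\<Sum>i<k. g i)" if "\<And>i. \<not> i < k \<Longrightarrow> g i = 0" for g :: "nat \<Rightarrow> 'z::comm_monoid_add"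
        using that n by (intro sum.mono_neutral_right) auto
      have "lc (2 * n) ?c (a n) = lc k ?c (a n)" "lc (2 * n) ?c (b n) = lc k ?c (b n)"
        "(\<Sum>i<2*n. \<bar>?c i\<bar>) = (\<Sum>i<k. \<bar>?c i\<bar>)" by (rule *, simp)+
      moreover have "lc k ?c (a n) = lc k c A" using n by (intro sum.cong) (auto simp: A)
      moreover have "lc k ?c (b n) = lc k c (b n)" "(\<Sum>i<k. \<bar>?c i\<bar>) = (\<Sum>i<k. \<bar>c i\<bar>)" by (auto intro: sum.cong)
      ultimately show ?thesis using correlatedD[OF corr[of n], of ?c] by simp
    qed
    then have le: "\<forall>\<^sub>F n in sequentially. norm (p (lc k c A) - norm (lc k c (b n))) \<le> (1/2)^n * (\<Sum>i<k. \<bar>c i\<bar>)"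
      by (auto simp: eventually_sequentially)
    have "(\<lambda>n. (1/2)^n * (\<Sum>i<k. \<bar>c i\<bar>)) \<longlonglongrightarrow> 0"
      by (intro tendsto_mult_left_zero LIMSEQ_power_zero) simp
    then have "(\<lambda>n. p (lc k c A) - norm (lc k c (b n))) \<longlonglongrightarrow> 0" by (rule Lim_null_comparison[OF le])
    moreover have "(\<lambda>n. p (lc k c A) - norm (lc k c (b n))) \<longlonglongrightarrow> p (lc k c A) - norm (lc k c B)"
      by (intro tendsto_intros B)
    ultimately show ?thesis using LIMSEQ_unique by fastforce
  qed
  have lin_lc: "\<exists>k. linext g x = lc k (lookup x) g \<and> linext h x = lc k (lookup x) h"
    for x :: "nat \<Rightarrow>\<^sub>0 real" and g :: "nat \<Rightarrow> 'w" and h :: "nat \<Rightarrow> 'g"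
  proof -
    obtain k where "keys x \<subseteq> {..<k}"
      using finite_nat_set_iff_bounded[of "keys x"] finite_keys[of x] by auto
    then show ?thesis by (intro exI[of _ k] conjI linext_superset) auto
  qed
  have isoB: "norm (linext B x) = p (linext A x)" for x using lin_lc[of A x B] iso by metis
  have densA: "\<exists>x. p (linext A x - w) < r" if "0 < r" for w r
  proof -
    obtain n where n: "p (v n - w) < r" using v[OF \<open>0 < r\<close>] by blast
    have "A (Suc (2 * n)) = v n" using A[of "Suc (2 * n)" "Suc n"] av[of n] by simp
    then show ?thesis using n by (intro exI[of _ "pt (Suc (2 * n))"]) simp
  qed
  obtain J where J: "linear J" "\<And>w. norm (J w) = p w" "\<And>x. J (linext A x) = linext B x"
    using isometric_extension_dense[OF p linear_linext linear_linext isoB densA] by blast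
  show ?thesis
  proof (rule that[OF J(1,2)])
    fix y :: 'g and r :: real assume r: "0 < r"
    have z: "(\<lambda>n. 4 * (1/2::real)^n) \<longlonglongrightarrow> 0"
      by (intro tendsto_mult_right_zero LIMSEQ_power_zero) simp
    obtain N where N: "\<And>n. N \<le> n \<Longrightarrow> 4 * (1/2)^n < r / 2"
      using order_tendstoD(2)[OF z, of "r / 2"] r by (auto simp: eventually_sequentially)
    obtain j where j: "dist (e j) y < r / 2" using e[of "r / 2"] r by auto
    define n where "n = prod_encode (j, N)"
    have n: "N \<le> n" "d n = e j" by (auto simp: n_def d_def le_prod_encode_2)
    have "norm (B (2 * n) - b (Suc n) (2 * n)) \<le> 2 * (1/2)^n"
      using B(2)[of "2 * n" "Suc n"] by simp
    then have "norm (B (2 * n) - d n) \<le> 4 * (1/2)^n"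
      using bd[of n] norm_triangle_ineq[of "B (2 * n) - b (Suc n) (2 * n)" "b (Suc n) (2 * n) - d n"] by simp
    then have "norm (B (2 * n) - y) < r"
      using N[OF n(1)] j norm_triangle_ineq[of "B (2 * n) - d n" "d n - y"] by (simp add: n(2) dist_norm)
    moreover have "J (A (2 * n)) = B (2 * n)" using J(3)[of "pt (2 * n)"] by simp
    ultimately show "\<exists>w. norm (J w - y) < r" by metis
  qed
qed

section \<open>Functoriality\<close>

instance gen :: (countable, countable) countable
  by countable_datatype

text \<open>The symmetries of the set of functions \<open>A\<close>. Linear isometries act so on the
  dual ball, left translations on the functions \<open>d(x, .)\<close>. The inverse is demanded too,
  because \<open>pW_act_le\<close> yields an isometry only when applied in both directions.\<close>

definition autos :: "('x \<Rightarrow> real) set \<Rightarrow> ('x \<Rightarrow> 'x) set" where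
  "autos A = {h. (\<forall>a\<in>A. a \<circ> h \<in> A) \<and> (\<exists>h'. (\<forall>a\<in>A. a \<circ> h' \<in> A) \<and> (\<forall>x. h (h' x) = x) \<and> (\<forall>x. h' (h x) = x))}"

lemma autosI:
  assumes "\<And>a. a \<in> A \<Longrightarrow> a \<circ> h \<in> A" "\<And>a. a \<in> A \<Longrightarrow> a \<circ> h' \<in> A" "\<And>x. h (h' x) = x" "\<And>x. h' (h x) = x"
  shows "h \<in> autos A" "h' \<in> autos A"
  unfolding autos_def using assms by blast+

lemma id_autos: "id \<in> autos A"
  by (rule autosI(1)[of A id id]) auto

lemma comp_autos: "h \<in> autos A \<Longrightarrow> k \<in> autos A \<Longrightarrow> h \<circ> k \<in> autos A"
proof -
  assume "h \<in> autos A" "k \<in> autos A"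
  then obtain h' k' where h: "\<And>a. a \<in> A \<Longrightarrow> a \<circ> h \<in> A" "\<And>a. a \<in> A \<Longrightarrow> a \<circ> h' \<in> A" "\<And>x. h (h' x) = x" "\<And>x. h' (h x) = x"
    and k: "\<And>a. a \<in> A \<Longrightarrow> a \<circ> k \<in> A" "\<And>a. a \<in> A \<Longrightarrow> a \<circ> k' \<in> A" "\<And>x. k (k' x) = x" "\<And>x. k' (k x) = x"
    unfolding autos_def by blast
  have "a \<circ> (h \<circ> k) \<in> A" "a \<circ> (k' \<circ> h') \<in> A" if "a \<in> A" for a
    using k(1)[OF h(1)[OF that]] h(2)[OF k(2)[OF that]] by (simp_all add: o_assoc)
  then show ?thesis by (rule autosI(1)) (auto simp: h k)
qed

lemma carrier_Iso_LI:
  assumes "linear f" "\<And>x. norm (f x) = norm x" "\<And>y. \<exists>x. f x = y"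
  shows "f \<in> carrier Iso_L"
proof -
  have "dist (f x) (f y) = dist x y" for x y
    using assms(2)[of "x - y"] by (simp add: dist_norm linear_diff[OF assms(1)])
  moreover have "surj f" using assms(3) by (metis surjI)
  ultimately show ?thesis using assms(1) by (simp add: Iso_L_def Iso_def isometric_embedding_def)
qed

context base_family
begin

lemma pW_Base_diff: "pW A (pt (Base x) - pt (Base y)) = (SUP a\<in>A. \<bar>a x - a y\<bar>)"
  using pW_Base[of "pt x - pt y"] by (simp add: linear_diff[OF linear_linext])

lemma pn_Base_diff: "pn A n (pt (Base x) - pt (Base y)) = pW A (pt (Base x) - pt (Base y))"
proof -
  have "\<forall>g\<in>keys (pt (Base x) - pt (Base y) :: ('x, real) gen \<Rightarrow>\<^sub>0 real). old n g"
    using keys_diff[of "pt (Base x)" "pt (Base y) :: ('x, real) gen \<Rightarrow>\<^sub>0 real"] by fastforce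
  then show ?thesis using pW_eq by metis
qed

lemma one_point_property_pW: "one_point_property (pW A)"
  unfolding one_point_property_def using one_point_realisation by metis

text \<open>Names over \<open>nat\<close> and \<open>rat\<close> are countable;
  \<open>map_gen\<close> reads their base points through \<open>s\<close> and their numbers in the
  reals. For density, all base points and numbers of a given combination are approximated
  simultaneously and \<open>map_gen_tendsto\<close> applies.\<close>

lemma dense_sequence_pW:
  fixes s :: "nat \<Rightarrow> 'x"
  assumes s: "\<And>x r. 0 < r \<Longrightarrow> \<exists>n. pW A (pt (Base (s n)) - pt (Base x)) < r"
  obtains v :: "nat \<Rightarrow> ('x, real) gen \<Rightarrow>\<^sub>0 real" where "\<And>w r. 0 < r \<Longrightarrow> \<exists>n. pW A (v n - w) < r"
proof
  fix w :: "('x, real) gen \<Rightarrow>\<^sub>0 real" and r :: real assume r: "0 < r"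
  let ?D = "\<lambda>u :: ((nat, rat) gen \<times> rat) list. comb (map (\<lambda>y. (map_gen s real_of_rat (fst y), real_of_rat (snd y))) u)"
  obtain u where u: "comb u = w" using surj_comb by blast
  define N where "N i x = (SOME n. pW A (pt (Base (s n)) - pt (Base x)) < inverse (real (Suc i)))" for i x
  have N: "pW A (pt (Base (s (N i x))) - pt (Base x)) < inverse (real (Suc i))" for i x
    unfolding N_def by (rule someI_ex) (simp add: s)
  define q where "q i c = (SOME q. \<bar>real_of_rat q - c\<bar> < inverse (real (Suc i)))" for i c
  have q: "\<bar>real_of_rat (q i c) - c\<bar> < inverse (real (Suc i))" for i c
    unfolding q_def
  proof (rule someI_ex)
    have "c - inverse (real (Suc i)) < c + inverse (real (Suc i))" by (simp add: add_pos_pos)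
    then obtain q where "c - inverse (real (Suc i)) < real_of_rat q" "real_of_rat q < c + inverse (real (Suc i))"
      using of_rat_dense by blast
    then have "\<bar>real_of_rat q - c\<bar> < inverse (real (Suc i))" by linarith
    then show "\<exists>q. \<bar>real_of_rat q - c\<bar> < inverse (real (Suc i))" ..
  qed
  let ?g = "\<lambda>i. map_gen (\<lambda>x. s (N i x)) (\<lambda>c. real_of_rat (q i c))"
  have q0: "(\<lambda>i. \<bar>real_of_rat (q i c) - c\<bar>) \<longlonglongrightarrow> 0" for c
    by (rule tendsto_sandwich[OF _ _ tendsto_const LIMSEQ_inverse_real_of_nat])
       (use q in \<open>auto intro!: always_eventually less_imp_le\<close>)
  then have qc: "(\<lambda>i. real_of_rat (q i c)) \<longlonglongrightarrow> c" for c
    by (simp add: tendsto_rabs_zero_iff LIM_zero_iff)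
  have h0: "(\<lambda>i. pn A n (pt (Base (s (N i x))) - pt (Base x))) \<longlonglongrightarrow> 0" for x n
    unfolding pn_Base_diff
    by (rule tendsto_sandwich[OF _ _ tendsto_const LIMSEQ_inverse_real_of_nat])
       (use N in \<open>auto intro!: always_eventually less_imp_le seminorm_nonneg[OF seminorm_pW]\<close>)
  have g: "(\<lambda>i. pn A n (pt (?g i g) - pt g)) \<longlonglongrightarrow> 0" for g n
    using map_gen_tendsto[of "\<lambda>i x. s (N i x)" "\<lambda>x. x" sequentially "\<lambda>i c. real_of_rat (q i c)" "\<lambda>c. c" n g, OF h0 qc]
    by (simp add: gen.map_ident)
  have single: "(\<lambda>i. pn A n (single (?g i g) (real_of_rat (q i c)) - single g c)) \<longlonglongrightarrow> 0" for n g c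
    by (rule pn_single_tendsto[OF g qc])
  define U where "U i = map (\<lambda>y. (map_gen (N i) (q i) (fst y), q i (snd y))) u" for i
  have D: "?D (U i) = comb (map (\<lambda>y. (?g i (fst y), real_of_rat (q i (snd y)))) u)" for i
    by (simp add: U_def o_def gen.map_comp)
  obtain n where n: "\<forall>g\<in>fst ` set u. old n g"
  proof -
    have "\<exists>n. \<forall>g\<in>C. old n g" if "finite C" for C :: "('x, real) gen set"
      using that
    proof (induction C)
      case (insert g C)
      then obtain n m where "\<forall>g\<in>C. old n g" "old m g" using ex_old by blast
      then show ?case using old_mono[of n _ "max n m"] old_mono[of m g "max n m"] by auto
    qed simp
    then show ?thesis using that by blast
  qed
  have keys_comb: "keys (comb u') \<subseteq> fst ` set u'" for u' :: "(('x, real) gen \<times> real) list"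
  proof (induction u')
    case (Cons y u')
    then show ?case using keys_add[of "single (fst y) (snd y)" "comb u'"] by (cases y) (auto split: if_splits)
  qed simp
  \<comment> \<open>Since renaming keeps stages, all approximants belong to stage \<open>n\<close>,
    where \<open>pW A\<close> is \<open>pn A n\<close>.\<close>
  have old_map: "old n (map_gen h b g) \<longleftrightarrow> old n g" for h :: "'x \<Rightarrow> 'x" and b :: "real \<Rightarrow> real" and g by (cases g) auto
  have "\<forall>g\<in>keys (?D (U i) - w). old n g" for i
    using keys_diff[of "?D (U i)" w] keys_comb[of u] keys_comb[of "map (\<lambda>y. (?g i (fst y), real_of_rat (q i (snd y)))) u"] n
    unfolding D u[symmetric] by (fastforce simp: old_map)
  then have eq: "pW A (?D (U i) - w) = pn A n (?D (U i) - w)" for i by (rule pW_eq)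
  have "(\<lambda>i. pn A n (?D (U i) - w)) \<longlonglongrightarrow> 0"
  proof (rule tendsto_sandwich[OF _ _ tendsto_const])
    show "(\<lambda>i. \<Sum>y\<leftarrow>u. pn A n (single (?g i (fst y)) (real_of_rat (q i (snd y))) - single (fst y) (snd y))) \<longlonglongrightarrow> 0"
      by (rule sum_list_tendsto_zero) (rule single)
    show "\<forall>\<^sub>F i in sequentially. pn A n (?D (U i) - w) \<le> (\<Sum>y\<leftarrow>u. pn A n (single (?g i (fst y)) (real_of_rat (q i (snd y))) - single (fst y) (snd y)))"
      using pn_comb_diff[of n "\<lambda>y. ?g _ (fst y)" "\<lambda>y. real_of_rat (q _ (snd y))" u fst snd]
      by (simp add: D u)
  qed (auto intro!: always_eventually seminorm_nonneg[OF seminorm_pn])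
  then have "\<forall>\<^sub>F i in sequentially. pW A (?D (U i) - w) < r" unfolding eq using r by (rule order_tendstoD(2))
  then have "\<exists>i. pW A (?D (U i) - w) < r" by (rule eventually_happens'[OF sequentially_bot])
  then obtain i where "pW A (?D (U i) - w) < r" ..
  then show "\<exists>k. pW A (?D (from_nat k) - w) < r" by (intro exI[of _ "to_nat (U i)"]) simp
qed

text \<open>This is applied to the dual ball of a normed space and to the metric functions of a
  Polish group. Continuity is stated along an arbitrary filter on \<open>'i\<close>, so that the
  application can take neighbourhoods in its own group; only base points have to be tested.\<close>

theorem functorial_embedding:
  fixes s :: "nat \<Rightarrow> 'x"
  assumes G: "gurarij_space TYPE('g::banach)"
    and s: "\<And>x r. 0 < r \<Longrightarrow> \<exists>n. (SUP a\<in>A. \<bar>a (s n) - a x\<bar>) < r"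
  obtains \<beta> :: "'x \<Rightarrow> 'g::banach" and \<Theta> :: "('x \<Rightarrow> 'x) \<Rightarrow> 'g \<Rightarrow> 'g" where
    "\<And>v. norm (linext \<beta> v) = (SUP a\<in>A. \<bar>linext a v\<bar>)"
    "\<And>h. h \<in> autos A \<Longrightarrow> \<Theta> h \<in> carrier Iso_L"
    "\<And>h k. h \<in> autos A \<Longrightarrow> k \<in> autos A \<Longrightarrow> \<Theta> (h \<circ> k) = \<Theta> h \<circ> \<Theta> k"
    "\<And>h x. h \<in> autos A \<Longrightarrow> \<Theta> h (\<beta> x) = \<beta> (h x)"
    "\<And>(h :: 'i \<Rightarrow> 'x \<Rightarrow> 'x) h0 F y. h0 \<in> autos A \<Longrightarrow> (\<forall>\<^sub>F i in F. h i \<in> autos A) \<Longrightarrow>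
       (\<And>x. ((\<lambda>i. \<beta> (h i x)) \<longlongrightarrow> \<beta> (h0 x)) F) \<Longrightarrow> ((\<lambda>i. \<Theta> (h i) y) \<longlongrightarrow> \<Theta> h0 y) F"
proof -
  obtain v :: "nat \<Rightarrow> ('x, real) gen \<Rightarrow>\<^sub>0 real" where v: "\<And>w r. 0 < r \<Longrightarrow> \<exists>n. pW A (v n - w) < r"
    by (rule dense_sequence_pW[of s]) (use s in \<open>auto simp: pW_Base_diff\<close>)
  obtain J :: "(('x, real) gen \<Rightarrow>\<^sub>0 real) \<Rightarrow> 'g" where J: "linear J" "\<And>w. norm (J w) = pW A w"
    and dense: "\<And>y r. 0 < r \<Longrightarrow> \<exists>w. norm (J w - y) < r"
    by (rule isometric_dense_embedding[OF G seminorm_pW one_point_property_pW], erule v) (rule that, auto)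
  define \<beta> where "\<beta> x = J (pt (Base x))" for x
  have \<beta>: "linext \<beta> u = J (linext (\<lambda>x. pt (Base x)) u)" for u
    unfolding \<beta>_def by (rule linear_linext_comp[OF J(1), symmetric])
  have "\<exists>T. linear T \<and> (\<forall>y. norm (T y) = norm y) \<and> (\<forall>w. T (J w) = J (act h w))" if h: "h \<in> autos A" for h
  proof -
    obtain h' where h': "\<And>a. a \<in> A \<Longrightarrow> a \<circ> h \<in> A" "\<And>a. a \<in> A \<Longrightarrow> a \<circ> h' \<in> A" "\<And>x. h' (h x) = x"
      using h unfolding autos_def by blast
    then have "h' \<circ> h = (\<lambda>x. x)" by auto
    then have "act h' (act h w) = w" for w by (simp add: act_comp act_id)
    then have "pW A (act h w) = pW A w" for w
      using pW_act_le[of h w] pW_act_le[of h' "act h w"] h' by (metis antisym)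
    then have iso: "norm (J (act h w)) = norm (J w)" for w by (simp add: J)
    have lin: "linear (\<lambda>w. J (act h w))" using linear_compose[OF linear_act J(1)] by (simp add: o_def)
    obtain T where "linear T" "\<And>x. norm (T x) = norm x" "\<And>v. T (J v) = J (act h v)"
      using isometric_extension_dense[OF seminorm_norm J(1) lin iso dense] by blast
    then show ?thesis by blast
  qed
  then obtain \<Theta> where lin: "\<And>h. h \<in> autos A \<Longrightarrow> linear (\<Theta> h)"
    and iso: "\<And>h y. h \<in> autos A \<Longrightarrow> norm (\<Theta> h y) = norm y"
    and ext: "\<And>h w. h \<in> autos A \<Longrightarrow> \<Theta> h (J w) = J (act h w)"
    by metis
  \<comment> \<open>Linear isometries that agree on the dense image of \<open>J\<close> are equal.
    So \<open>\<Theta>\<close> is a homomorphism although each \<open>\<Theta> h\<close> was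
    obtained by choice.\<close>
  have eqI: "T y = T' y" if "linear T" "linear T'" "\<And>y. norm (T y) = norm y" "\<And>y. norm (T' y) = norm y" "\<And>w. T (J w) = T' (J w)"
    for T T' :: "'g \<Rightarrow> 'g" and y
  proof (rule ccontr)
    assume "T y \<noteq> T' y"
    then have "0 < norm (T y - T' y) / 2" by simp
    then obtain w where w: "norm (J w - y) < norm (T y - T' y) / 2" using dense by blast
    have "T y - T' y = T' (J w - y) - T (J w - y)"
      using that(5)[of w] by (simp add: linear_diff[OF that(1)] linear_diff[OF that(2)])
    then have "norm (T y - T' y) \<le> norm (J w - y) + norm (J w - y)"
      using norm_triangle_ineq4[of "T' (J w - y)" "T (J w - y)"] by (simp add: that)
    then show False using w by simp
  qed
  have comp: "\<Theta> (h \<circ> k) = \<Theta> h \<circ> \<Theta> k" if h: "h \<in> autos A" and k: "k \<in> autos A" for h k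
  proof
    fix y
    show "\<Theta> (h \<circ> k) y = (\<Theta> h \<circ> \<Theta> k) y"
      by (rule eqI[OF lin[OF comp_autos[OF h k]] linear_compose[OF lin[OF k] lin[OF h]]])
         (simp_all add: iso ext comp_autos h k act_comp)
  qed
  have id: "\<Theta> id = id"
  proof
    fix y show "\<Theta> id y = id y"
      by (rule eqI[OF lin[OF id_autos] linear_id]) (simp_all add: iso ext id_autos act_id[unfolded id_def[symmetric]])
  qed
  show ?thesis
  proof
    show "norm (linext \<beta> u) = (SUP a\<in>A. \<bar>linext a u\<bar>)" for u by (simp add: \<beta> J pW_Base)
    show "\<Theta> h \<in> carrier Iso_L" if h: "h \<in> autos A" for h
    proof (rule carrier_Iso_LI[OF lin[OF h] iso[OF h]])
      fix y
      obtain h' where h': "\<And>a. a \<in> A \<Longrightarrow> a \<circ> h' \<in> A" "\<And>x. h (h' x) = x" "\<And>x. h' (h x) = x"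
        and "\<And>a. a \<in> A \<Longrightarrow> a \<circ> h \<in> A" using h unfolding autos_def by blast
      then have "h' \<in> autos A" by (intro autosI(2)[of A h])
      moreover have "h \<circ> h' = id" using h'(2) by auto
      ultimately have "\<Theta> h (\<Theta> h' y) = y" using fun_cong[OF comp[OF h], of h' y] id by simp
      then show "\<exists>x. \<Theta> h x = y" ..
    qed
    show "\<Theta> (h \<circ> k) = \<Theta> h \<circ> \<Theta> k" if "h \<in> autos A" "k \<in> autos A" for h k using comp that .
    show "\<Theta> h (\<beta> x) = \<beta> (h x)" if "h \<in> autos A" for h x by (simp add: \<beta>_def ext that)
  next
    fix h :: "'i \<Rightarrow> 'x \<Rightarrow> 'x" and h0 F y
    assume h0: "h0 \<in> autos A" and hi: "\<forall>\<^sub>F i in F. h i \<in> autos A"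
      and lim: "\<And>x. ((\<lambda>i. \<beta> (h i x)) \<longlongrightarrow> \<beta> (h0 x)) F"
    have "((\<lambda>i. pW A (pt (Base (h i x)) - pt (Base (h0 x)))) \<longlongrightarrow> 0) F" for x
    proof -
      have "norm (\<beta> x - \<beta> y) = pW A (pt (Base x) - pt (Base y))" for x y
        by (simp add: \<beta>_def flip: linear_diff[OF J(1)] J(2))
      then show ?thesis using lim[of x] by (subst (asm) tendsto_dist_iff) (simp add: dist_norm)
    qed
    then have act: "((\<lambda>i. pW A (act (h i) w - act h0 w)) \<longlongrightarrow> 0) F" for w by (rule pW_act_tendsto)
    show "((\<lambda>i. \<Theta> (h i) y) \<longlongrightarrow> \<Theta> h0 y) F"
    proof (rule tendstoI)
      fix e :: real assume e: "0 < e"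
      then obtain w where w: "norm (J w - y) < e / 3" using dense[of "e / 3" y] by auto
      have "\<forall>\<^sub>F i in F. pW A (act (h i) w - act h0 w) < e / 3" by (rule order_tendstoD(2)[OF act]) (use e in simp)
      then show "\<forall>\<^sub>F i in F. dist (\<Theta> (h i) y) (\<Theta> h0 y) < e"
        using hi
      proof eventually_elim
        case (elim i)
        \<comment> \<open>Both operators are isometric, so replacing \<open>y\<close> by the nearby
          \<open>J w\<close> costs at most \<open>e / 3\<close> twice.\<close>
        have "\<Theta> (h i) y - \<Theta> h0 y = J (act (h i) w - act h0 w) - \<Theta> (h i) (J w - y) + \<Theta> h0 (J w - y)"
          by (simp add: linear_diff[OF lin] linear_diff[OF J(1)] ext h0 elim)
        also have "norm \<dots> \<le> norm (J (act (h i) w - act h0 w)) + norm (\<Theta> (h i) (J w - y)) + norm (\<Theta> h0 (J w - y))"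
          using norm_triangle_ineq[of "J (act (h i) w - act h0 w) - \<Theta> (h i) (J w - y)" "\<Theta> h0 (J w - y)"]
            norm_triangle_ineq4[of "J (act (h i) w - act h0 w)" "\<Theta> (h i) (J w - y)"] by linarith
        also have "\<dots> < e" using elim w by (simp add: J(2) iso h0)
        finally show ?case by (simp add: dist_norm)
      qed
    qed
  qed
qed

end

section \<open>Isometry groups\<close>

abbreviation invf :: "('a \<Rightarrow> 'b) \<Rightarrow> 'b \<Rightarrow> 'a" where "invf \<equiv> inv_into UNIV"

lemma Iso_simps [simp]: "mult Iso = (\<circ>)" "one Iso = id" "mult Iso_L = (\<circ>)" "one Iso_L = id"
  by (simp_all add: Iso_def Iso_L_def)

lemma carrier_Iso: "f \<in> carrier Iso \<longleftrightarrow> (\<forall>x y. dist (f x) (f y) = dist x y) \<and> surj f"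
  by (simp add: Iso_def isometric_embedding_def)

lemma carrier_Iso_L: "f \<in> carrier Iso_L \<longleftrightarrow> f \<in> carrier Iso \<and> linear f"
  by (auto simp: Iso_L_def)

lemma Iso_dist: "f \<in> carrier Iso \<Longrightarrow> dist (f x) (f y) = dist x y"
  by (simp add: carrier_Iso)

lemma Iso_bij: "f \<in> carrier Iso \<Longrightarrow> bij f"
  unfolding carrier_Iso bij_def inj_def by (metis dist_eq_0_iff)

lemma Iso_inv: "f \<in> carrier Iso \<Longrightarrow> f (invf f x) = x" "f \<in> carrier Iso \<Longrightarrow> invf f (f x) = x"
  using Iso_bij[of f] by (auto simp: bij_def surj_f_inv_f)

lemma inv_in_Iso: "f \<in> carrier Iso \<Longrightarrow> invf f \<in> carrier Iso"
  unfolding carrier_Iso[of "invf f"]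
proof (intro conjI allI)
  assume f: "f \<in> carrier Iso"
  show "dist (invf f x) (invf f y) = dist x y" for x y
    using Iso_dist[OF f, of "invf f x" "invf f y"] by (simp add: Iso_inv[OF f])
  show "surj (invf f)" using Iso_bij[OF f] by (simp add: bij_imp_bij_inv bij_is_surj)
qed

lemma comp_in_Iso: "f \<in> carrier Iso \<Longrightarrow> g \<in> carrier Iso \<Longrightarrow> f \<circ> g \<in> carrier Iso"
  using comp_surj[of g f] by (simp add: carrier_Iso)

lemma id_in_Iso: "id \<in> carrier Iso"
  by (simp add: carrier_Iso)

lemma group_Iso: "group (Iso :: ('x::metric_space \<Rightarrow> 'x) monoid)"
proof (rule groupI)
  fix f :: "'x \<Rightarrow> 'x" assume f: "f \<in> carrier Iso"
  then have "invf f \<circ> f = id" by (auto simp: Iso_inv)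
  then show "\<exists>g\<in>carrier Iso. g \<otimes>\<^bsub>Iso\<^esub> f = \<one>\<^bsub>Iso\<^esub>" using inv_in_Iso[OF f] by auto
qed (auto simp: comp_in_Iso id_in_Iso o_assoc)

lemma subgroup_Iso_L: "subgroup (carrier Iso_L) (Iso :: ('e::real_normed_vector \<Rightarrow> 'e) monoid)"
proof -
  have lin: "linear (invf f)" if "f \<in> carrier Iso" "linear f" for f :: "'e \<Rightarrow> 'e"
  proof (rule linearI)
    fix x y c
    show "invf f (x + y) = invf f x + invf f y"
      using Iso_inv(2)[OF that(1), of "invf f x + invf f y"] by (simp add: linear_add[OF that(2)] Iso_inv(1)[OF that(1)])
    show "invf f (c *\<^sub>R x) = c *\<^sub>R invf f x"
      using Iso_inv(2)[OF that(1), of "c *\<^sub>R invf f x"] by (simp add: linear_scale[OF that(2)] Iso_inv(1)[OF that(1)])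
  qed
  have inv: "inv\<^bsub>Iso\<^esub> f = invf f" if "f \<in> carrier Iso" for f :: "'e \<Rightarrow> 'e"
  proof (rule group.inv_equality[OF group_Iso])
    show "invf f \<otimes>\<^bsub>Iso\<^esub> f = \<one>\<^bsub>Iso\<^esub>" using that by (auto simp: Iso_inv)
  qed (use that inv_in_Iso in auto)
  have "id \<in> (carrier Iso_L :: ('e \<Rightarrow> 'e) set)" by (simp add: carrier_Iso_L id_in_Iso linear_id)
  then have "carrier Iso_L \<noteq> ({} :: ('e \<Rightarrow> 'e) set)" by blast
  then show ?thesis
    by (intro group.subgroupI[OF group_Iso])
       (auto simp: carrier_Iso_L comp_in_Iso linear_compose inv inv_in_Iso lin)
qed

lemma Iso_L_eq: "Iso_L = Iso\<lparr>carrier := carrier Iso_L\<rparr>"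
  by (simp add: Iso_L_def)

lemma group_Iso_L: "group (Iso_L :: ('e::real_normed_vector \<Rightarrow> 'e) monoid)"
  using subgroup.subgroup_is_group[OF subgroup_Iso_L group_Iso] Iso_L_eq by metis

lemma inv_in_Iso_L:
  fixes f :: "'e::real_normed_vector \<Rightarrow> 'e"
  assumes "f \<in> carrier Iso_L" shows "invf f \<in> carrier Iso_L" and "inv\<^bsub>Iso_L\<^esub> f = invf f"
proof -
  have f: "f \<in> carrier Iso" using assms by (simp add: carrier_Iso_L)
  let ?g = "inv\<^bsub>Iso_L\<^esub> f"
  have g: "?g \<in> carrier Iso_L" "?g \<circ> f = id"
    using group.inv_closed[OF group_Iso_L assms] group.l_inv[OF group_Iso_L assms] by auto
  have "?g y = invf f y" for y using fun_cong[OF g(2), of "invf f y"] by (simp add: Iso_inv[OF f])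
  then show "inv\<^bsub>Iso_L\<^esub> f = invf f" ..
  then show "invf f \<in> carrier Iso_L" using g(1) by simp
qed

section \<open>The pointwise topology on the linear isometry group\<close>

lemma topspace_pointwise [simp]: "topspace (pointwise_topology S) = S"
  by (simp add: pointwise_topology_def)

lemma eventually_topspace_atin: "\<forall>\<^sub>F x in atin X a. x \<in> topspace X"
  unfolding eventually_atin by (metis DiffD1 openin_topspace)

lemma continuous_map_pointwise:
  "continuous_map X (pointwise_topology S) \<Phi> \<longleftrightarrow>
    (\<forall>x\<in>topspace X. \<Phi> x \<in> S) \<and> (\<forall>y. \<forall>x\<in>topspace X. ((\<lambda>z. \<Phi> z y) \<longlongrightarrow> \<Phi> x y) (atin X x))"
  unfolding pointwise_topology_def continuous_map_in_subtopology continuous_map_componentwise_UNIV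
  by (auto simp: continuous_map_atin)

lemma pointwise_eval_tendsto:
  "f \<in> S \<Longrightarrow> ((\<lambda>\<phi>. \<phi> y) \<longlongrightarrow> f y) (atin (pointwise_topology S) f)"
  using continuous_map_pointwise[of "pointwise_topology S" S "\<lambda>x. x"] by simp

lemma openin_pointwise_nbhd:
  fixes S :: "('a \<Rightarrow> 'b::metric_space) set"
  assumes U: "openin (pointwise_topology S) U" and f: "f \<in> U"
  obtains Y e where "finite Y" "0 < e" "\<And>g. g \<in> S \<Longrightarrow> (\<And>y. y \<in> Y \<Longrightarrow> dist (g y) (f y) < e) \<Longrightarrow> g \<in> U"
proof -
  obtain V where V: "openin (product_topology (\<lambda>_. euclidean) UNIV) V" and UV: "U = V \<inter> S"
    using U unfolding pointwise_topology_def openin_subtopology by blast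
  then obtain W where W: "finite {i. W i \<noteq> UNIV}" "\<And>i. open (W i)" "f \<in> PiE UNIV W" "PiE UNIV W \<subseteq> V"
    using f unfolding openin_product_topology_alt by fastforce
  have "\<exists>e>0. \<forall>z. dist z (f y) < e \<longrightarrow> z \<in> W y" for y
    using W(2)[of y] W(3) by (auto simp: open_dist)
  then obtain r where r: "\<And>y. 0 < r y" "\<And>y z. dist z (f y) < r y \<Longrightarrow> z \<in> W y" by metis
  let ?Y = "{i. W i \<noteq> UNIV}"
  show ?thesis
  proof (rule that[of ?Y "Min (insert 1 (r ` ?Y))"])
    fix g assume g: "g \<in> S" "\<And>y. y \<in> ?Y \<Longrightarrow> dist (g y) (f y) < Min (insert 1 (r ` ?Y))"
    have "g y \<in> W y" for y
    proof (cases "y \<in> ?Y")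
      case True
      then have "Min (insert 1 (r ` ?Y)) \<le> r y" using W(1) by (intro Min_le) auto
      then show ?thesis using g(2)[OF True] r(2)[of "g y" y] by simp
    qed auto
    then show "g \<in> U" using W(4) g(1) by (auto simp: UV)
  qed (use W(1) r(1) in auto)
qed

text \<open>Isometries are equicontinuous, so a dense sequence decides convergence.\<close>

lemma isometric_tendsto_dense:
  fixes f :: "'i \<Rightarrow> 'x::metric_space \<Rightarrow> 'y::metric_space" and e :: "'n \<Rightarrow> 'x"
  assumes f: "\<forall>\<^sub>F i in F. \<forall>x y. dist (f i x) (f i y) = dist x y" and f0: "\<And>x y. dist (f0 x) (f0 y) = dist x y"
    and e: "\<And>y r. 0 < r \<Longrightarrow> \<exists>n. dist (e n) y < r"
    and lim: "\<And>n. ((\<lambda>i. f i (e n)) \<longlongrightarrow> f0 (e n)) F"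
  shows "((\<lambda>i. f i y) \<longlongrightarrow> f0 y) F"
proof (rule tendstoI)
  fix r :: real assume r: "0 < r"
  then obtain n where n: "dist (e n) y < r / 3" using e[of "r / 3"] by auto
  have "\<forall>\<^sub>F i in F. dist (f i (e n)) (f0 (e n)) < r / 3" by (rule tendstoD[OF lim]) (use r in simp)
  then show "\<forall>\<^sub>F i in F. dist (f i y) (f0 y) < r"
    using f
  proof eventually_elim
    case (elim i)
    have "dist (f i y) (f0 y) \<le> dist (f i y) (f i (e n)) + dist (f i (e n)) (f0 (e n)) + dist (f0 (e n)) (f0 y)"
      using dist_triangle[of "f i y" "f0 y" "f i (e n)"] dist_triangle[of "f i (e n)" "f0 y" "f0 (e n)"] by linarith
    also have "\<dots> < r" using elim n by (simp add: f0 dist_commute)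
    finally show ?case .
  qed
qed

lemma topological_group_Iso_L:
  "topological_group (Iso_L :: ('e::real_normed_vector \<Rightarrow> 'e) monoid) (pointwise_topology (carrier Iso_L))"
  unfolding topological_group_def
proof (intro conjI)
  let ?T = "pointwise_topology (carrier Iso_L :: ('e \<Rightarrow> 'e) set)"
  have cL: "f \<in> carrier Iso" if "f \<in> carrier Iso_L" for f :: "'e \<Rightarrow> 'e" using that by (simp add: carrier_Iso_L)
  show "group (Iso_L :: ('e \<Rightarrow> 'e) monoid)" by (rule group_Iso_L)
  show "topspace ?T = carrier Iso_L" by simp
  show "continuous_map (prod_topology ?T ?T) ?T (\<lambda>(f, g). f \<otimes>\<^bsub>Iso_L\<^esub> g)"
    unfolding continuous_map_pointwise
  proof (intro conjI ballI allI)
    fix z :: "('e \<Rightarrow> 'e) \<times> ('e \<Rightarrow> 'e)" assume z: "z \<in> topspace (prod_topology ?T ?T)"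
    then obtain f0 g0 where z0: "z = (f0, g0)" "f0 \<in> carrier Iso_L" "g0 \<in> carrier Iso_L" by auto
    show "(case z of (f, g) \<Rightarrow> f \<otimes>\<^bsub>Iso_L\<^esub> g) \<in> carrier Iso_L"
      using group.subgroup_self[OF group_Iso_L] z0 by (auto simp: carrier_Iso_L comp_in_Iso linear_compose)
    fix y
    let ?F = "atin (prod_topology ?T ?T) z"
    have "continuous_map (prod_topology ?T ?T) ?T fst" "continuous_map (prod_topology ?T ?T) ?T snd"
      by (rule continuous_map_fst continuous_map_snd)+
    then have lim: "((\<lambda>w. fst w x) \<longlongrightarrow> f0 x) ?F" "((\<lambda>w. snd w x) \<longlongrightarrow> g0 x) ?F" for x
      using z unfolding continuous_map_pointwise z0(1) by auto
    have "((\<lambda>w. fst w (snd w y)) \<longlongrightarrow> f0 (g0 y)) ?F"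
    proof (rule tendsto_dist_iff[THEN iffD2], rule tendsto_sandwich[OF _ _ tendsto_const])
      show "((\<lambda>w. dist (snd w y) (g0 y) + dist (fst w (g0 y)) (f0 (g0 y))) \<longlongrightarrow> 0) ?F"
        using tendsto_add[OF lim(2)[of y, THEN tendsto_dist_iff[THEN iffD1]] lim(1)[of "g0 y", THEN tendsto_dist_iff[THEN iffD1]]] by simp
      show "\<forall>\<^sub>F w in ?F. dist (fst w (snd w y)) (f0 (g0 y)) \<le> dist (snd w y) (g0 y) + dist (fst w (g0 y)) (f0 (g0 y))"
        using eventually_topspace_atin[of "prod_topology ?T ?T" z]
      proof eventually_elim
        case (elim w)
        then have "fst w \<in> carrier Iso" by (auto intro: cL)
        then show ?case using dist_triangle[of "fst w (snd w y)" "f0 (g0 y)" "fst w (g0 y)"] by (simp add: Iso_dist)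
      qed
    qed simp
    then show "((\<lambda>w. (case w of (f, g) \<Rightarrow> f \<otimes>\<^bsub>Iso_L\<^esub> g) y) \<longlongrightarrow> (case z of (f, g) \<Rightarrow> f \<otimes>\<^bsub>Iso_L\<^esub> g) y) ?F"
      by (simp add: z0(1) case_prod_unfold)
  qed
  show "continuous_map ?T ?T (\<lambda>f. inv\<^bsub>Iso_L\<^esub> f)"
    unfolding continuous_map_pointwise
  proof (intro conjI ballI allI)
    fix f0 :: "'e \<Rightarrow> 'e" assume "f0 \<in> topspace ?T"
    then have f0: "f0 \<in> carrier Iso_L" by simp
    then show "inv\<^bsub>Iso_L\<^esub> f0 \<in> carrier Iso_L" by (simp add: inv_in_Iso_L)
    fix y
    let ?x = "invf f0 y"
    have "((\<lambda>f. invf f y) \<longlongrightarrow> ?x) (atin ?T f0)"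
    proof (rule tendsto_dist_iff[THEN iffD2], rule tendsto_sandwich[OF _ _ tendsto_const])
      show "((\<lambda>f. dist (f ?x) (f0 ?x)) \<longlongrightarrow> 0) (atin ?T f0)"
        using pointwise_eval_tendsto[OF f0, of ?x, THEN tendsto_dist_iff[THEN iffD1]] .
      \<comment> \<open>Applying \<open>f\<close> to both points on the left turns them into
        \<open>y = f0 ?x\<close> and \<open>f ?x\<close>.\<close>
      show "\<forall>\<^sub>F f in atin ?T f0. dist (invf f y) ?x \<le> dist (f ?x) (f0 ?x)"
        using eventually_topspace_atin[of ?T f0]
      proof eventually_elim
        case (elim f)
        then have "f \<in> carrier Iso" by (auto intro: cL)
        then have "dist (invf f y) ?x = dist y (f ?x)" using Iso_dist[of f "invf f y" ?x] by (simp add: Iso_inv)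
        then show ?case by (simp add: Iso_inv[OF cL[OF f0]] dist_commute)
      qed
    qed simp
    then have "((\<lambda>f. invf f y) \<longlongrightarrow> (inv\<^bsub>Iso_L\<^esub> f0) y) (atin ?T f0)" by (simp add: inv_in_Iso_L[OF f0])
    moreover have "\<forall>\<^sub>F f in atin ?T f0. invf f y = (inv\<^bsub>Iso_L\<^esub> f) y"
      using eventually_topspace_atin[of ?T f0] by eventually_elim (simp add: inv_in_Iso_L)
    ultimately show "((\<lambda>f. (inv\<^bsub>Iso_L\<^esub> f) y) \<longlongrightarrow> (inv\<^bsub>Iso_L\<^esub> f0) y) (atin ?T f0)"
      by (rule Lim_transform_eventually)
  qed
qed

text \<open>One isometry is picked from each nonempty box \<open>N ks\<close>, and there are only
  countably many lists \<open>ks\<close>. The length of the list is also the precision, so long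
  lists control any basic neighbourhood.\<close>

lemma separable_Iso_L:
  fixes e :: "nat \<Rightarrow> 'g::real_normed_vector"
  assumes e: "\<And>y r. 0 < r \<Longrightarrow> \<exists>n. dist (e n) y < r"
  shows "separable_space (pointwise_topology (carrier Iso_L :: ('g \<Rightarrow> 'g) set))"
proof -
  let ?L = "carrier Iso_L :: ('g \<Rightarrow> 'g) set"
  define N where "N ks = {f \<in> ?L. \<forall>i<length ks. dist (f (e i)) (e (ks ! i)) < inverse (real (length ks))}" for ks
  define pick where "pick ks = (SOME f. f \<in> N ks)" for ks
  define D where "D = pick ` {ks. N ks \<noteq> {}}"
  have pick: "pick ks \<in> N ks" if "N ks \<noteq> {}" for ks unfolding pick_def using that by (simp add: some_in_eq)
  have DL: "D \<subseteq> ?L" using pick by (auto simp: D_def N_def)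
  have iso: "dist (f x) (f y) = dist x y" if "f \<in> ?L" for f x y using that by (simp add: carrier_Iso_L Iso_dist)
  have "\<exists>g\<in>D. g \<in> U" if U: "openin (pointwise_topology ?L) U" and f: "f \<in> U" for U f
  proof -
    have fL: "f \<in> ?L" using openin_subset[OF U] f by auto
    obtain Y r where Y: "finite Y" "0 < r" "\<And>g. g \<in> ?L \<Longrightarrow> (\<And>y. y \<in> Y \<Longrightarrow> dist (g y) (f y) < r) \<Longrightarrow> g \<in> U"
      using openin_pointwise_nbhd[OF U f] by blast
    have "\<exists>n. dist (e n) y < r / 4" for y by (rule e) (use Y(2) in simp)
    then obtain k where k: "\<And>y. dist (e (k y)) y < r / 4" by metis
    obtain m0 :: nat where m0: "4 / r < real m0" using reals_Archimedean2 by blast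
    \<comment> \<open>Large enough for every index \<open>k y\<close> to occur in the list and for
      the precision to be finer than \<open>r / 4\<close>.\<close>
    define m where "m = Max (insert (Suc m0) ((\<lambda>y. Suc (k y)) ` Y))"
    have mk: "k y < m" if "y \<in> Y" for y
    proof -
      have "Suc (k y) \<le> m" unfolding m_def using that Y(1) by (intro Max_ge) auto
      then show ?thesis by simp
    qed
    have "Suc m0 \<le> m" using Y(1) unfolding m_def by (intro Max_ge) auto
    then have m: "0 < m" "4 / r < real m" using m0 by linarith+
    have small: "inverse (real m) < r / 4" using m Y(2) by (simp add: field_simps)
    have "\<exists>j. dist (f (e i)) (e j) < inverse (real m)" for i
      using e[of "inverse (real m)" "f (e i)"] m(1) by (simp add: dist_commute)
    then obtain j where j: "\<And>i. dist (f (e i)) (e (j i)) < inverse (real m)" by metis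
    let ?ks = "map j [0..<m]"
    have fN: "f \<in> N ?ks" using j fL by (simp add: N_def)
    then have gN: "pick ?ks \<in> N ?ks" "pick ?ks \<in> D" using pick by (auto simp: D_def)
    define g where "g = pick ?ks"
    have gL: "g \<in> ?L" and gj: "\<And>i. i < m \<Longrightarrow> dist (g (e i)) (e (j i)) < inverse (real m)"
      using gN(1) by (auto simp: N_def g_def)
    have "dist (g y) (f y) < r" if y: "y \<in> Y" for y
    proof -
      let ?i = "k y"
      have "dist (g y) (f y) \<le> dist (g y) (g (e ?i)) + dist (g (e ?i)) (e (j ?i)) + (dist (f (e ?i)) (e (j ?i)) + dist (f (e ?i)) (f y))"
        using dist_triangle[of "g y" "f y" "g (e ?i)"] dist_triangle[of "g (e ?i)" "f y" "e (j ?i)"]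
          dist_triangle2[of "e (j ?i)" "f y" "f (e ?i)"] dist_commute[of "f y" "f (e ?i)"] dist_commute[of "f (e ?i)" "e (j ?i)"] by linarith
      also have "\<dots> < r"
        using gj[OF mk[OF y]] j[of ?i] small k[of y] by (simp add: iso[OF gL] iso[OF fL] dist_commute)
      finally show ?thesis .
    qed
    then have "g \<in> U" using Y(3)[OF gL] by blast
    then show ?thesis using gN(2) by (auto simp: g_def)
  qed
  then have "pointwise_topology ?L closure_of D = ?L"
    using DL by (auto simp: closure_of_def)
  moreover have "countable D" unfolding D_def by (rule countable_image) simp
  ultimately show ?thesis unfolding separable_space_def using DL by auto
qed


lemma norm_Iso_L: "f \<in> carrier Iso_L \<Longrightarrow> norm (f x) = norm x"
  using Iso_dist[of f x 0] linear_0[of f] by (simp add: carrier_Iso_L)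

lemma linear_Iso_L: "f \<in> carrier Iso_L \<Longrightarrow> linear f"
  by (simp add: carrier_Iso_L)

text \<open>An isometry and its inverse are recorded together on a dense sequence: the resulting pairs of
  sequences are described by closed conditions, which makes the group a closed subset of a
  countable power of the space.\<close>

lemma completely_metrizable_Iso_L:
  fixes e :: "nat \<Rightarrow> 'g::banach"
  assumes e: "\<And>y r. 0 < r \<Longrightarrow> \<exists>n. dist (e n) y < r"
  shows "completely_metrizable_space (pointwise_topology (carrier Iso_L :: ('g \<Rightarrow> 'g) set))"
proof -
  let ?L = "carrier Iso_L :: ('g \<Rightarrow> 'g) set" and ?P = "product_topology (\<lambda>_. euclidean) UNIV :: (nat \<Rightarrow> 'g) topology"
  let ?T = "pointwise_topology ?L" and ?X = "prod_topology ?P ?P"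
  define C1 where "C1 v = {z \<in> topspace ?X. norm (linext (fst z) v) = norm (linext e v)}" for v
  define C2 where "C2 v = {z \<in> topspace ?X. norm (linext (snd z) v) = norm (linext e v)}" for v
  \<comment> \<open>The relation \<open>norm (f x - y) = norm (x - g y)\<close> says that
    \<open>g\<close> is inverse to \<open>f\<close> without composing the two, so on combinations of
    the \<open>e n\<close> it is a closed condition.\<close>
  define C3 where "C3 p = {z \<in> topspace ?X. norm (linext (fst z) (fst p) - linext e (snd p)) = norm (linext e (fst p) - linext (snd z) (snd p))}" for p
  define C where "C = \<Inter> (range C1 \<union> range C2 \<union> range C3)"
  have "continuous_map ?X ?P fst" "continuous_map ?X ?P snd" by (rule continuous_map_fst continuous_map_snd)+
  then have "continuous_map ?X euclidean (\<lambda>z. fst z n)" "continuous_map ?X euclidean (\<lambda>z. snd z n)" for n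
    unfolding continuous_map_componentwise_UNIV by blast+
  moreover have "z0 \<in> topspace ?X" for z0 by (cases z0) simp
  ultimately have lim: "((\<lambda>z. fst z n) \<longlongrightarrow> fst z0 n) (atin ?X z0)" "((\<lambda>z. snd z n) \<longlongrightarrow> snd z0 n) (atin ?X z0)" for n z0
    unfolding continuous_map_atin limitin_canonical_iff by blast+
  have cl: "closedin ?X {z \<in> topspace ?X. f z = g z}" if "\<And>z0. (f \<longlongrightarrow> f z0) (atin ?X z0)" "\<And>z0. (g \<longlongrightarrow> g z0) (atin ?X z0)"
    for f g :: "_ \<Rightarrow> real"
    by (rule closedin_continuous_maps_eq[of euclidean]) (auto simp: continuous_map_atin that)
  have "closedin ?X (C1 v)" "closedin ?X (C2 v)" "closedin ?X (C3 p)" for v p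
    unfolding C1_def C2_def C3_def linext_def by (rule cl; intro tendsto_intros lim)+
  then have closed: "closedin ?X C" unfolding C_def by (intro closedin_Inter) auto
  define \<Phi> where "\<Phi> f = ((\<lambda>n. f (e n)), (\<lambda>n. invf f (e n)))" for f :: "'g \<Rightarrow> 'g"
  have \<Phi>C: "\<Phi> f \<in> C" if f: "f \<in> ?L" for f
  proof -
    have fi: "invf f \<in> ?L" by (rule inv_in_Iso_L[OF f])
    have l: "linext (fst (\<Phi> f)) v = f (linext e v)" "linext (snd (\<Phi> f)) v = invf f (linext e v)" for v
      using linear_linext_comp[OF linear_Iso_L[OF f], of e v] linear_linext_comp[OF linear_Iso_L[OF fi], of e v] by (simp_all add: \<Phi>_def)
    have "norm (f x - y) = norm (x - invf f y)" for x y
      using norm_Iso_L[OF f, of "x - invf f y"] f by (simp add: linear_diff[OF linear_Iso_L[OF f]] Iso_inv carrier_Iso_L)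
    then show ?thesis
      by (auto simp: C_def C1_def C2_def C3_def l norm_Iso_L[OF f] norm_Iso_L[OF fi])
  qed
  have surj: "\<exists>f\<in>?L. \<Phi> f = z" if z: "z \<in> C" for z
  proof -
    obtain a b where ab: "z = (a, b)" by force
    have "z \<in> C1 v" "z \<in> C2 v" "z \<in> C3 (v, u)" for v u
      by (rule subsetD[OF _ z], auto simp: C_def)+
    then have c: "norm (linext a v) = norm (linext e v)" "norm (linext b v) = norm (linext e v)"
      "norm (linext a v - linext e u) = norm (linext e v - linext b u)" for v u
      by (simp_all add: C1_def C2_def C3_def ab)
    have dense: "\<exists>v. norm (linext e v - y) < r" if "0 < r" for y r
    proof -
      obtain n where "dist (e n) y < r" using e[OF \<open>0 < r\<close>] by blast
      then show ?thesis by (intro exI[of _ "pt n"]) (simp add: dist_norm)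
    qed
    obtain f where f: "linear f" "\<And>x. norm (f x) = norm x" "\<And>v. f (linext e v) = linext a v"
      using isometric_extension_dense[OF seminorm_norm linear_linext linear_linext c(1) dense] by blast
    obtain g where g: "linear g" "\<And>x. norm (g x) = norm x" "\<And>v. g (linext e v) = linext b v"
      using isometric_extension_dense[OF seminorm_norm linear_linext linear_linext c(2) dense] by blast
    \<comment> \<open>Combinations \<open>v\<close> and \<open>u\<close> approximate
      \<open>g y\<close> and \<open>y\<close>; the third relation then bounds the difference by four
      small terms, whence the quarter.\<close>
    have fg: "f (g y) = y" for y
    proof (rule ccontr)
      assume "f (g y) \<noteq> y"
      then have r: "0 < norm (f (g y) - y) / 4" by simp
      obtain v where v: "norm (linext e v - g y) < norm (f (g y) - y) / 4" using dense[OF r] by blast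
      obtain u where u: "norm (linext e u - y) < norm (f (g y) - y) / 4" using dense[OF r] by blast
      have "norm (f (linext e v) - linext e u) = norm (linext e v - g (linext e u))" using c(3) by (simp add: f g)
      moreover have "linext e v - g (linext e u) = (linext e v - g y) - g (linext e u - y)"
        by (simp add: linear_diff[OF g(1)])
      ultimately have 1: "norm (f (linext e v) - linext e u) \<le> norm (linext e v - g y) + norm (linext e u - y)"
        using norm_triangle_ineq4[of "linext e v - g y" "g (linext e u - y)"] by (simp add: g(2))
      have eq: "f (g y) - y = (f (linext e v) - linext e u) + (linext e u - y) - f (linext e v - g y)"
        by (simp add: linear_diff[OF f(1)])
      have "norm (f (g y) - y) \<le> norm (f (linext e v) - linext e u) + norm (linext e u - y) + norm (f (linext e v - g y))"
        unfolding eq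
        using norm_triangle_ineq4[of "(f (linext e v) - linext e u) + (linext e u - y)" "f (linext e v - g y)"]
          norm_triangle_ineq[of "f (linext e v) - linext e u" "linext e u - y"] by linarith
      then have "norm (f (g y) - y) \<le> norm (f (linext e v) - linext e u) + norm (linext e u - y) + norm (linext e v - g y)"
        by (simp only: f(2))
      with 1 v u show False by linarith
    qed
    have fL: "f \<in> ?L" by (rule carrier_Iso_LI[OF f(1,2)]) (use fg in blast)
    then have "invf f y = g y" for y using Iso_inv(2)[of f "g y"] fg by (simp add: carrier_Iso_L)
    then have "\<Phi> f = z" using f(3)[of "pt _"] g(3)[of "pt _"] by (simp add: \<Phi>_def ab)
    then show ?thesis using fL by blast
  qed
  define \<Psi> where "\<Psi> z = (SOME f. f \<in> ?L \<and> \<Phi> f = z)" for z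
  have \<Psi>: "\<Psi> z \<in> ?L" "\<Phi> (\<Psi> z) = z" if "z \<in> C" for z
    using someI_ex[of "\<lambda>f. f \<in> ?L \<and> \<Phi> f = z"] surj[OF that] unfolding \<Psi>_def by blast+
  have inj: "f = g" if "f \<in> ?L" "g \<in> ?L" "\<Phi> f = \<Phi> g" for f g
  proof
    fix y
    have fe: "f (e n) = g (e n)" for n using that(3) by (simp add: \<Phi>_def fun_eq_iff)
    have iso: "dist (f x) (f x') = dist x x'" "dist (g x) (g x') = dist x x'" for x x'
      using that(1,2) by (simp_all add: carrier_Iso_L Iso_dist)
    have "((\<lambda>_::nat. f y) \<longlongrightarrow> g y) sequentially"
      by (rule isometric_tendsto_dense[where e = e and f = "\<lambda>_. f" and ?f0.0 = g and y = y]) (simp_all add: iso fe e)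
    then show "f y = g y" by (simp add: LIMSEQ_const_iff)
  qed
  have topC: "topspace (subtopology ?X C) = C" using closedin_subset[OF closed] by auto
  have "homeomorphic_maps ?T (subtopology ?X C) \<Phi> \<Psi>"
    unfolding homeomorphic_maps_def
  proof (intro conjI ballI)
    have inv: "((\<lambda>f. invf f y) \<longlongrightarrow> invf f0 y) (atin ?T f0)" if f0: "f0 \<in> ?L" for f0 y
    proof -
      have "((\<lambda>f. (inv\<^bsub>Iso_L\<^esub> f) y) \<longlongrightarrow> (inv\<^bsub>Iso_L\<^esub> f0) y) (atin ?T f0)"
        using topological_group_Iso_L f0 unfolding topological_group_def continuous_map_pointwise by auto
      then have "((\<lambda>f. (inv\<^bsub>Iso_L\<^esub> f) y) \<longlongrightarrow> invf f0 y) (atin ?T f0)" by (simp add: inv_in_Iso_L[OF f0])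
      moreover have "\<forall>\<^sub>F f in atin ?T f0. (inv\<^bsub>Iso_L\<^esub> f) y = invf f y"
        using eventually_topspace_atin[of ?T f0] by eventually_elim (simp add: inv_in_Iso_L)
      ultimately show ?thesis by (rule Lim_transform_eventually)
    qed
    have "continuous_map ?T ?X \<Phi>"
      unfolding continuous_map_pairwise continuous_map_componentwise_UNIV
      by (auto simp: continuous_map_atin \<Phi>_def intro: pointwise_eval_tendsto inv)
    then show "continuous_map ?T (subtopology ?X C) \<Phi>"
      using \<Phi>C by (auto simp: continuous_map_in_subtopology)
    show "continuous_map (subtopology ?X C) ?T \<Psi>"
      unfolding continuous_map_pointwise topC
    proof (intro conjI ballI allI)
      show "\<Psi> z \<in> ?L" if "z \<in> C" for z using \<Psi>(1) that by blast
      fix y z0 assume z0: "z0 \<in> C"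
      let ?F = "atin (subtopology ?X C) z0"
      have inC: "\<forall>\<^sub>F z in ?F. z \<in> C" using eventually_topspace_atin[of "subtopology ?X C" z0] topC by simp
      show "((\<lambda>z. \<Psi> z y) \<longlongrightarrow> \<Psi> z0 y) ?F"
      proof (rule isometric_tendsto_dense[where e = e and f = \<Psi> and ?f0.0 = "\<Psi> z0" and y = y])
        show "\<exists>n. dist (e n) y < r" if "0 < r" for y r using e[OF that] .
        show "\<forall>\<^sub>F z in ?F. \<forall>x y. dist (\<Psi> z x) (\<Psi> z y) = dist x y"
          using inC by eventually_elim (use \<Psi>(1) in \<open>auto simp: carrier_Iso_L Iso_dist\<close>)
        show "dist (\<Psi> z0 x) (\<Psi> z0 y) = dist x y" for x y using \<Psi>(1)[OF z0] by (simp add: carrier_Iso_L Iso_dist)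
        fix n
        have \<Psi>e: "\<Psi> z (e n) = fst z n" if "z \<in> C" for z using \<Psi>(2)[OF that] by (metis \<Phi>_def fst_conv)
        have "continuous_map (subtopology ?X C) ?P fst"
          by (rule continuous_map_from_subtopology[OF continuous_map_fst])
        then have "continuous_map (subtopology ?X C) euclidean (\<lambda>z. fst z n)"
          unfolding continuous_map_componentwise_UNIV by blast
        then have "((\<lambda>z. fst z n) \<longlongrightarrow> fst z0 n) ?F"
          unfolding continuous_map_atin limitin_canonical_iff topC using z0 by blast
        then have "((\<lambda>z. fst z n) \<longlongrightarrow> \<Psi> z0 (e n)) ?F" by (simp add: \<Psi>e[OF z0])
        then show "((\<lambda>z. \<Psi> z (e n)) \<longlongrightarrow> \<Psi> z0 (e n)) ?F"
          by (rule Lim_transform_eventually) (use inC in \<open>eventually_elim, simp add: \<Psi>e\<close>)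
      qed
    qed
    show "\<Psi> (\<Phi> f) = f" if "f \<in> topspace ?T" for f
      using that \<Psi>[OF \<Phi>C] by (intro inj) auto
    show "\<Phi> (\<Psi> z) = z" if "z \<in> topspace (subtopology ?X C)" for z using that topC \<Psi>(2) by simp
  qed
  then have "?T homeomorphic_space subtopology ?X C" unfolding homeomorphic_space_def by blast
  moreover have "completely_metrizable_space ?P"
    unfolding completely_metrizable_space_product_topology by (simp add: completely_metrizable_space_euclidean)
  then have "completely_metrizable_space ?X" by (simp add: completely_metrizable_space_prod_topology)
  then have "completely_metrizable_space (subtopology ?X C)" using closed by (rule completely_metrizable_space_closedin)
  ultimately show ?thesis using homeomorphic_completely_metrizable_space by blast
qed

theorem polish_group_Iso_L:
  assumes "separable_space (euclidean :: 'g::banach topology)"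
  shows "polish_group (Iso_L :: ('g \<Rightarrow> 'g) monoid) (pointwise_topology (carrier Iso_L))"
proof -
  obtain e :: "nat \<Rightarrow> 'g" where e: "\<And>y r. 0 < r \<Longrightarrow> \<exists>n. dist (e n) y < r"
    by (rule separable_dense_sequence[OF assms]) blast
  show ?thesis
    unfolding polish_group_def
    by (intro conjI topological_group_Iso_L completely_metrizable_Iso_L[of e] separable_Iso_L[of e]; rule e)
qed

section \<open>Affine isometries\<close>

definition reflect :: "'e::real_normed_vector \<Rightarrow> 'e \<Rightarrow> 'e" where
  "reflect z x = 2 *\<^sub>R z - x"

lemma reflect_reflect: "reflect z (reflect z x) = x"
  by (simp add: reflect_def)

lemma reflect_Iso: "reflect z \<in> carrier Iso"
proof -
  have "surj (reflect z)" by (rule surjI[of _ "reflect z"]) (rule reflect_reflect)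
  then show ?thesis by (simp add: carrier_Iso reflect_def dist_norm norm_minus_commute)
qed

lemma reflect_midpoint:
  "reflect (midpoint a b) a = b" "reflect (midpoint a b) b = a"
  by (simp_all add: reflect_def midpoint_def)

lemma reflect_centre: "reflect z z = z"
  by (simp add: reflect_def scaleR_2)

text \<open>Vaisala's argument: with \<open>\<rho>\<close> the reflection in the midpoint, passing from \<open>g\<close> to \<open>\<rho> g\<^sup>-\<^sup>1 \<rho> g\<close> doubles the
  displacement of the midpoint, which is bounded.\<close>

lemma Iso_fixes_midpoint:
  fixes a b :: "'e::real_normed_vector"
  assumes g: "g \<in> carrier Iso" "g a = a" "g b = b"
  shows "g (midpoint a b) = midpoint a b"
proof -
  let ?z = "midpoint a b"
  define \<rho> where "\<rho> = reflect ?z"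
  have \<rho>: "\<rho> \<in> carrier Iso" and \<rho>ab: "\<rho> a = b" "\<rho> b = a" "\<rho> ?z = ?z"
    unfolding \<rho>_def by (rule reflect_Iso reflect_midpoint reflect_centre)+
  define W where "W = {g \<in> carrier Iso. g a = a \<and> g b = b}"
  \<comment> \<open>As \<open>g\<close> fixes \<open>a\<close>, the displacement is bounded
    independently of \<open>g\<close>, so the supremum \<open>D\<close> below is finite.\<close>
  have bd: "dist (g ?z) ?z \<le> 2 * dist ?z a" if "g \<in> W" for g
  proof -
    have gI: "g \<in> carrier Iso" "g a = a" using that by (auto simp: W_def)
    then have "dist (g ?z) a = dist ?z a" using Iso_dist[OF gI(1), of ?z a] by simp
    then show ?thesis using dist_triangle2[of "g ?z" ?z a] by simp
  qed
  have bdd: "bdd_above ((\<lambda>g. dist (g ?z) ?z) ` W)" using bd by (rule bdd_aboveI2)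
  define D where "D = (SUP g\<in>W. dist (g ?z) ?z)"
  have up: "dist (g ?z) ?z \<le> D" if "g \<in> W" for g unfolding D_def using that bdd by (rule cSUP_upper)
  have half: "2 * dist (g ?z) ?z \<le> D" if g: "g \<in> W" for g
  proof -
    have gI: "g \<in> carrier Iso" "g a = a" "g b = b" using g by (auto simp: W_def)
    \<comment> \<open>The reflection exchanges \<open>a\<close> and \<open>b\<close>, so
      \<open>?h\<close> fixes both again.\<close>
    let ?h = "\<rho> \<circ> (invf g \<circ> (\<rho> \<circ> g))"
    have "invf g a = a" "invf g b = b" using Iso_inv(2)[OF gI(1), of a] Iso_inv(2)[OF gI(1), of b] gI by simp_all
    then have h: "?h \<in> W" using gI \<rho> by (auto simp: W_def comp_in_Iso inv_in_Iso \<rho>ab)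
    have "dist (?h ?z) ?z = dist (\<rho> (invf g (\<rho> (g ?z)))) (\<rho> ?z)" by (simp add: \<rho>ab)
    also have "\<dots> = dist (invf g (\<rho> (g ?z))) (invf g (g ?z))" by (simp add: Iso_dist[OF \<rho>] Iso_inv[OF gI(1)])
    also have "\<dots> = dist (\<rho> (g ?z)) (g ?z)" by (rule Iso_dist[OF inv_in_Iso[OF gI(1)]])
    also have "\<dots> = 2 * dist (g ?z) ?z"
    proof -
      have "\<rho> (g ?z) - g ?z = 2 *\<^sub>R (?z - g ?z)" by (simp add: \<rho>_def reflect_def scaleR_2)
      then show ?thesis by (simp add: dist_norm norm_minus_commute)
    qed
    finally show ?thesis using up[OF h] by simp
  qed
  have "id \<in> W" by (simp add: W_def id_in_Iso)
  then have "W \<noteq> {}" by auto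
  then have "D \<le> D / 2" by (subst (1) D_def, rule cSUP_least) (use half in force)+
  moreover have "g \<in> W" using g by (simp add: W_def)
  ultimately have "dist (g ?z) ?z \<le> 0" using up[of g] by linarith
  then show ?thesis by simp
qed

text \<open>Composed with reflections and its inverse, \<open>f\<close> becomes an isometry fixing
  \<open>a\<close> and \<open>b\<close>; its fixing the midpoint means that \<open>f\<close>
  preserves midpoints, whence additivity. For real scalars, \<open>n c\<close> is compared with an
  integer: the error stays bounded while the defect is multiplied by \<open>n\<close>.\<close>

theorem Mazur_Ulam:
  fixes f :: "'e::real_normed_vector \<Rightarrow> 'e"
  assumes f: "f \<in> carrier Iso" and f0: "f 0 = 0"
  shows "linear f"
proof -
  have mid: "f (midpoint a b) = midpoint (f a) (f b)" for a b
  proof -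
    let ?z = "midpoint a b" and ?z' = "midpoint (f a) (f b)"
    let ?h = "reflect ?z \<circ> (invf f \<circ> (reflect ?z' \<circ> f))"
    have "?h \<in> carrier Iso" by (intro comp_in_Iso inv_in_Iso f reflect_Iso)
    moreover have "?h a = a" "?h b = b" by (simp_all add: reflect_midpoint Iso_inv[OF f])
    ultimately have "?h ?z = ?z" by (rule Iso_fixes_midpoint)
    then have "invf f (reflect ?z' (f ?z)) = reflect ?z ?z" using reflect_reflect[of ?z] by (metis comp_apply)
    then have "invf f (reflect ?z' (f ?z)) = ?z" by (simp add: reflect_centre)
    then have "reflect ?z' (f ?z) = f ?z" using Iso_inv(1)[OF f] by metis
    then have "2 *\<^sub>R ?z' = 2 *\<^sub>R f ?z" by (simp add: reflect_def scaleR_2 algebra_simps)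
    then show ?thesis by simp
  qed
  have half: "f ((1/2) *\<^sub>R x) = (1/2) *\<^sub>R f x" for x using mid[of 0 x] by (simp add: midpoint_def f0)
  have add: "f (x + y) = f x + f y" for x y
  proof -
    have "f (x + y) = f (midpoint (2 *\<^sub>R x) (2 *\<^sub>R y))" by (simp add: midpoint_def flip: scaleR_add_right)
    also have "\<dots> = (1/2) *\<^sub>R f (2 *\<^sub>R x) + (1/2) *\<^sub>R f (2 *\<^sub>R y)" by (subst mid) (simp add: midpoint_def scaleR_add_right)
    also have "\<dots> = f x + f y" using half[of "2 *\<^sub>R x"] half[of "2 *\<^sub>R y"] by simp
    finally show ?thesis .
  qed
  have neg: "f (- x) = - f x" for x using add[of x "- x"] f0 by (simp add: eq_neg_iff_add_eq_0 add.commute)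
  have nat: "f (real n *\<^sub>R x) = real n *\<^sub>R f x" for n x by (induction n) (simp_all add: f0 add scaleR_add_left)
  have int: "f (real_of_int k *\<^sub>R x) = real_of_int k *\<^sub>R f x" for k x
    using nat[of "nat k" x] nat[of "nat (- k)" x] neg[of "real (nat (- k)) *\<^sub>R x"] by (cases "0 \<le> k") auto
  have norm_f: "norm (f x - f y) = norm (x - y)" for x y using Iso_dist[OF f, of x y] by (simp add: dist_norm)
  have norm0: "norm (f x) = norm x" for x using norm_f[of x 0] by (simp add: f0)
  have "f (c *\<^sub>R x) = c *\<^sub>R f x" for c x
  proof (rule ccontr)
    assume "f (c *\<^sub>R x) \<noteq> c *\<^sub>R f x"
    then have pos: "0 < norm (f (c *\<^sub>R x) - c *\<^sub>R f x)" by simp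
    obtain n :: nat where n: "2 * norm x / norm (f (c *\<^sub>R x) - c *\<^sub>R f x) < real n" using reals_Archimedean2 by blast
    let ?k = "\<lfloor>real n * c\<rfloor>"
    have k: "\<bar>real n * c - real_of_int ?k\<bar> \<le> 1" by linarith
    have "real n * norm (f (c *\<^sub>R x) - c *\<^sub>R f x) = norm (real n *\<^sub>R (f (c *\<^sub>R x) - c *\<^sub>R f x))" by simp
    also have "real n *\<^sub>R (f (c *\<^sub>R x) - c *\<^sub>R f x) = (f ((real n * c) *\<^sub>R x) - f (real_of_int ?k *\<^sub>R x)) + (real_of_int ?k - real n * c) *\<^sub>R f x"
      using nat[of n "c *\<^sub>R x"] by (simp add: int algebra_simps)
    also have "norm \<dots> \<le> norm ((real n * c) *\<^sub>R x - real_of_int ?k *\<^sub>R x) + \<bar>real_of_int ?k - real n * c\<bar> * norm x"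
      using norm_triangle_ineq[of "f ((real n * c) *\<^sub>R x) - f (real_of_int ?k *\<^sub>R x)" "(real_of_int ?k - real n * c) *\<^sub>R f x"]
      by (simp add: norm_f norm0)
    also have "norm ((real n * c) *\<^sub>R x - real_of_int ?k *\<^sub>R x) = \<bar>real n * c - real_of_int ?k\<bar> * norm x"
      by (simp flip: scaleR_diff_left)
    also have "\<dots> + \<bar>real_of_int ?k - real n * c\<bar> * norm x \<le> 1 * norm x + 1 * norm x"
      using k by (intro add_mono mult_right_mono) (auto simp: abs_minus_commute)
    finally show False using n pos by (simp add: field_simps)
  qed
  then show ?thesis using add by (intro linearI) auto
qed

lemma Iso_linear_part:
  fixes \<phi> :: "'e::real_normed_vector \<Rightarrow> 'e"
  assumes \<phi>: "\<phi> \<in> carrier Iso" shows "(\<lambda>x. \<phi> x - \<phi> 0) \<in> carrier Iso_L"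
proof -
  have "\<exists>x. \<phi> x - \<phi> 0 = y" for y
    using Iso_inv(1)[OF \<phi>, of "y + \<phi> 0"] by (intro exI[of _ "invf \<phi> (y + \<phi> 0)"]) simp
  then have "surj (\<lambda>x. \<phi> x - \<phi> 0)" by (metis surjI)
  then have "(\<lambda>x. \<phi> x - \<phi> 0) \<in> carrier Iso"
    using Iso_dist[OF \<phi>] by (simp add: carrier_Iso dist_norm)
  moreover from this have "linear (\<lambda>x. \<phi> x - \<phi> 0)" by (rule Mazur_Ulam) simp
  ultimately show ?thesis by (simp add: carrier_Iso_L)
qed

section \<open>Embedding separable normed spaces\<close>

theorem separable_normed_g_embedding:
  assumes G: "gurarij_space TYPE('g::banach)"
    and sep: "separable_space (euclidean :: 'e::real_normed_vector topology)"
  shows "\<exists>i :: 'e \<Rightarrow> 'g. linear i \<and> g_embedding i"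
proof -
  define A where "A = {a :: 'e \<Rightarrow> real. linear a \<and> (\<forall>x. \<bar>a x\<bar> \<le> norm x)}"
  have "(\<lambda>_. 0) \<in> A" by (auto simp: A_def intro: linearI)
  then have ne: "A \<noteq> {}" by blast
  interpret base_family A
    by unfold_locales (use ne in \<open>auto simp: pointwise_bounded_def A_def\<close>)
  have sup: "(SUP a\<in>A. \<bar>a x\<bar>) = norm x" for x
  proof (rule antisym)
    show "(SUP a\<in>A. \<bar>a x\<bar>) \<le> norm x" by (rule cSUP_least[OF ne]) (simp add: A_def)
    obtain a where a: "linear a" "\<And>x. \<bar>a x\<bar> \<le> norm x" "a x = norm x"
      using norming_functional[OF seminorm_norm] by blast
    have "\<bar>a x\<bar> \<le> (SUP a\<in>A. \<bar>a x\<bar>)"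
      by (rule cSUP_upper) (use a in \<open>auto simp: A_def intro!: bdd_aboveI2[where M = "norm x"]\<close>)
    then show "norm x \<le> (SUP a\<in>A. \<bar>a x\<bar>)" using a(3) by simp
  qed
  obtain s :: "nat \<Rightarrow> 'e" where s: "\<And>y r. 0 < r \<Longrightarrow> \<exists>n. dist (s n) y < r"
    by (rule separable_dense_sequence[OF sep]) blast
  have sA: "(SUP a\<in>A. \<bar>a (s n) - a x\<bar>) = dist (s n) x" for n x
  proof -
    have "(SUP a\<in>A. \<bar>a (s n) - a x\<bar>) = (SUP a\<in>A. \<bar>a (s n - x)\<bar>)"
      by (intro SUP_cong) (auto simp: A_def linear_diff)
    then show ?thesis by (simp add: sup dist_norm)
  qed
  obtain \<beta> :: "'e \<Rightarrow> 'g" and \<Theta> where norm\<beta>: "\<And>v. norm (linext \<beta> v) = (SUP a\<in>A. \<bar>linext a v\<bar>)"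
    and \<Theta>: "\<And>h. h \<in> autos A \<Longrightarrow> \<Theta> h \<in> carrier Iso_L"
    and \<Theta>comp: "\<And>h k. h \<in> autos A \<Longrightarrow> k \<in> autos A \<Longrightarrow> \<Theta> (h \<circ> k) = \<Theta> h \<circ> \<Theta> k"
    and \<Theta>\<beta>: "\<And>h x. h \<in> autos A \<Longrightarrow> \<Theta> h (\<beta> x) = \<beta> (h x)"
    and \<Theta>lim: "\<And>(h :: ('e \<Rightarrow> 'e) \<Rightarrow> 'e \<Rightarrow> 'e) h0 F y. h0 \<in> autos A \<Longrightarrow> (\<forall>\<^sub>F i in F. h i \<in> autos A) \<Longrightarrow>
       (\<And>x. ((\<lambda>i. \<beta> (h i x)) \<longlongrightarrow> \<beta> (h0 x)) F) \<Longrightarrow> ((\<lambda>i. \<Theta> (h i) y) \<longlongrightarrow> \<Theta> h0 y) F"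
    by (rule functorial_embedding[OF G, where s = s and 'i = "'e \<Rightarrow> 'e"]) (use s sA in auto)
  have norm\<beta>': "norm (linext \<beta> v) = norm (linext (\<lambda>x. x) v)" for v
  proof -
    have "(SUP a\<in>A. \<bar>linext a v\<bar>) = (SUP a\<in>A. \<bar>a (linext (\<lambda>x. x) v)\<bar>)"
    proof (intro SUP_cong refl)
      fix a assume "a \<in> A"
      then have "a (linext (\<lambda>x. x) v) = linext a v" by (intro linear_linext_comp) (simp add: A_def)
      then show "\<bar>linext a v\<bar> = \<bar>a (linext (\<lambda>x. x) v)\<bar>" by simp
    qed
    then show ?thesis by (simp add: norm\<beta> sup)
  qed
  \<comment> \<open>\<open>\<beta>\<close> is given on points only. Linear relations carry over
    because the norm of a formal combination depends only on its value in \<open>'e\<close>.\<close>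
  have lin\<beta>: "linear \<beta>"
  proof (rule linearI)
    fix x y c
    have "norm (\<beta> (x + y) - (\<beta> x + \<beta> y)) = 0"
      using norm\<beta>'[of "pt (x + y) - (pt x + pt y)"] by (simp add: linear_diff[OF linear_linext] linear_add[OF linear_linext])
    then show "\<beta> (x + y) = \<beta> x + \<beta> y" by simp
    have "norm (\<beta> (c *\<^sub>R x) - c *\<^sub>R \<beta> x) = 0"
      using norm\<beta>'[of "pt (c *\<^sub>R x) - c *\<^sub>R pt x"] by (simp add: linear_diff[OF linear_linext] linear_scale[OF linear_linext])
    then show "\<beta> (c *\<^sub>R x) = c *\<^sub>R \<beta> x" by simp
  qed
  have iso\<beta>: "norm (\<beta> x) = norm x" for x using norm\<beta>'[of "pt x"] by simp
  have dist\<beta>: "dist (\<beta> x) (\<beta> y) = dist x y" for x y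
    by (simp add: dist_norm iso\<beta> flip: linear_diff[OF lin\<beta>])
  have autos: "h \<in> autos A" if h: "h \<in> carrier Iso_L" for h
  proof (rule autosI(1)[of A h "invf h"])
    have "a \<circ> k \<in> A" if "a \<in> A" "k \<in> carrier Iso_L" for a k
      using that linear_compose[OF linear_Iso_L[OF that(2)], of a] norm_Iso_L[OF that(2)] by (auto simp: A_def) metis
    then show "a \<circ> h \<in> A" "a \<circ> invf h \<in> A" if "a \<in> A" for a using that h inv_in_Iso_L(1)[OF h] by blast+
  qed (use h in \<open>simp_all add: Iso_inv carrier_Iso_L\<close>)
  define L where "L \<phi> x = \<phi> x - \<phi> 0" for \<phi> :: "'e \<Rightarrow> 'e" and x
  have L: "L \<phi> \<in> carrier Iso_L" if "\<phi> \<in> carrier Iso" for \<phi> unfolding L_def by (rule Iso_linear_part[OF that])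
  \<comment> \<open>An isometry is its linear part followed by the translation by
    \<open>\<phi> 0\<close>, which extends to the translation by
    \<open>\<beta> (\<phi> 0)\<close>.\<close>
  define \<Xi> where "\<Xi> \<phi> y = \<Theta> (L \<phi>) y + \<beta> (\<phi> 0)" for \<phi> y
  have \<Xi>Iso: "\<Xi> \<phi> \<in> carrier Iso" if \<phi>: "\<phi> \<in> carrier Iso" for \<phi>
  proof -
    have T: "\<Theta> (L \<phi>) \<in> carrier Iso" using \<Theta>[OF autos[OF L[OF \<phi>]]] by (simp add: carrier_Iso_L)
    have "\<Xi> \<phi> (invf (\<Theta> (L \<phi>)) (y - \<beta> (\<phi> 0))) = y" for y by (simp add: \<Xi>_def Iso_inv[OF T])
    then have "surj (\<Xi> \<phi>)" by (intro surjI[of "\<Xi> \<phi>" "\<lambda>y. invf (\<Theta> (L \<phi>)) (y - \<beta> (\<phi> 0))"])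
    then show ?thesis using Iso_dist[OF T] by (simp add: carrier_Iso \<Xi>_def dist_norm)
  qed
  have \<Xi>comp: "\<Xi> (\<phi> \<circ> \<psi>) = \<Xi> \<phi> \<circ> \<Xi> \<psi>" if \<phi>: "\<phi> \<in> carrier Iso" and \<psi>: "\<psi> \<in> carrier Iso" for \<phi> \<psi>
  proof
    fix y
    have "L (\<phi> \<circ> \<psi>) = L \<phi> \<circ> L \<psi>"
      using linear_diff[OF linear_Iso_L[OF L[OF \<phi>]]] by (auto simp: L_def fun_eq_iff)
    then have "\<Theta> (L (\<phi> \<circ> \<psi>)) y = \<Theta> (L \<phi>) (\<Theta> (L \<psi>) y)" using \<Theta>comp autos L \<phi> \<psi> by simp
    moreover have "\<beta> (\<phi> (\<psi> 0)) = \<beta> (L \<phi> (\<psi> 0)) + \<beta> (\<phi> 0)" by (simp add: L_def linear_diff[OF lin\<beta>])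
    ultimately show "\<Xi> (\<phi> \<circ> \<psi>) y = (\<Xi> \<phi> \<circ> \<Xi> \<psi>) y"
      using linear_add[OF linear_Iso_L[OF \<Theta>[OF autos[OF L[OF \<phi>]]]]] by (simp add: \<Xi>_def \<Theta>\<beta> autos L \<phi>)
  qed
  have "continuous_map (pointwise_topology (carrier Iso)) (pointwise_topology (carrier Iso)) \<Xi>"
    unfolding continuous_map_pointwise
  proof (intro conjI ballI allI)
    show "\<Xi> \<phi> \<in> carrier Iso" if "\<phi> \<in> topspace (pointwise_topology (carrier Iso))" for \<phi> using that \<Xi>Iso by simp
    fix y and \<phi>0 :: "'e \<Rightarrow> 'e" assume "\<phi>0 \<in> topspace (pointwise_topology (carrier Iso))"
    then have \<phi>0: "\<phi>0 \<in> carrier Iso" by simp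
    let ?F = "atin (pointwise_topology (carrier Iso)) \<phi>0"
    have ev: "((\<lambda>\<phi>. \<phi> x) \<longlongrightarrow> \<phi>0 x) ?F" for x by (rule pointwise_eval_tendsto[OF \<phi>0])
    have cont: "((\<lambda>\<phi>. \<beta> (g \<phi>)) \<longlongrightarrow> \<beta> l) ?F" if "(g \<longlongrightarrow> l) ?F" for g :: "('e \<Rightarrow> 'e) \<Rightarrow> 'e" and l
      using that unfolding tendsto_dist_iff[of g] tendsto_dist_iff[of "\<lambda>\<phi>. \<beta> (g \<phi>)"] by (simp add: dist\<beta>)
    have "((\<lambda>\<phi>. \<Theta> (L \<phi>) y) \<longlongrightarrow> \<Theta> (L \<phi>0) y) ?F"
    proof (rule \<Theta>lim)
      show "L \<phi>0 \<in> autos A" by (intro autos L \<phi>0)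
      show "\<forall>\<^sub>F \<phi> in ?F. L \<phi> \<in> autos A"
        using eventually_topspace_atin[of "pointwise_topology (carrier Iso)" \<phi>0] by eventually_elim (auto intro: autos L)
      show "((\<lambda>\<phi>. \<beta> (L \<phi> x)) \<longlongrightarrow> \<beta> (L \<phi>0 x)) ?F" for x
        unfolding L_def by (intro cont tendsto_diff ev)
    qed
    then show "((\<lambda>\<phi>. \<Xi> \<phi> y) \<longlongrightarrow> \<Xi> \<phi>0 y) ?F"
      unfolding \<Xi>_def by (intro tendsto_add cont ev)
  qed
  moreover have "\<Xi> \<in> hom Iso Iso" by (rule homI) (simp_all add: \<Xi>Iso \<Xi>comp)
  moreover have "\<Xi> \<phi> (\<beta> x) = \<beta> (\<phi> x)" if "\<phi> \<in> carrier Iso" for \<phi> x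
    by (simp add: \<Xi>_def \<Theta>\<beta>[OF autos[OF L[OF that]]] L_def linear_diff[OF lin\<beta>])
  ultimately have "g_embedding \<beta>"
    unfolding g_embedding_def isometric_embedding_def using dist\<beta> by blast
  then show ?thesis using lin\<beta> by blast
qed

section \<open>Left-invariant metrics\<close>

text \<open>Frink's lemma: the chain is cut at the last index before which it has at most half of its length.\<close>

lemma chain_bound:
  fixes f :: "'a \<Rightarrow> 'a \<Rightarrow> real"
  assumes nn: "\<And>x y. 0 \<le> f x y" and refl: "\<And>x. f x x = 0"
    and quasi: "\<And>x y z w. f x w \<le> 2 * max (f x y) (max (f y z) (f z w))"
  shows "f (p 0) (p N) \<le> 2 * (\<Sum>i<N. f (p i) (p (Suc i)))"
proof (induction N arbitrary: p rule: less_induct)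
  case (less N)
  show ?case
  proof (cases "N = 0")
    case False
    define S where "S k = (\<Sum>i<k. f (p i) (p (Suc i)))" for k
    have S0: "0 \<le> S k" for k by (simp add: S_def sum_nonneg nn)
    \<comment> \<open>The chain is cut at \<open>Max K\<close>; the strict bound leaves room for the
      middle step to the next index.\<close>
    define K where "K = {k. k < N \<and> S k \<le> S N / 2}"
    have "0 \<in> K" "finite K" using False S0[of N] by (auto simp: K_def S_def)
    then have k: "Max K \<in> K" "\<And>j. j \<in> K \<Longrightarrow> j \<le> Max K" using Max_in by auto
    define k where "k = Max K"
    have kN: "k < N" "S k \<le> S N / 2" using k(1) by (auto simp: K_def k_def)
    have split: "S N = S (Suc k) + (\<Sum>i<N - Suc k. f (p (i + Suc k)) (p (Suc i + Suc k)))"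
    proof -
      have "S N = S (Suc k) + (\<Sum>i=Suc k..<N. f (p i) (p (Suc i)))"
        unfolding S_def lessThan_atLeast0 using kN by (intro sum.atLeastLessThan_concat[symmetric]) auto
      also have "(\<Sum>i=Suc k..<N. f (p i) (p (Suc i))) = (\<Sum>i=0..<N - Suc k. f (p (i + Suc k)) (p (Suc (i + Suc k))))"
        using sum.shift_bounds_nat_ivl[of "\<lambda>i. f (p i) (p (Suc i))" 0 "Suc k" "N - Suc k"] kN by simp
      finally show ?thesis by (simp add: lessThan_atLeast0)
    qed
    have tail: "(\<Sum>i<N - Suc k. f (p (i + Suc k)) (p (Suc i + Suc k))) \<le> S N / 2"
    proof (cases "Suc k < N")
      case True
      have "Suc k \<notin> K" using k(2)[of "Suc k"] unfolding k_def by auto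
      then have "\<not> S (Suc k) \<le> S N / 2" using True by (simp add: K_def)
      then show ?thesis using split by simp
    next
      case False
      then show ?thesis using S0[of N] by simp
    qed
    \<comment> \<open>The outer pieces have at most half of the length, so the induction hypothesis
      bounds them by \<open>S N\<close>; the middle piece is a single summand.\<close>
    have "f (p 0) (p k) \<le> S N" using less[OF kN(1), of p] kN(2) by (simp add: S_def)
    moreover have "f (p k) (p (Suc k)) \<le> S N"
      using split S0[of k] sum_nonneg[of "{..<N - Suc k}" "\<lambda>i. f (p (i + Suc k)) (p (Suc i + Suc k))"] nn by (simp add: S_def)
    moreover have "f (p (Suc k)) (p N) \<le> S N"
      using less[of "N - Suc k" "\<lambda>i. p (i + Suc k)"] tail kN by simp
    ultimately show ?thesis
      using quasi[where x = "p 0" and w = "p N" and y = "p k" and z = "p (Suc k)"] by (simp add: S_def)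
  qed (simp add: refl)
qed

definition chain_sums :: "('a \<Rightarrow> 'a \<Rightarrow> real) \<Rightarrow> 'a \<Rightarrow> 'a \<Rightarrow> real set" where
  "chain_sums f x y = {S. \<exists>N p. p 0 = x \<and> p N = y \<and> S = (\<Sum>i<N. f (p i) (p (Suc i)))}"

text \<open>For a nonnegative symmetric \<open>f\<close> vanishing on the diagonal this is the
  largest pseudometric below \<open>f\<close>.\<close>

definition chain_dist :: "('a \<Rightarrow> 'a \<Rightarrow> real) \<Rightarrow> 'a \<Rightarrow> 'a \<Rightarrow> real" where
  "chain_dist f x y = Inf (chain_sums f x y)"

context
  fixes f :: "'a \<Rightarrow> 'a \<Rightarrow> real"
  assumes nn: "\<And>x y. 0 \<le> f x y" and refl: "\<And>x. f x x = 0" and sym: "\<And>x y. f x y = f y x"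
    and quasi: "\<And>x y z w. f x w \<le> 2 * max (f x y) (max (f y z) (f z w))"
begin

lemma chain_sums_base: "f x y \<in> chain_sums f x y"
  unfolding chain_sums_def by (intro CollectI exI[of _ 1] exI[of _ "\<lambda>i. if i = 0 then x else y"]) simp

lemma chain_sums_nonneg: "S \<in> chain_sums f x y \<Longrightarrow> 0 \<le> S"
  by (auto simp: chain_sums_def sum_nonneg nn)

lemma chain_sums_add:
  assumes "S \<in> chain_sums f x y" "S' \<in> chain_sums f y z" shows "S + S' \<in> chain_sums f x z"
proof -
  obtain N p where p: "p 0 = x" "p N = y" "S = (\<Sum>i<N. f (p i) (p (Suc i)))" using assms(1) by (auto simp: chain_sums_def)
  obtain M q where q: "q 0 = y" "q M = z" "S' = (\<Sum>i<M. f (q i) (q (Suc i)))" using assms(2) by (auto simp: chain_sums_def)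
  define r where "r i = (if i \<le> N then p i else q (i - N))" for i
  have rN: "r (i + N) = q i" for i using p q by (cases i) (auto simp: r_def)
  have "(\<Sum>i<M + N. f (r i) (r (Suc i))) = (\<Sum>i=0..<N. f (r i) (r (Suc i))) + (\<Sum>i=N..<M + N. f (r i) (r (Suc i)))"
    unfolding lessThan_atLeast0 by (rule sum.atLeastLessThan_concat[symmetric]) auto
  also have "(\<Sum>i=N..<M + N. f (r i) (r (Suc i))) = (\<Sum>i=0..<M. f (r (i + N)) (r (Suc i + N)))"
    using sum.shift_bounds_nat_ivl[of "\<lambda>i. f (r i) (r (Suc i))" 0 N M] by simp
  also have "\<dots> = S'" unfolding rN q(3) by (simp add: lessThan_atLeast0)
  also have "(\<Sum>i=0..<N. f (r i) (r (Suc i))) = S" unfolding p(3) lessThan_atLeast0 by (intro sum.cong) (auto simp: r_def)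
  finally show ?thesis unfolding chain_sums_def
    using p(1) q(2) rN[of M] by (intro CollectI exI[of _ "M + N"] exI[of _ r]) (auto simp: r_def)
qed

lemma chain_sums_sym: "S \<in> chain_sums f x y \<Longrightarrow> S \<in> chain_sums f y x"
proof -
  assume "S \<in> chain_sums f x y"
  then obtain N p where p: "p 0 = x" "p N = y" "S = (\<Sum>i<N. f (p i) (p (Suc i)))" by (auto simp: chain_sums_def)
  have "S = (\<Sum>i<N. f (p (N - Suc i)) (p (Suc (N - Suc i))))"
    unfolding p(3) by (rule sum.nat_diff_reindex[symmetric])
  also have "\<dots> = (\<Sum>i<N. f (p (N - i)) (p (N - Suc i)))"
    by (rule sum.cong[OF HOL.refl], subst sym) (simp add: Suc_diff_Suc)
  finally show ?thesis unfolding chain_sums_def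
    using p by (intro CollectI exI[of _ N] exI[of _ "\<lambda>i. p (N - i)"]) simp
qed

lemma bdd_chain_sums: "bdd_below (chain_sums f x y)"
  using chain_sums_nonneg by (intro bdd_belowI[of _ 0])

lemma chain_dist_le: "S \<in> chain_sums f x y \<Longrightarrow> chain_dist f x y \<le> S"
  unfolding chain_dist_def by (intro cInf_lower bdd_chain_sums)

lemma chain_dist_ge: "(\<And>S. S \<in> chain_sums f x y \<Longrightarrow> m \<le> S) \<Longrightarrow> m \<le> chain_dist f x y"
  unfolding chain_dist_def using chain_sums_base by (intro cInf_greatest) auto

lemma chain_dist_upper: "chain_dist f x y \<le> f x y"
  by (rule chain_dist_le[OF chain_sums_base])

lemma chain_dist_lower: "f x y \<le> 2 * chain_dist f x y"
proof -
  have "f x y / 2 \<le> chain_dist f x y"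
  proof (rule chain_dist_ge)
    fix S assume "S \<in> chain_sums f x y"
    then obtain N p where p: "p 0 = x" "p N = y" "S = (\<Sum>i<N. f (p i) (p (Suc i)))" by (auto simp: chain_sums_def)
    show "f x y / 2 \<le> S" using chain_bound[where f = f and p = p and N = N, OF nn refl quasi] p by simp
  qed
  then show ?thesis by simp
qed

lemma chain_dist_nonneg: "0 \<le> chain_dist f x y"
  by (rule chain_dist_ge[OF chain_sums_nonneg])

lemma chain_dist_refl: "chain_dist f x x = 0"
  using chain_dist_upper[of x x] chain_dist_nonneg[of x x] by (simp add: refl)

lemma chain_dist_sym: "chain_dist f x y = chain_dist f y x"
proof -
  have "chain_dist f x y \<le> chain_dist f y x" for x y
    by (rule chain_dist_ge, rule chain_dist_le, rule chain_sums_sym)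
  then show ?thesis by (intro antisym)
qed

lemma chain_dist_triangle: "chain_dist f x z \<le> chain_dist f x y + chain_dist f y z"
proof -
  have "chain_dist f x z - chain_dist f y z \<le> chain_dist f x y"
  proof (rule chain_dist_ge)
    fix S assume S: "S \<in> chain_sums f x y"
    have "chain_dist f x z - S \<le> chain_dist f y z"
    proof (rule chain_dist_ge)
      fix S' assume "S' \<in> chain_sums f y z"
      from chain_dist_le[OF chain_sums_add[OF S this]] show "chain_dist f x z - S \<le> S'" by simp
    qed
    then show "chain_dist f x z - chain_dist f y z \<le> S" by simp
  qed
  then show ?thesis by simp
qed

lemma chain_dist_contract:
  assumes "\<And>x y. f (k x) (k y) = f x y" shows "chain_dist f (k x) (k y) \<le> chain_dist f x y"
proof (rule chain_dist_ge)
  fix S assume "S \<in> chain_sums f x y"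
  then obtain N p where p: "p 0 = x" "p N = y" "S = (\<Sum>i<N. f (p i) (p (Suc i)))" by (auto simp: chain_sums_def)
  then have "S \<in> chain_sums f (k x) (k y)" unfolding chain_sums_def
    by (intro CollectI exI[of _ N] exI[of _ "\<lambda>i. k (p i)"]) (simp add: assms)
  then show "chain_dist f (k x) (k y) \<le> S" by (rule chain_dist_le)
qed

end

text \<open>The identity off the carrier makes this a permutation of the whole type, as
  \<open>autos\<close> requires.\<close>

definition translation :: "('a, 'b) monoid_scheme \<Rightarrow> 'a \<Rightarrow> 'a \<Rightarrow> 'a" where
  "translation H h x = (if x \<in> carrier H then h \<otimes>\<^bsub>H\<^esub> x else x)"

section \<open>The Birkhoff--Kakutani theorem\<close>

locale topological_grp =
  fixes H :: "('a, 'b) monoid_scheme" (structure) and T :: "'a topology"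
  assumes tg: "topological_group H T"
begin

sublocale group H using tg by (simp add: topological_group_def)

lemma topT: "topspace T = carrier H" using tg by (simp add: topological_group_def)

lemma open_carrier: "openin T (carrier H)" using openin_topspace[of T] by (simp add: topT)

lemma open_subset: "openin T U \<Longrightarrow> x \<in> U \<Longrightarrow> x \<in> carrier H"
  using openin_subset topT by blast

lemma continuous_mult: "continuous_map (prod_topology T T) T (\<lambda>(x, y). x \<otimes> y)"
  using tg by (simp add: topological_group_def)

lemma continuous_inv: "continuous_map T T (\<lambda>x. inv x)"
  using tg by (simp add: topological_group_def)

lemma continuous_left: "c \<in> carrier H \<Longrightarrow> continuous_map T T (\<lambda>y. c \<otimes> y)"
  and continuous_right: "c \<in> carrier H \<Longrightarrow> continuous_map T T (\<lambda>y. y \<otimes> c)"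
  using continuous_map_compose[OF _ continuous_mult, of T "\<lambda>y. (c, y)"]
    continuous_map_compose[OF _ continuous_mult, of T "\<lambda>y. (y, c)"]
  by (simp_all add: continuous_map_pairwise o_def topT)

lemma square_nbhd:
  assumes W: "openin T W" "\<one> \<in> W"
  obtains V where "openin T V" "\<one> \<in> V" "V \<subseteq> W" "\<And>x y. x \<in> V \<Longrightarrow> y \<in> V \<Longrightarrow> x \<otimes> y \<in> W"
proof -
  let ?M = "{z \<in> topspace (prod_topology T T). (\<lambda>(x, y). x \<otimes> y) z \<in> W}"
  have "openin (prod_topology T T) ?M" by (rule openin_continuous_map_preimage[OF continuous_mult W(1)])
  moreover have "(\<one>, \<one>) \<in> ?M" using W(2) by (simp add: topT)
  ultimately obtain A B where AB: "openin T A" "openin T B" "\<one> \<in> A" "\<one> \<in> B" "A \<times> B \<subseteq> ?M"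
    unfolding openin_prod_topology_alt by meson
  show ?thesis
  proof (rule that[of "A \<inter> B \<inter> W"])
    show "x \<otimes> y \<in> W" if "x \<in> A \<inter> B \<inter> W" "y \<in> A \<inter> B \<inter> W" for x y using AB(5) that by auto
  qed (use AB W in auto)
qed

text \<open>Cubes and not squares, because Frink's argument cuts a chain into three pieces.\<close>

lemma cube_nbhd:
  assumes W: "openin T W" "\<one> \<in> W"
  obtains V where "openin T V" "\<one> \<in> V" "V \<subseteq> W" "\<And>x. x \<in> V \<Longrightarrow> inv x \<in> V"
    "\<And>x y z. x \<in> V \<Longrightarrow> y \<in> V \<Longrightarrow> z \<in> V \<Longrightarrow> x \<otimes> y \<otimes> z \<in> W"
proof -
  obtain V1 where V1: "openin T V1" "\<one> \<in> V1" "V1 \<subseteq> W" "\<And>x y. x \<in> V1 \<Longrightarrow> y \<in> V1 \<Longrightarrow> x \<otimes> y \<in> W"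
    by (rule square_nbhd[OF W]) blast
  obtain V2 where V2: "openin T V2" "\<one> \<in> V2" "V2 \<subseteq> V1" "\<And>x y. x \<in> V2 \<Longrightarrow> y \<in> V2 \<Longrightarrow> x \<otimes> y \<in> V1"
    by (rule square_nbhd[OF V1(1,2)]) blast
  let ?V = "V2 \<inter> {x \<in> topspace T. inv x \<in> V2}"
  show ?thesis
  proof (rule that[of ?V])
    show "openin T ?V" by (intro openin_Int V2 openin_continuous_map_preimage[OF continuous_inv])
    show "\<one> \<in> ?V" using V2 by (simp add: topT)
    show "?V \<subseteq> W" using V1 V2 by auto
    show "inv x \<in> ?V" if "x \<in> ?V" for x using that by (auto simp: topT)
    show "x \<otimes> y \<otimes> z \<in> W" if "x \<in> ?V" "y \<in> ?V" "z \<in> ?V" for x y z using that V1(4) V2(3,4) by blast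
  qed
qed

text \<open>The gauge \<open>f x y\<close> measures how deep \<open>inv x \<otimes> y\<close> lies
  in a sequence of neighbourhoods \<open>U n\<close>. As the cube of \<open>U (Suc n)\<close> lies
  in \<open>U n\<close>, Frink's lemma applies and gives
  \<open>f / 2 \<le> chain_dist f \<le> f\<close>, so the two define the same
  neighbourhoods.\<close>

theorem left_invariant_metric:
  assumes met: "metrizable_space T"
  obtains d :: "'a \<Rightarrow> 'a \<Rightarrow> real" where
    "\<And>x y. 0 \<le> d x y" "\<And>x. d x x = 0" "\<And>x y. d x y = d y x" "\<And>x y z. d x z \<le> d x y + d y z" "\<And>x y. d x y \<le> 1"
    "\<And>h x y. h \<in> carrier H \<Longrightarrow> d (translation H h x) (translation H h y) = d x y"
    "\<And>x r. x \<in> carrier H \<Longrightarrow> 0 < r \<Longrightarrow> \<exists>W. openin T W \<and> x \<in> W \<and> (\<forall>y\<in>W. d x y < r)"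
    "\<And>W x. openin T W \<Longrightarrow> x \<in> W \<Longrightarrow> \<exists>r>0. \<forall>y\<in>carrier H. d x y < r \<longrightarrow> y \<in> W"
proof -
  obtain M \<mu> where M: "Metric_space M \<mu>" "T = Metric_space.mtopology M \<mu>"
    using met unfolding metrizable_space_def by blast
  interpret M: Metric_space M \<mu> by (rule M(1))
  have MC: "M = carrier H" using topT M(2) by simp
  let ?B = "\<lambda>n. M.mball \<one> (inverse (real (Suc n)))"
  define P where "P n V \<longleftrightarrow> openin T V \<and> \<one> \<in> V \<and> (\<forall>x\<in>V. inv x \<in> V) \<and> (n = 0 \<longrightarrow> V = carrier H)" for n :: nat and V
  \<comment> \<open>The balls of a compatible metric make the \<open>U n\<close> a neighbourhood
    base at the unit.\<close>
  define Q where "Q n V V' \<longleftrightarrow> V' \<subseteq> V \<and> V' \<subseteq> ?B n \<and> (\<forall>x\<in>V'. \<forall>y\<in>V'. \<forall>z\<in>V'. x \<otimes> y \<otimes> z \<in> V)" for n V V'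
  have "\<exists>U. \<forall>n. P n (U n) \<and> Q n (U n) (U (Suc n))"
  proof (rule dependent_nat_choice)
    show "\<exists>V. P 0 V" by (rule exI[of _ "carrier H"]) (simp add: P_def open_carrier)
    fix V n assume "P n V"
    moreover have "openin T (?B n)" unfolding M(2) by (rule M.openin_mball)
    moreover have "\<one> \<in> ?B n" by (rule M.centre_in_mball_iff[THEN iffD2]) (simp add: MC)
    ultimately have V: "openin T (V \<inter> ?B n)" "\<one> \<in> V \<inter> ?B n" by (auto simp: P_def)
    obtain V' where V': "openin T V'" "\<one> \<in> V'" "V' \<subseteq> V \<inter> ?B n" "\<And>x. x \<in> V' \<Longrightarrow> inv x \<in> V'"
      "\<And>x y z. x \<in> V' \<Longrightarrow> y \<in> V' \<Longrightarrow> z \<in> V' \<Longrightarrow> x \<otimes> y \<otimes> z \<in> V \<inter> ?B n"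
      by (rule cube_nbhd[OF V]) blast
    have "P (Suc n) V'" using V' by (simp add: P_def)
    moreover have "Q n V V'" using V'(3,5) unfolding Q_def by blast
    ultimately show "\<exists>V'. P (Suc n) V' \<and> Q n V V'" by blast
  qed
  then obtain U where U: "\<And>n. P n (U n)" "\<And>n. Q n (U n) (U (Suc n))" by blast
  have Uopen: "openin T (U n)" and U1: "\<one> \<in> U n" and Uinv: "x \<in> U n \<Longrightarrow> inv x \<in> U n" for n x using U(1) by (auto simp: P_def)
  have U0: "U 0 = carrier H" using U(1)[of 0] by (simp add: P_def)
  have Ucube: "x \<in> U (Suc n) \<Longrightarrow> y \<in> U (Suc n) \<Longrightarrow> z \<in> U (Suc n) \<Longrightarrow> x \<otimes> y \<otimes> z \<in> U n" for n x y z
    using U(2)[of n] by (simp add: Q_def)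
  have UB: "U (Suc n) \<subseteq> ?B n" for n using U(2)[of n] by (simp add: Q_def)
  have Udec: "U m \<subseteq> U n" if "n \<le> m" for n m
    using that by (rule lift_Suc_antimono_le[of U, rotated]) (use U(2) in \<open>simp add: Q_def\<close>)
  have UC: "x \<in> U n \<Longrightarrow> x \<in> carrier H" for x n using open_subset[OF Uopen] .
  \<comment> \<open>The exponent is the last \<open>k\<close> with \<open>x \<in> U k\<close>, where
    \<open>U 0\<close> is the whole group; so \<open>g x \<le> (1/2) ^ n\<close> means
    \<open>x \<in> U n\<close>.\<close>
  define g where "g x = (if \<forall>n. x \<in> U n then 0 else (1/2) ^ (LEAST k. x \<notin> U (Suc k)) :: real)" for x
  have g_le: "g x \<le> (1/2) ^ n \<longleftrightarrow> x \<in> U n" if x: "x \<in> carrier H" for x n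
  proof (cases "\<forall>n. x \<in> U n")
    case False
    then obtain m where "x \<notin> U m" by blast
    then have "x \<notin> U (Suc m)" using Udec[of m "Suc m"] by auto
    define k where "k = (LEAST k. x \<notin> U (Suc k))"
    have k: "x \<notin> U (Suc k)" unfolding k_def by (rule LeastI) fact
    have "x \<in> U k"
    proof (cases k)
      case (Suc j)
      then show ?thesis using not_less_Least[of j "\<lambda>k. x \<notin> U (Suc k)"] by (simp add: k_def)
    qed (simp add: U0 x)
    have "g x = (1/2) ^ k" using False by (simp add: g_def k_def)
    then have "g x \<le> (1/2) ^ n \<longleftrightarrow> n \<le> k" by (simp add: power_decreasing_iff)
    also have "\<dots> \<longleftrightarrow> x \<in> U n"
    proof
      assume "x \<in> U n"
      then show "n \<le> k" using k Udec[of "Suc k" n] by (metis not_less_eq_eq subsetD)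
    qed (use \<open>x \<in> U k\<close> Udec in blast)
    finally show ?thesis .
  qed (simp add: g_def)
  have g0: "0 \<le> g x" for x by (simp add: g_def)
  have g1: "g x \<le> 1" for x by (simp add: g_def power_le_one)
  have gpow: "g x = 0 \<or> (\<exists>k. g x = (1/2) ^ k)" for x by (auto simp: g_def)
  have ginv: "g (inv x) = g x" if x: "x \<in> carrier H" for x
  proof -
    have "inv x \<in> U n \<longleftrightarrow> x \<in> U n" for n using Uinv[of x n] Uinv[of "inv x" n] x by auto
    then show ?thesis by (simp add: g_def)
  qed
  have g_zero: "g x = 0" if "\<And>n. x \<in> U n" for x using that by (simp add: g_def)
  have cube: "g (x \<otimes> y \<otimes> z) \<le> 2 * max (g x) (max (g y) (g z))" if xyz: "x \<in> carrier H" "y \<in> carrier H" "z \<in> carrier H" for x y z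
  proof -
    define m where "m = max (g x) (max (g y) (g z))"
    have m: "g x \<le> m" "g y \<le> m" "g z \<le> m" by (auto simp: m_def)
    have c: "x \<otimes> y \<otimes> z \<in> carrier H" using xyz by simp
    have "m = g x \<or> m = g y \<or> m = g z" by (auto simp: m_def max_def)
    then have "m = 0 \<or> (\<exists>k. m = (1/2) ^ k)" using gpow by metis
    then have "g (x \<otimes> y \<otimes> z) \<le> 2 * m"
    proof (elim disjE exE)
      assume "m = 0"
      then have "g x \<le> (1/2) ^ Suc n" "g y \<le> (1/2) ^ Suc n" "g z \<le> (1/2) ^ Suc n" for n
        using m order_trans[of _ 0 "(1/2) ^ Suc n :: real"] by auto
      then have "x \<otimes> y \<otimes> z \<in> U n" for n using Ucube[of x n y z] g_le xyz by blast
      then show ?thesis using \<open>m = 0\<close> g_zero by simp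
    next
      fix k assume mk: "m = (1/2) ^ k"
      show ?thesis
      proof (cases k)
        case 0
        then show ?thesis using g1[of "x \<otimes> y \<otimes> z"] mk by simp
      next
        case (Suc j)
        then have "x \<otimes> y \<otimes> z \<in> U j" using Ucube[of x j y z] g_le xyz m mk by blast
        then show ?thesis using g_le[OF c, of j] mk Suc by simp
      qed
    qed
    then show ?thesis by (simp add: m_def)
  qed
  \<comment> \<open>Off the carrier the discrete metric keeps the bound 1, the three-step inequality
    and invariance under translations.\<close>
  define f where "f x y = (if x \<in> carrier H \<and> y \<in> carrier H then g (inv x \<otimes> y) else if x = y then 0 else 1)" for x y
  have nn: "0 \<le> f x y" for x y by (simp add: f_def g0)
  have f1: "f x y \<le> 1" for x y by (simp add: f_def g1)
  have refl: "f x x = 0" for x by (simp add: f_def g_zero U1)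
  have sym: "f x y = f y x" for x y
    using ginv[of "inv x \<otimes> y"] by (auto simp: f_def inv_mult_group)
  have quasi: "f x w \<le> 2 * max (f x y) (max (f y z) (f z w))" for x y z w
  proof (cases "x \<in> carrier H \<and> y \<in> carrier H \<and> z \<in> carrier H \<and> w \<in> carrier H")
    case True
    then have "(inv x \<otimes> y) \<otimes> (inv y \<otimes> z) \<otimes> (inv z \<otimes> w) = inv x \<otimes> w"
      by (simp add: m_assoc) (simp add: m_assoc[symmetric])
    then show ?thesis using cube[of "inv x \<otimes> y" "inv y \<otimes> z" "inv z \<otimes> w"] True by (simp add: f_def)
  next
    case False
    show ?thesis
    proof (cases "f x y = 1 \<or> f y z = 1 \<or> f z w = 1")
      case True
      then show ?thesis using f1[of x w] by auto
    next
      case ne: False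
      have "x = y \<or> x \<in> carrier H \<and> y \<in> carrier H" "y = z \<or> y \<in> carrier H \<and> z \<in> carrier H" "z = w \<or> z \<in> carrier H \<and> w \<in> carrier H"
        using ne by (auto simp: f_def split: if_splits)
      then have "x = w" using False by auto
      then show ?thesis using nn[of x y] by (simp add: refl le_max_iff_disj)
    qed
  qed
  let ?d = "chain_dist f"
  have cd: "?d x y \<le> f x y" "f x y \<le> 2 * ?d x y" for x y
    by (rule chain_dist_upper[where f = f, OF nn refl sym quasi] chain_dist_lower[where f = f, OF nn refl sym quasi])+
  have inv: "f (translation H h x) (translation H h y) = f x y" if h: "h \<in> carrier H" for h x y
  proof -
    have "inv (h \<otimes> x) \<otimes> (h \<otimes> y) = inv x \<otimes> y" if "x \<in> carrier H" "y \<in> carrier H"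
    proof -
      have "inv h \<otimes> (h \<otimes> y) = y" using that h by (simp add: m_assoc[symmetric])
      then show ?thesis using that h by (simp add: inv_mult_group m_assoc)
    qed
    moreover have "h \<otimes> x \<noteq> y" if "x \<in> carrier H" "y \<notin> carrier H" for x y using that h by auto
    ultimately show ?thesis using h by (auto simp: f_def translation_def)
  qed
  have inverse: "translation H (inv h) (translation H h x) = x" if h: "h \<in> carrier H" for h x
    using h by (simp add: translation_def m_assoc[symmetric])
  show ?thesis
  proof (rule that[of ?d])
    show "0 \<le> ?d x y" for x y by (rule chain_dist_nonneg[where f = f, OF nn refl sym quasi])
    show "?d x x = 0" for x by (rule chain_dist_refl[where f = f, OF nn refl sym quasi])
    show "?d x y = ?d y x" for x y by (rule chain_dist_sym[where f = f, OF nn refl sym quasi])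
    show "?d x z \<le> ?d x y + ?d y z" for x y z by (rule chain_dist_triangle[where f = f, OF nn refl sym quasi])
    show "?d x y \<le> 1" for x y using cd(1)[of x y] f1[of x y] by linarith
    show "?d (translation H h x) (translation H h y) = ?d x y" if h: "h \<in> carrier H" for h x y
    proof (rule antisym)
      show "?d (translation H h x) (translation H h y) \<le> ?d x y"
        by (rule chain_dist_contract[where f = f and k = "translation H h", OF nn refl sym quasi inv[OF h]])
      show "?d x y \<le> ?d (translation H h x) (translation H h y)"
        using chain_dist_contract[where f = f and k = "translation H (inv h)" and x = "translation H h x" and y = "translation H h y",
              OF nn refl sym quasi inv] h
        by (simp add: inverse)
    qed
  next
    fix x and r :: real assume x: "x \<in> carrier H" and r: "0 < r"
    obtain n where n: "(1/2) ^ n < r" using real_arch_pow_inv[OF r, of "1/2"] by auto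
    let ?W = "{y \<in> topspace T. inv x \<otimes> y \<in> U n}"
    have "openin T ?W" by (rule openin_continuous_map_preimage[OF continuous_left Uopen]) (simp add: x)
    moreover have "x \<in> ?W" using x U1 by (simp add: topT)
    moreover have "?d x y < r" if "y \<in> ?W" for y
    proof -
      have y: "y \<in> carrier H" "inv x \<otimes> y \<in> U n" using that by (auto simp: topT)
      then have "f x y \<le> (1/2) ^ n" using g_le[of "inv x \<otimes> y" n] x by (simp add: f_def)
      then show ?thesis using cd(1)[of x y] n by linarith
    qed
    ultimately show "\<exists>W. openin T W \<and> x \<in> W \<and> (\<forall>y\<in>W. ?d x y < r)" by blast
  next
    fix W x assume W: "openin T W" and xW: "x \<in> W"
    have x: "x \<in> carrier H" by (rule open_subset[OF W xW])
    let ?V = "{z \<in> topspace T. x \<otimes> z \<in> W}"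
    have "openin T ?V" by (rule openin_continuous_map_preimage[OF continuous_left[OF x] W])
    moreover have "\<one> \<in> ?V" using xW x by (simp add: topT)
    ultimately obtain \<epsilon> where \<epsilon>: "0 < \<epsilon>" "M.mball \<one> \<epsilon> \<subseteq> ?V" unfolding M(2) M.openin_mtopology by blast
    obtain n where n: "inverse (real (Suc n)) < \<epsilon>" using reals_Archimedean[OF \<epsilon>(1)] by blast
    have UV: "U (Suc n) \<subseteq> ?V" using UB[of n] \<epsilon>(2) M.mball_subset_concentric[of "inverse (real (Suc n))" \<epsilon> \<one>] n by (auto dest: less_imp_le)
    \<comment> \<open>One factor 2 is lost in passing from \<open>?d\<close> back to
      \<open>f\<close>.\<close>
    have "y \<in> W" if y: "y \<in> carrier H" "?d x y < (1/2) ^ Suc (Suc n)" for y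
    proof -
      have "f x y \<le> (1/2) ^ Suc n" using cd(2)[of x y] y(2) by simp
      then have "inv x \<otimes> y \<in> U (Suc n)" using g_le[of "inv x \<otimes> y" "Suc n"] x y by (simp add: f_def)
      then have "x \<otimes> (inv x \<otimes> y) \<in> W" using UV by blast
      then show ?thesis using x y by (simp add: m_assoc[symmetric])
    qed
    then show "\<exists>r>0. \<forall>y\<in>carrier H. ?d x y < r \<longrightarrow> y \<in> W" by (intro exI[of _ "(1/2) ^ Suc (Suc n)"]) auto
  qed
qed

end

section \<open>Embedding Polish groups\<close>

context topological_grp
begin

lemma translation_mult:
  "h \<in> carrier H \<Longrightarrow> k \<in> carrier H \<Longrightarrow> translation H (h \<otimes> k) = translation H h \<circ> translation H k"
  by (auto simp: translation_def m_assoc)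

lemma translation_inv:
  assumes "h \<in> carrier H"
  shows "translation H h (translation H (inv h) x) = x" "translation H (inv h) (translation H h x) = x"
  using assms by (simp_all add: translation_def m_assoc[symmetric])

text \<open>Viewing \<open>g\<close> as the function \<open>d(., g)\<close> is the Kuratowski
  embedding, so base points in the carrier keep their distances. The vector
  \<open>\<theta> h (\<beta> \<one>) = \<beta> h\<close> recovers \<open>h\<close>, which gives both
  injectivity and continuity of the inverse.\<close>

theorem embedding_into_Iso_L:
  assumes G: "gurarij_space TYPE('g::banach)" and met: "metrizable_space T" and sep: "separable_space T"
  shows "\<exists>S \<theta>. subgroup S (Iso_L :: ('g \<Rightarrow> 'g) monoid) \<and>
         \<theta> \<in> iso H (Iso_L\<lparr>carrier := S\<rparr>) \<and>
         homeomorphic_map T (subtopology (pointwise_topology (carrier Iso_L)) S) \<theta>"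
proof -
  obtain d :: "'a \<Rightarrow> 'a \<Rightarrow> real" where d: "\<And>x y. 0 \<le> d x y" "\<And>x. d x x = 0" "\<And>x y. d x y = d y x"
      "\<And>x y z. d x z \<le> d x y + d y z" "\<And>x y. d x y \<le> 1"
    and dinv: "\<And>h x y. h \<in> carrier H \<Longrightarrow> d (translation H h x) (translation H h y) = d x y"
    and dsmall: "\<And>x r. x \<in> carrier H \<Longrightarrow> 0 < r \<Longrightarrow> \<exists>W. openin T W \<and> x \<in> W \<and> (\<forall>y\<in>W. d x y < r)"
    and dnbhd: "\<And>W x. openin T W \<Longrightarrow> x \<in> W \<Longrightarrow> \<exists>r>0. \<forall>y\<in>carrier H. d x y < r \<longrightarrow> y \<in> W"
    by (rule left_invariant_metric[OF met]) blast
  define \<alpha> where "\<alpha> x g = (if g \<in> carrier H then d x g else 0)" for x g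
  define A where "A = \<alpha> ` carrier H"
  have ne: "A \<noteq> {}" unfolding A_def using one_closed by blast
  have \<alpha>1: "\<bar>\<alpha> x g\<bar> \<le> 1" for x g by (simp add: \<alpha>_def d)
  interpret base_family A
  proof
    show "pointwise_bounded A" using ne \<alpha>1 unfolding pointwise_bounded_def A_def by blast
  qed
  have \<alpha>diff: "\<bar>\<alpha> x g - \<alpha> x g'\<bar> \<le> d g g'" if "g \<in> carrier H" "g' \<in> carrier H" for x g g'
    using d(4)[of x g g'] d(4)[of x g' g] d(3)[of g' g] that by (simp add: \<alpha>_def abs_le_iff)
  have sup: "(SUP a\<in>A. \<bar>a g - a g'\<bar>) = d g g'" if g: "g \<in> carrier H" "g' \<in> carrier H" for g g'
  proof (rule antisym)
    show "(SUP a\<in>A. \<bar>a g - a g'\<bar>) \<le> d g g'"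
      by (rule cSUP_least[OF ne]) (use \<alpha>diff[OF g] in \<open>auto simp: A_def\<close>)
    have "\<bar>\<alpha> g g - \<alpha> g g'\<bar> \<le> (SUP a\<in>A. \<bar>a g - a g'\<bar>)"
      by (rule cSUP_upper) (use \<alpha>diff[OF g] g in \<open>auto simp: A_def intro!: bdd_aboveI2[where M = "d g g'"]\<close>)
    then show "d g g' \<le> (SUP a\<in>A. \<bar>a g - a g'\<bar>)" using g by (simp add: \<alpha>_def d)
  qed
  obtain D where D: "countable D" "D \<subseteq> carrier H" "T closure_of D = carrier H"
    using sep unfolding separable_space_def by (auto simp: topT)
  have "D \<noteq> {}" using D(3) one_closed by auto
  \<comment> \<open>Density is demanded over the whole type. All functions of \<open>A\<close>
    vanish off the carrier, so a single point there, if one exists, represents all the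
    others.\<close>
  define s where "s n = (case n of 0 \<Rightarrow> (SOME g. g \<notin> carrier H) | Suc n \<Rightarrow> from_nat_into D n)" for n
  have s: "\<exists>n. (SUP a\<in>A. \<bar>a (s n) - a x\<bar>) < r" if r: "0 < r" for x r
  proof (cases "x \<in> carrier H")
    case True
    obtain W where W: "openin T W" "x \<in> W" "\<And>y. y \<in> W \<Longrightarrow> d x y < r" using dsmall[OF True r] by blast
    have "x \<in> T closure_of D" using True D(3) by simp
    then obtain y where y: "y \<in> D" "y \<in> W" using W(1,2) unfolding in_closure_of by blast
    obtain n where "from_nat_into D n = y" using from_nat_into_surj[OF D(1) y(1)] by blast
    then have "s (Suc n) = y" by (simp add: s_def)
    then show ?thesis using W(3)[OF y(2)] sup[of y x] True y(1) D(2) d(3)[of y x] by (intro exI[of _ "Suc n"]) auto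
  next
    case False
    then have "s 0 \<notin> carrier H" unfolding s_def by (simp add: someI[of "\<lambda>g. g \<notin> carrier H" x])
    then have "(SUP a\<in>A. \<bar>a (s 0) - a x\<bar>) \<le> 0"
      by (intro cSUP_least[OF ne]) (use False in \<open>auto simp: A_def \<alpha>_def\<close>)
    then show ?thesis using r by (intro exI[of _ 0]) simp
  qed
  obtain \<beta> :: "'a \<Rightarrow> 'g" and \<Theta> where norm\<beta>: "\<And>v. norm (linext \<beta> v) = (SUP a\<in>A. \<bar>linext a v\<bar>)"
    and \<Theta>: "\<And>h. h \<in> autos A \<Longrightarrow> \<Theta> h \<in> carrier Iso_L"
    and \<Theta>comp: "\<And>h k. h \<in> autos A \<Longrightarrow> k \<in> autos A \<Longrightarrow> \<Theta> (h \<circ> k) = \<Theta> h \<circ> \<Theta> k"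
    and \<Theta>\<beta>: "\<And>h x. h \<in> autos A \<Longrightarrow> \<Theta> h (\<beta> x) = \<beta> (h x)"
    and \<Theta>lim: "\<And>(h :: 'a \<Rightarrow> 'a \<Rightarrow> 'a) h0 F y. h0 \<in> autos A \<Longrightarrow> (\<forall>\<^sub>F i in F. h i \<in> autos A) \<Longrightarrow>
       (\<And>x. ((\<lambda>i. \<beta> (h i x)) \<longlongrightarrow> \<beta> (h0 x)) F) \<Longrightarrow> ((\<lambda>i. \<Theta> (h i) y) \<longlongrightarrow> \<Theta> h0 y) F"
    by (rule functorial_embedding[OF G, where s = s and 'i = 'a]) (use s in auto)
  have dist\<beta>: "dist (\<beta> g) (\<beta> g') = d g g'" if "g \<in> carrier H" "g' \<in> carrier H" for g g'
    using norm\<beta>[of "pt g - pt g'"] sup[OF that] by (simp add: dist_norm linear_diff[OF linear_linext])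
  have \<alpha>tr: "\<alpha> x \<circ> translation H h = \<alpha> (inv h \<otimes> x)" if "x \<in> carrier H" "h \<in> carrier H" for x h
  proof
    fix g
    have "d x (h \<otimes> g) = d (inv h \<otimes> x) g" if "g \<in> carrier H"
      using dinv[of "inv h" x "h \<otimes> g"] that \<open>x \<in> carrier H\<close> \<open>h \<in> carrier H\<close> by (simp add: translation_def m_assoc[symmetric])
    then show "(\<alpha> x \<circ> translation H h) g = \<alpha> (inv h \<otimes> x) g" using that by (simp add: \<alpha>_def translation_def)
  qed
  have autos: "translation H h \<in> autos A" if h: "h \<in> carrier H" for h
  proof (rule autosI(1)[of A _ "translation H (inv h)"])
    have "a \<circ> translation H k \<in> A" if "a \<in> A" "k \<in> carrier H" for a k
      using that \<alpha>tr unfolding A_def by auto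
    then show "a \<circ> translation H h \<in> A" "a \<circ> translation H (inv h) \<in> A" if "a \<in> A" for a using that h by auto
  qed (use h translation_inv in auto)
  define \<theta> where "\<theta> h = \<Theta> (translation H h)" for h
  have \<theta>hom: "\<theta> \<in> hom H Iso_L"
    by (rule homI) (simp_all add: \<theta>_def \<Theta> autos \<Theta>comp translation_mult)
  then have gh: "group_hom H Iso_L \<theta>"
    by (simp add: group_hom_def group_hom_axioms_def group_axioms group_Iso_L)
  define S where "S = \<theta> ` carrier H"
  have S: "subgroup S Iso_L" unfolding S_def by (rule group_hom.img_is_subgroup[OF gh])
  have SL: "S \<subseteq> carrier Iso_L" using subgroup.subset[OF S] .
  have \<theta>1: "\<theta> h (\<beta> \<one>) = \<beta> h" if "h \<in> carrier H" for h
    using that by (simp add: \<theta>_def \<Theta>\<beta> autos translation_def)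
  \<comment> \<open>The distance was obtained as a pseudometric; it separates the points of the
    group because the topology is T1.\<close>
  have dzero: "x = y" if "x \<in> carrier H" "y \<in> carrier H" "d x y = 0" for x y
  proof (rule ccontr)
    assume "x \<noteq> y"
    moreover have "t1_space T" by (intro Hausdorff_imp_t1_space metrizable_imp_Hausdorff_space met)
    ultimately have "\<exists>W. openin T W \<and> x \<in> W \<and> y \<notin> W"
      using that(1,2) by (simp add: t1_space_def topT)
    then obtain W where W: "openin T W" "x \<in> W" "y \<notin> W" by auto
    show False using dnbhd[OF W(1,2)] that(2,3) W(3) by auto
  qed
  have inj: "inj_on \<theta> (carrier H)"
  proof (rule inj_onI)
    fix h k assume "h \<in> carrier H" "k \<in> carrier H" "\<theta> h = \<theta> k"
    then show "h = k" using \<theta>1[of h] \<theta>1[of k] dist\<beta>[of h k] dzero by simp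
  qed
  have subtop: "subtopology (pointwise_topology (carrier Iso_L)) S = pointwise_topology S"
    using SL by (simp add: pointwise_topology_def subtopology_subtopology Int_absorb1)
  have "homeomorphic_maps T (pointwise_topology S) \<theta> (inv_into (carrier H) \<theta>)"
    unfolding homeomorphic_maps_def
  proof (intro conjI ballI)
    show "continuous_map T (pointwise_topology S) \<theta>"
      unfolding continuous_map_pointwise topT
    proof (intro conjI ballI allI)
      show "\<theta> h \<in> S" if "h \<in> carrier H" for h using that by (simp add: S_def)
      fix y h0 assume h0: "h0 \<in> carrier H"
      show "((\<lambda>h. \<theta> h y) \<longlongrightarrow> \<theta> h0 y) (atin T h0)"
        unfolding \<theta>_def
      proof (rule \<Theta>lim[OF autos[OF h0]])
        have ev: "\<forall>\<^sub>F h in atin T h0. h \<in> carrier H" using eventually_topspace_atin[of T h0] by (simp add: topT)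
        then show "\<forall>\<^sub>F h in atin T h0. translation H h \<in> autos A" by eventually_elim (rule autos)
        fix x
        show "((\<lambda>h. \<beta> (translation H h x)) \<longlongrightarrow> \<beta> (translation H h0 x)) (atin T h0)"
        proof (cases "x \<in> carrier H")
          case True
          show ?thesis
          proof (rule tendstoI)
            fix r :: real assume "0 < r"
            then obtain W where W: "openin T W" "h0 \<otimes> x \<in> W" "\<And>y. y \<in> W \<Longrightarrow> d (h0 \<otimes> x) y < r"
              using dsmall[of "h0 \<otimes> x" r] h0 True by auto
            have "limitin T (\<lambda>h. h \<otimes> x) (h0 \<otimes> x) (atin T h0)"
              using continuous_right[OF True] h0 unfolding continuous_map_atin topT by blast
            then have "\<forall>\<^sub>F h in atin T h0. h \<otimes> x \<in> W" using W(1,2) unfolding limitin_def by blast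
            then show "\<forall>\<^sub>F h in atin T h0. dist (\<beta> (translation H h x)) (\<beta> (translation H h0 x)) < r"
              using ev
            proof eventually_elim
              case (elim h)
              then show ?case using W(3)[of "h \<otimes> x"] True h0 d(3)[of "h \<otimes> x" "h0 \<otimes> x"] by (simp add: translation_def dist\<beta>)
            qed
          qed
        qed (simp add: translation_def)
      qed
    qed
    show "continuous_map (pointwise_topology S) T (inv_into (carrier H) \<theta>)"
      unfolding continuous_map_atin
    proof
      fix \<phi>0 assume "\<phi>0 \<in> topspace (pointwise_topology S)"
      then obtain h0 where h0: "h0 \<in> carrier H" "\<phi>0 = \<theta> h0" "\<phi>0 \<in> S" by (auto simp: S_def)
      have retr: "inv_into (carrier H) \<theta> (\<theta> h) = h" if "h \<in> carrier H" for h using inj that by simp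
      show "limitin T (inv_into (carrier H) \<theta>) (inv_into (carrier H) \<theta> \<phi>0) (atin (pointwise_topology S) \<phi>0)"
        unfolding limitin_def h0(2) retr[OF h0(1)] topT
      proof (intro conjI allI impI h0(1))
        fix W assume "openin T W \<and> h0 \<in> W"
        then obtain r where r: "0 < r" "\<And>y. y \<in> carrier H \<Longrightarrow> d h0 y < r \<Longrightarrow> y \<in> W" using dnbhd[of W h0] by blast
        have "\<forall>\<^sub>F \<phi> in atin (pointwise_topology S) \<phi>0. dist (\<phi> (\<beta> \<one>)) (\<phi>0 (\<beta> \<one>)) < r"
          by (rule tendstoD[OF pointwise_eval_tendsto[OF h0(3)] r(1)])
        then show "\<forall>\<^sub>F \<phi> in atin (pointwise_topology S) (\<theta> h0). inv_into (carrier H) \<theta> \<phi> \<in> W"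
          using eventually_topspace_atin[of "pointwise_topology S" \<phi>0] unfolding h0(2)
        proof eventually_elim
          case (elim \<phi>)
          then obtain h where h: "h \<in> carrier H" "\<phi> = \<theta> h" by (auto simp: S_def)
          then have "d h0 h < r" using elim(1) h0(1) d(3)[of h h0] by (simp add: \<theta>1 dist\<beta>)
          then show ?case using r(2)[OF h(1)] by (simp add: h retr)
        qed
      qed
    qed
    show "inv_into (carrier H) \<theta> (\<theta> h) = h" if "h \<in> topspace T" for h using that inj by (simp add: topT)
    show "\<theta> (inv_into (carrier H) \<theta> \<phi>) = \<phi>" if "\<phi> \<in> topspace (pointwise_topology S)" for \<phi>
      using that by (simp add: S_def f_inv_into_f)
  qed
  then have "homeomorphic_map T (subtopology (pointwise_topology (carrier Iso_L)) S) \<theta>"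
    unfolding subtop homeomorphic_map_maps by blast
  moreover have "\<theta> \<in> iso H (Iso_L\<lparr>carrier := S\<rparr>)"
    using \<theta>hom inj by (auto simp: iso_def hom_def bij_betw_def S_def)
  ultimately show ?thesis using S by blast
qed

end

theorem polish_group_embedding:
  fixes H :: "('a, 'b) monoid_scheme"
  assumes G: "gurarij_space TYPE('g::banach)" and H: "polish_group H T"
  shows "\<exists>S \<theta>. subgroup S (Iso_L :: ('g \<Rightarrow> 'g) monoid) \<and>
         \<theta> \<in> iso H (Iso_L\<lparr>carrier := S\<rparr>) \<and>
         homeomorphic_map T (subtopology (pointwise_topology (carrier Iso_L)) S) \<theta>"
proof -
  interpret topological_grp H T using H by unfold_locales (simp add: polish_group_def)
  show ?thesis
    using H by (intro embedding_into_Iso_L[OF G]) (auto simp: polish_group_def completely_metrizable_imp_metrizable_space)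
qed

theorem theorem3p10:
  assumes "gurarij_space TYPE('g::banach)"
  shows "polish_group (Iso_L :: ('g \<Rightarrow> 'g) monoid) (pointwise_topology (carrier Iso_L)) \<and>
    (\<forall>(H :: ('a, 'b) monoid_scheme) T. polish_group H T \<longrightarrow>
      (\<exists>S \<theta>. subgroup S (Iso_L :: ('g \<Rightarrow> 'g) monoid) \<and>
         \<theta> \<in> iso H (Iso_L\<lparr>carrier := S\<rparr>) \<and>
         homeomorphic_map T (subtopology (pointwise_topology (carrier Iso_L)) S) \<theta>)) \<and>
    (separable_space (euclidean :: 'e::real_normed_vector topology) \<longrightarrow>
      (\<exists>i :: 'e \<Rightarrow> 'g. linear i \<and> g_embedding i))"
proof -
  have "separable_space (euclidean :: 'g topology)" using assms by (simp add: gurarij_space_def)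
  then show ?thesis
    by (intro conjI allI impI polish_group_Iso_L polish_group_embedding[OF assms] separable_normed_g_embedding[OF assms])
qed


end
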